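(* If $s$ is a unitarily invariant CNP kernel on $\mathbb{B}_d$, then $s$ admits a characteristic function, i.e., every pure $1/s$-contraction admits a characteristic function.
   Context: All Hilbert spaces are complex; $d\ge1$; $\mathbb{B}_d$ is the open Euclidean unit ball of $\mathbb{C}^d$. Unitarily invariant CNP kernel: a reproducing kernel $s(\boldsymbol z,\boldsymbol w)=\sum_{n\ge0}a_n\langle\boldsymbol z,\boldsymbol w\rangle^n$ on $\mathbb{B}_d$ with $a_0=1$, $a_n>0$ for all $n$, whose reproducing kernel Hilbert space $H_s$ is an irreducible complete Nevanlinna-Pick space. By a known result this is equivalent to: the real numbers $b_n$ defined by $\sum_{n\ge1}b_nt^n=1-\frac1{\sum_{n\ge0}a_nt^n}$ (as power series near $t=0$) satisfy $b_n\ge0$ for all $n\ge1$. For such $s$ the multiplication operators $M_{z_i}$ by the coordinate functions are bounded on $H_s$ and $(M_{z_1},\dots,M_{z_d})$ is a $1/s$-contraction (known). Put $a_\alpha=a_{|\alpha|}\frac{|\alpha|!}{\alpha!}$ for $\alpha\in\mathbb{Z}_+^d$, $b_\alpha=b_{|\alpha|}\frac{|\alpha|!}{\alpha!}$ for $\alpha\in\mathbb{Z}_+^d\setminus\{0\}$. For a Hilbert space $\mathcal{E}$, $H_s\otimes\mathcal{E}$ is identified with the space of $\mathcal{E}$-valued holomorphic functions $\sum_\alpha c_\alpha\boldsymbol z^\alpha$ on $\mathbb{B}_d$ with $\sum_\alpha\|c_\alpha\|^2/a_\alpha<\infty$. $1/s$-contraction: a commuting $d$-tuple $\boldsymbol T$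 of bounded operators on a Hilbert space $\mathcal{H}$ such that $\sum_{\alpha\neq0}b_\alpha\boldsymbol T^\alpha(\boldsymbol T^\alpha)^*$ converges strongly and $I-\sum_{\alpha\ne0}b_\alpha\boldsymbol T^\alpha(\boldsymbol T^\alpha)^*\ge0$; $\Delta_{\boldsymbol T}$ is the positive square root of the latter operator. It is pure if $\sum_{\alpha\in\mathbb{Z}_+^d}a_\alpha\boldsymbol T^\alpha\Delta_{\boldsymbol T}^2(\boldsymbol T^\alpha)^*$ converges strongly to $I$. For a pure $1/s$-contraction $\boldsymbol T$, $V_{\boldsymbol T}:\mathcal{H}\to H_s\otimes\overline{\mathrm{Ran}}\,\Delta_{\boldsymbol T}$, $V_{\boldsymbol T}h=\sum_{\alpha}a_\alpha\boldsymbol z^\alpha\otimes\Delta_{\boldsymbol T}(\boldsymbol T^\alpha)^*h$, is a (well-defined) isometry. $\boldsymbol T$ admits a characteristic function if there are a Hilbert space $\mathcal{E}$ and a $\mathcal{B}(\mathcal{E},\overline{\mathrm{Ran}}\,\Delta_{\boldsymbol T})$-valued analytic function $\theta_{\boldsymbol T}$ on $\mathbb{B}_d$ such that multiplication by $\theta_{\boldsymbol T}$ defines a (bounded) operator $M_{\theta_{\boldsymbol T}}:H_s\otimes\mathcal{E}\to H_s\otimes\overline{\mathrm{Ran}}\,\Delta_{\boldsymbol T}$ with $I-V_{\boldsymbol T}V_{\boldsymbol T}^*=M_{\theta_{\boldsymbol T}}M_{\theta_{\boldsymbol T}}^*$. *)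

theory Defs
  imports
    "HOL-Analysis.Analysis"
    "HOL-Computational_Algebra.Formal_Power_Series"
begin

section \<open>Complex Hilbert spaces\<close>

text \<open>
  The inner product is linear in its first argument. The real inner product, the norm and the
  topology are those of the underlying real space, with \<open>inner x y = Re (cinner x y)\<close>.
\<close>

class complex_inner = real_inner +
  fixes scaleC :: "complex \<Rightarrow> 'a \<Rightarrow> 'a" (infixr \<open>*\<^sub>C\<close> 75)
    and cinner :: "'a \<Rightarrow> 'a \<Rightarrow> complex"
  assumes scaleC_add_right: "c *\<^sub>C (x + y) = c *\<^sub>C x + c *\<^sub>C y"
    and scaleC_add_left: "(c + d) *\<^sub>C x = c *\<^sub>C x + d *\<^sub>C x"
    and scaleC_scaleC: "c *\<^sub>C d *\<^sub>C x = (c * d) *\<^sub>C x"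
    and scaleR_scaleC: "r *\<^sub>R x = complex_of_real r *\<^sub>C x"
    and cinner_commute: "cinner x y = cnj (cinner y x)"
    and cinner_add_left: "cinner (x + y) z = cinner x z + cinner y z"
    and cinner_scaleC_left: "cinner (c *\<^sub>C x) y = c * cinner x y"
    and inner_eq_Re_cinner: "inner x y = Re (cinner x y)"

class chilbert_space = complex_inner + complete_space

instantiation complex :: chilbert_space
begin

definition scaleC_complex :: "complex \<Rightarrow> complex \<Rightarrow> complex"
  where "scaleC_complex c x = c * x"

definition cinner_complex :: "complex \<Rightarrow> complex \<Rightarrow> complex"
  where "cinner_complex x y = x * cnj y"

instance
  by intro_classes
    (auto simp: scaleC_complex_def cinner_complex_def algebra_simps scaleR_conv_of_real
      inner_complex_def)

end

lemma cinner_self: "cinner x x = complex_of_real ((norm x)\<^sup>2)"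
proof -
  have "Im (cinner x x) = 0"
    using cinner_commute[of x x] by (metis cnj.simps(2) neg_equal_zero)
  then show ?thesis
    by (simp add: complex_eq_iff power2_norm_eq_inner inner_eq_Re_cinner)
qed

lemma cinner_scaleC_right: "cinner x (c *\<^sub>C y) = cnj c * cinner x y"
  by (metis cinner_commute cinner_scaleC_left complex_cnj_mult)

lemma cinner_add_right: "cinner x (y + z) = cinner x y + cinner x z"
  by (metis cinner_commute cinner_add_left complex_cnj_add)

lemma norm_scaleC: "norm (c *\<^sub>C x) = cmod c * norm x"
proof -
  have "complex_of_real ((norm (c *\<^sub>C x))\<^sup>2) = complex_of_real ((cmod c * norm x)\<^sup>2)"
    unfolding cinner_self[symmetric] cinner_scaleC_left cinner_scaleC_right power_mult_distrib
    using complex_norm_square[of c] by (simp add: cinner_self mult.commute)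
  then have "(norm (c *\<^sub>C x))\<^sup>2 = (cmod c * norm x)\<^sup>2"
    using of_real_eq_iff by blast
  then show ?thesis
    by (simp add: power2_eq_iff_nonneg)
qed

lemma norm_cinner_le: "cmod (cinner x y) \<le> norm x * norm y"
proof (cases "cinner x y = 0")
  case False
  define c where "c = cnj (cinner x y) / complex_of_real (cmod (cinner x y))"
  have c: "cmod c = 1"
    using False by (simp add: c_def norm_divide)
  have "c * cinner x y = complex_of_real (cmod (cinner x y))"
    using False complex_norm_square[of "cinner x y"]
    by (simp add: c_def mult.commute power2_eq_square nonzero_divide_eq_eq)
  then have "cmod (cinner x y) = inner (c *\<^sub>C x) y"
    by (simp add: inner_eq_Re_cinner cinner_scaleC_left)
  also have "\<dots> \<le> norm (c *\<^sub>C x) * norm y"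
    by (rule norm_cauchy_schwarz)
  finally show ?thesis
    by (simp add: norm_scaleC c)
qed auto


section \<open>Square-summable families\<close>

text \<open>
  \<open>('i, 'h) ell2\<close> is the Hilbert space tensor product of the scalar space of square-summable
  families over \<open>'i\<close> with \<open>'h\<close>. HOL cannot quantify existentially over types; closed subspaces of
  \<open>('d multi_index, 'h) ell2\<close> serve as the range of quantification for the coefficient space \<open>E\<close> of a
  characteristic function. No generality is lost: only the closed span \<open>E\<^sub>0\<close> of the ranges of
  all \<open>\<theta>(z)\<^sup>*\<close> matters for \<open>M\<^sub>\<theta> M\<^sub>\<theta>\<^sup>*\<close>, and since \<open>\<theta>\<close> is determined by countably many Taylor
  coefficients, \<open>E\<^sub>0\<close> embeds isometrically.
\<close>

typedef (overloaded) ('i, 'h) ell2 =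
  "{x :: 'i \<Rightarrow> 'h::complex_inner. (\<lambda>i. (norm (x i))\<^sup>2) summable_on UNIV}"
  morphisms ell2_nth Abs_ell2
  by (rule exI[of _ "\<lambda>_. 0"]) simp

setup_lifting type_definition_ell2

lemma ell2_add_summable:
  fixes x y :: "'i \<Rightarrow> 'h::complex_inner"
  assumes "(\<lambda>i. (norm (x i))\<^sup>2) summable_on UNIV" "(\<lambda>i. (norm (y i))\<^sup>2) summable_on UNIV"
  shows "(\<lambda>i. (norm (x i + y i))\<^sup>2) summable_on UNIV"
proof (rule summable_on_comparison_test)
  show "(\<lambda>i. 2 * ((norm (x i))\<^sup>2 + (norm (y i))\<^sup>2)) summable_on UNIV"
    using assms by (intro summable_on_cmult_right summable_on_add)
  show "(norm (x i + y i))\<^sup>2 \<le> 2 * ((norm (x i))\<^sup>2 + (norm (y i))\<^sup>2)" for i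
  proof -
    have "(norm (x i + y i))\<^sup>2 \<le> (norm (x i) + norm (y i))\<^sup>2"
      by (intro power_mono norm_triangle_ineq) simp
    also have "\<dots> \<le> 2 * ((norm (x i))\<^sup>2 + (norm (y i))\<^sup>2)"
      using sum_squares_bound[of "norm (x i)" "norm (y i)"] by (simp add: power2_sum)
    finally show ?thesis .
  qed
qed simp

lemma ell2_scale_summable:
  fixes x :: "'i \<Rightarrow> 'h::complex_inner"
  assumes "(\<lambda>i. (norm (x i))\<^sup>2) summable_on UNIV"
  shows "(\<lambda>i. (norm (c *\<^sub>C x i))\<^sup>2) summable_on UNIV"
  using summable_on_cmult_right[OF assms, of "(cmod c)\<^sup>2"]
  by (simp add: norm_scaleC power_mult_distrib)

lemma ell2_cinner_abs_summable:
  fixes x y :: "'i \<Rightarrow> 'h::complex_inner"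
  assumes "(\<lambda>i. (norm (x i))\<^sup>2) summable_on UNIV" "(\<lambda>i. (norm (y i))\<^sup>2) summable_on UNIV"
  shows "(\<lambda>i. cmod (cinner (x i) (y i))) summable_on UNIV"
proof (rule summable_on_comparison_test)
  show "(\<lambda>i. (norm (x i))\<^sup>2 + (norm (y i))\<^sup>2) summable_on UNIV"
    using assms by (intro summable_on_add)
  show "cmod (cinner (x i) (y i)) \<le> (norm (x i))\<^sup>2 + (norm (y i))\<^sup>2" for i
  proof -
    have "2 * (norm (x i) * norm (y i)) \<le> (norm (x i))\<^sup>2 + (norm (y i))\<^sup>2"
      using sum_squares_bound[of "norm (x i)" "norm (y i)"] by simp
    moreover have "0 \<le> norm (x i) * norm (y i)" by simp
    ultimately show ?thesis
      using norm_cinner_le[of "x i" "y i"] by linarith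
  qed
qed simp

lemma ell2_infsum_cinner_self:
  fixes x :: "'i \<Rightarrow> 'h::complex_inner"
  assumes "(\<lambda>i. (norm (x i))\<^sup>2) summable_on UNIV"
  shows "(\<Sum>\<^sub>\<infinity>i. cinner (x i) (x i)) = complex_of_real (\<Sum>\<^sub>\<infinity>i. (norm (x i))\<^sup>2)"
  unfolding cinner_self by (intro infsumI has_sum_of_real has_sum_infsum assms)

instantiation ell2 :: (type, complex_inner) complex_inner
begin

lift_definition zero_ell2 :: "('a, 'b) ell2" is "\<lambda>_. 0" by simp

lift_definition plus_ell2 :: "('a, 'b) ell2 \<Rightarrow> ('a, 'b) ell2 \<Rightarrow> ('a, 'b) ell2"
  is "\<lambda>x y i. x i + y i" by (rule ell2_add_summable)

lift_definition uminus_ell2 :: "('a, 'b) ell2 \<Rightarrow> ('a, 'b) ell2"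
  is "\<lambda>x i. - x i" by simp

lift_definition minus_ell2 :: "('a, 'b) ell2 \<Rightarrow> ('a, 'b) ell2 \<Rightarrow> ('a, 'b) ell2"
  is "\<lambda>x y i. x i - y i"
  subgoal for x y using ell2_add_summable[of x "\<lambda>i. - y i"] by simp
  done

lift_definition scaleC_ell2 :: "complex \<Rightarrow> ('a, 'b) ell2 \<Rightarrow> ('a, 'b) ell2"
  is "\<lambda>c x i. c *\<^sub>C x i" by (rule ell2_scale_summable)

lift_definition scaleR_ell2 :: "real \<Rightarrow> ('a, 'b) ell2 \<Rightarrow> ('a, 'b) ell2"
  is "\<lambda>c x i. c *\<^sub>R x i" unfolding scaleR_scaleC by (rule ell2_scale_summable)

lift_definition cinner_ell2 :: "('a, 'b) ell2 \<Rightarrow> ('a, 'b) ell2 \<Rightarrow> complex"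
  is "\<lambda>x y. \<Sum>\<^sub>\<infinity>i. cinner (x i) (y i)" .

definition inner_ell2 :: "('a, 'b) ell2 \<Rightarrow> ('a, 'b) ell2 \<Rightarrow> real"
  where "inner_ell2 x y = Re (cinner x y)"

definition norm_ell2 :: "('a, 'b) ell2 \<Rightarrow> real"
  where "norm_ell2 x = sqrt (inner x x)"

definition sgn_ell2 :: "('a, 'b) ell2 \<Rightarrow> ('a, 'b) ell2"
  where "sgn_ell2 x = inverse (norm x) *\<^sub>R x"

definition dist_ell2 :: "('a, 'b) ell2 \<Rightarrow> ('a, 'b) ell2 \<Rightarrow> real"
  where "dist_ell2 x y = norm (x - y)"

definition uniformity_ell2 :: "(('a, 'b) ell2 \<times> ('a, 'b) ell2) filter"
  where "uniformity_ell2 = (INF e\<in>{0 <..}. principal {(x, y). dist x y < e})"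

definition open_ell2 :: "('a, 'b) ell2 set \<Rightarrow> bool"
  where "open_ell2 U = (\<forall>x\<in>U. eventually (\<lambda>(x', y). x' = x \<longrightarrow> y \<in> U) uniformity)"

instance
proof
  fix x y z :: "('a, 'b) ell2" and r s :: real and c d :: complex
  show "x + y + z = x + (y + z)" by transfer (simp add: add.assoc)
  show "x + y = y + x" by transfer (simp add: add.commute)
  show "0 + x = x" by transfer simp
  show "- x + x = 0" by transfer simp
  show "x - y = x + - y" by transfer simp
  show "r *\<^sub>R (x + y) = r *\<^sub>R x + r *\<^sub>R y" by transfer (simp add: scaleR_add_right)
  show "(r + s) *\<^sub>R x = r *\<^sub>R x + s *\<^sub>R x" by transfer (simp add: scaleR_add_left)
  show "r *\<^sub>R s *\<^sub>R x = (r * s) *\<^sub>R x" by transfer simp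
  show "1 *\<^sub>R x = x" by transfer simp
  show "dist x y = norm (x - y)" by (rule dist_ell2_def)
  show "sgn x = inverse (norm x) *\<^sub>R x" by (rule sgn_ell2_def)
  show "(uniformity :: (('a, 'b) ell2 \<times> ('a, 'b) ell2) filter)
      = (INF e\<in>{0 <..}. principal {(x, y). dist x y < e})" by (rule uniformity_ell2_def)
  show "open U = (\<forall>x\<in>U. eventually (\<lambda>(x', y). x' = x \<longrightarrow> y \<in> U) uniformity)"
    for U :: "('a, 'b) ell2 set" by (rule open_ell2_def)
  show comm: "cinner x y = cnj (cinner y x)" for x y :: "('a, 'b) ell2"
  proof transfer
    fix x y :: "'a \<Rightarrow> 'b"
    have "(\<lambda>i. cinner (x i) (y i)) = (\<lambda>i. cnj (cinner (y i) (x i)))"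
      using cinner_commute by blast
    then show "(\<Sum>\<^sub>\<infinity>i. cinner (x i) (y i)) = cnj (\<Sum>\<^sub>\<infinity>i. cinner (y i) (x i))"
      by (simp only: infsum_cnj)
  qed
  show add: "cinner (x + y) z = cinner x z + cinner y z" for x y z :: "('a, 'b) ell2"
    by transfer (simp add: cinner_add_left infsum_add abs_summable_summable
        ell2_cinner_abs_summable)
  show sc: "cinner (c *\<^sub>C x) y = c * cinner x y" for x y :: "('a, 'b) ell2" and c
    by transfer (simp add: cinner_scaleC_left infsum_cmult_right')
  show RC: "r *\<^sub>R x = complex_of_real r *\<^sub>C x" for x :: "('a, 'b) ell2" and r
    by transfer (simp add: scaleR_scaleC)
  show "inner x y = inner y x"
    unfolding inner_ell2_def using comm[of x y] by simp
  show "inner (x + y) z = inner x z + inner y z"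
    unfolding inner_ell2_def by (simp add: add)
  show "inner (r *\<^sub>R x) y = r * inner x y"
    unfolding inner_ell2_def by (simp add: RC sc)
  have self: "inner x x = (\<Sum>\<^sub>\<infinity>i. (norm (ell2_nth x i))\<^sup>2)"
    unfolding inner_ell2_def cinner_ell2.rep_eq using ell2_nth[of x]
    by (subst ell2_infsum_cinner_self) auto
  show "0 \<le> inner x x"
    unfolding self by (rule infsum_nonneg) simp
  show "inner x x = 0 \<longleftrightarrow> x = 0"
  proof
    assume "inner x x = 0"
    then have "norm (ell2_nth x i) ^ 2 = 0" for i
      unfolding self using ell2_nth[of x]
      by (intro nonneg_infsum_le_0D[where A = UNIV]) auto
    then show "x = 0" by transfer auto
  next
    assume "x = 0"
    then show "inner x x = 0" unfolding self by (simp add: zero_ell2.rep_eq)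
  qed
  show "norm x = sqrt (inner x x)" by (rule norm_ell2_def)
  show "c *\<^sub>C (x + y) = c *\<^sub>C x + c *\<^sub>C y" by transfer (simp add: scaleC_add_right)
  show "(c + d) *\<^sub>C x = c *\<^sub>C x + d *\<^sub>C x" by transfer (simp add: scaleC_add_left)
  show "c *\<^sub>C d *\<^sub>C x = (c * d) *\<^sub>C x" by transfer (simp add: scaleC_scaleC)
  show "inner x y = Re (cinner x y)" by (rule inner_ell2_def)
qed

end

lemma norm_ell2_sq: "(norm x)\<^sup>2 = (\<Sum>\<^sub>\<infinity>i. (norm (ell2_nth x i))\<^sup>2)"
  unfolding power2_norm_eq_inner[of x] inner_eq_Re_cinner[of x] cinner_ell2.rep_eq
  using ell2_nth[of x] by (subst ell2_infsum_cinner_self) auto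

lemma ell2_sum_le: "finite F \<Longrightarrow> (\<Sum>i\<in>F. (norm (ell2_nth x i))\<^sup>2) \<le> (norm x)\<^sup>2"
  unfolding norm_ell2_sq using ell2_nth[of x] by (intro finite_sum_le_infsum) auto

lemma norm_ell2_nth_le: "norm (ell2_nth x i) \<le> norm x"
  using ell2_sum_le[of "{i}" x] by (auto intro: power2_le_imp_le)

instance ell2 :: (type, chilbert_space) chilbert_space
proof
  fix X :: "nat \<Rightarrow> ('a, 'b) ell2"
  assume X: "Cauchy X"
  have "Cauchy (\<lambda>n. ell2_nth (X n) i)" for i
  proof (rule CauchyI)
    fix e :: real assume "0 < e"
    then obtain M where M: "\<And>m n. m \<ge> M \<Longrightarrow> n \<ge> M \<Longrightarrow> norm (X m - X n) < e"
      using CauchyD[OF X] by blast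
    then show "\<exists>M. \<forall>m\<ge>M. \<forall>n\<ge>M. norm (ell2_nth (X m) i - ell2_nth (X n) i) < e"
      using norm_ell2_nth_le[of "X m - X n" i for m n]
      by (metis minus_ell2.rep_eq le_less_trans)
  qed
  then have "\<forall>i. \<exists>l. (\<lambda>n. ell2_nth (X n) i) \<longlonglongrightarrow> l"
    by (simp add: Cauchy_convergent_iff flip: convergent_def)
  then obtain L where L: "\<And>i. (\<lambda>n. ell2_nth (X n) i) \<longlonglongrightarrow> L i"
    by (rule choice[THEN exE]) blast
  have bound: "(\<Sum>i\<in>F. (norm (ell2_nth (X m) i - L i))\<^sup>2) \<le> e\<^sup>2"
    if "finite F" "\<And>n. n \<ge> M \<Longrightarrow> norm (X m - X n) < e" for F m M e
  proof (rule tendsto_upperbound)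
    show "(\<lambda>n. \<Sum>i\<in>F. (norm (ell2_nth (X m) i - ell2_nth (X n) i))\<^sup>2)
        \<longlonglongrightarrow> (\<Sum>i\<in>F. (norm (ell2_nth (X m) i - L i))\<^sup>2)"
      by (intro tendsto_intros L)
    show "eventually (\<lambda>n. (\<Sum>i\<in>F. (norm (ell2_nth (X m) i - ell2_nth (X n) i))\<^sup>2) \<le> e\<^sup>2)
        sequentially"
      using eventually_ge_at_top[of M]
    proof eventually_elim
      case (elim n)
      have "(\<Sum>i\<in>F. (norm (ell2_nth (X m) i - ell2_nth (X n) i))\<^sup>2) \<le> (norm (X m - X n))\<^sup>2"
        using ell2_sum_le[OF that(1), of "X m - X n"] by (simp add: minus_ell2.rep_eq)
      also have "\<dots> \<le> e\<^sup>2"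
        using that(2)[OF elim] by (intro power_mono) auto
      finally show ?case .
    qed
  qed simp
  have diff: "(\<lambda>i. (norm (ell2_nth (X m) i - L i))\<^sup>2) summable_on UNIV"
    if "\<And>n. n \<ge> M \<Longrightarrow> norm (X m - X n) < e" for m M e
    using bound[OF _ that] by (intro nonneg_bdd_above_summable_on bdd_aboveI2[where M = "e\<^sup>2"]) auto
  obtain M0 where M0: "\<And>m n. m \<ge> M0 \<Longrightarrow> n \<ge> M0 \<Longrightarrow> norm (X m - X n) < 1"
    using CauchyD[OF X zero_less_one] by blast
  have "(\<lambda>i. (norm (ell2_nth (X M0) i + - (ell2_nth (X M0) i - L i)))\<^sup>2) summable_on UNIV"
    using ell2_nth[of "X M0"] diff[of M0 M0 1] M0
    by (intro ell2_add_summable) (auto simp: norm_minus_commute)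
  then have "(\<lambda>i. (norm (L i))\<^sup>2) summable_on UNIV" by simp
  then obtain Y where Y: "ell2_nth Y = L"
    using Abs_ell2_inverse[of L] by auto
  have "X \<longlonglongrightarrow> Y"
  proof (rule LIMSEQ_I)
    fix e :: real assume "0 < e"
    then obtain M where M: "\<And>m n. m \<ge> M \<Longrightarrow> n \<ge> M \<Longrightarrow> norm (X m - X n) < e / 2"
      using CauchyD[OF X, of "e / 2"] by auto
    have "norm (X m - Y) < e" if "m \<ge> M" for m
    proof -
      have "(\<lambda>i. (norm (ell2_nth (X m) i - L i))\<^sup>2) summable_on UNIV"
        using M[OF that] by (rule diff)
      moreover have "(\<Sum>i\<in>F. (norm (ell2_nth (X m) i - L i))\<^sup>2) \<le> (e / 2)\<^sup>2" if "finite F" for F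
        using that M[OF \<open>m \<ge> M\<close>] by (rule bound)
      ultimately have "(norm (X m - Y))\<^sup>2 \<le> (e / 2)\<^sup>2"
        unfolding norm_ell2_sq minus_ell2.rep_eq Y by (intro infsum_le_finite_sums) auto
      then have "norm (X m - Y) \<le> e / 2"
        by (rule power2_le_imp_le) (use \<open>0 < e\<close> in simp)
      then show ?thesis using \<open>0 < e\<close> by simp
    qed
    then show "\<exists>M. \<forall>m\<ge>M. norm (X m - Y) < e" by blast
  qed
  then show "convergent X" by (auto simp: convergent_def)
qed


section \<open>Operators on complex Hilbert spaces\<close>

definition bounded_clinear :: "('x::complex_inner \<Rightarrow> 'y::complex_inner) \<Rightarrow> bool"
  where "bounded_clinear A \<longleftrightarrow> bounded_linear A \<and> (\<forall>c x. A (c *\<^sub>C x) = c *\<^sub>C A x)"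

definition closed_csubspace :: "'x::complex_inner set \<Rightarrow> bool"
  where "closed_csubspace E \<longleftrightarrow> closed E \<and> 0 \<in> E \<and>
    (\<forall>x\<in>E. \<forall>y\<in>E. x + y \<in> E) \<and> (\<forall>c. \<forall>x\<in>E. c *\<^sub>C x \<in> E)"

definition orthogonal_compl :: "'x::complex_inner set \<Rightarrow> 'x set"
  where "orthogonal_compl E = {x. \<forall>y\<in>E. cinner x y = 0}"

text \<open>
  For closed subspaces \<open>E\<close> and \<open>F\<close>, extension by zero on the orthogonal complement of \<open>E\<close>
  identifies the bounded operators from \<open>E\<close> to \<open>F\<close> isometrically with this set of operators
  between the ambient spaces.
\<close>

definition bounded_ops :: "'x::complex_inner set \<Rightarrow> 'y::complex_inner set \<Rightarrow> ('x \<Rightarrow>\<^sub>L 'y) set"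
  where "bounded_ops E F = {A. bounded_clinear (blinfun_apply A) \<and>
    (\<forall>x\<in>E. blinfun_apply A x \<in> F) \<and> (\<forall>x\<in>orthogonal_compl E. blinfun_apply A x = 0)}"

text \<open>
  The adjoint of an operator \<open>S\<close> from the Hilbert space with carrier \<open>X\<close> and inner product
  \<open>ipX\<close> into a Hilbert space with inner product \<open>ipY\<close>.
\<close>

definition adjoint_on ::
    "'x set \<Rightarrow> ('x \<Rightarrow> 'x \<Rightarrow> complex) \<Rightarrow> ('y \<Rightarrow> 'y \<Rightarrow> complex) \<Rightarrow> ('x \<Rightarrow> 'y) \<Rightarrow> 'y \<Rightarrow> 'x"
  where "adjoint_on X ipX ipY S y = (THE x. x \<in> X \<and> (\<forall>u\<in>X. ipY (S u) y = ipX u x))"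

abbreviation cadjoint :: "('x::chilbert_space \<Rightarrow> 'y::chilbert_space) \<Rightarrow> 'y \<Rightarrow> 'x"
  where "cadjoint \<equiv> adjoint_on UNIV cinner cinner"

definition positive_op :: "('x::complex_inner \<Rightarrow> 'x) \<Rightarrow> bool"
  where "positive_op A \<longleftrightarrow> bounded_clinear A \<and> (\<forall>x. cinner (A x) x \<in> \<real>\<^sub>\<ge>\<^sub>0)"

definition positive_sqrt :: "('x::complex_inner \<Rightarrow> 'x) \<Rightarrow> 'x \<Rightarrow> 'x"
  where "positive_sqrt A = (SOME D. positive_op D \<and> D \<circ> D = A)"


section \<open>Multi-indices and the space \<open>H\<^sub>s \<otimes> E\<close>\<close>

type_synonym 'd multi_index = "'d \<Rightarrow> nat"

definition total_degree :: "'d::finite multi_index \<Rightarrow> nat"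
  where "total_degree \<alpha> = (\<Sum>i\<in>UNIV. \<alpha> i)"

text \<open>\<open>a\<^sub>\<alpha> = a\<^bsub>|\<alpha>|\<^esub> |\<alpha>|! / \<alpha>!\<close>\<close>

definition multi_coeff :: "(nat \<Rightarrow> real) \<Rightarrow> 'd::finite multi_index \<Rightarrow> real"
  where "multi_coeff a \<alpha> = a (total_degree \<alpha>) * fact (total_degree \<alpha>) / (\<Prod>i\<in>UNIV. fact (\<alpha> i))"

definition monomial :: "complex ^ 'd::finite \<Rightarrow> 'd multi_index \<Rightarrow> complex"
  where "monomial z \<alpha> = (\<Prod>i\<in>UNIV. z $ i ^ \<alpha> i)"

text \<open>
  An element \<open>\<Sum>\<^sub>\<alpha> c\<^sub>\<alpha> z\<^sup>\<alpha>\<close> of \<open>H\<^sub>s \<otimes> E\<close> is represented by its coefficient family \<open>c\<close>; \<open>Hs_value c\<close>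
  is the corresponding \<open>E\<close>-valued function on the unit ball. The sequence \<open>a\<close> consists of the
  Taylor coefficients of \<open>s\<close>, and \<open>H\<^sub>s\<close> itself is \<open>Hs a (UNIV :: complex set)\<close>.
\<close>

definition Hs :: "(nat \<Rightarrow> real) \<Rightarrow> 'e::chilbert_space set \<Rightarrow> ('d::finite multi_index \<Rightarrow> 'e) set"
  where "Hs a E = {c. (\<forall>\<alpha>. c \<alpha> \<in> E) \<and> (\<lambda>\<alpha>. (norm (c \<alpha>))\<^sup>2 / multi_coeff a \<alpha>) summable_on UNIV}"

definition Hs_inner :: "(nat \<Rightarrow> real) \<Rightarrow> ('d::finite multi_index \<Rightarrow> 'e::chilbert_space)
    \<Rightarrow> ('d multi_index \<Rightarrow> 'e) \<Rightarrow> complex"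
  where "Hs_inner a c c' = (\<Sum>\<^sub>\<infinity>\<alpha>. cinner (c \<alpha>) (c' \<alpha>) / complex_of_real (multi_coeff a \<alpha>))"

definition Hs_norm :: "(nat \<Rightarrow> real) \<Rightarrow> ('d::finite multi_index \<Rightarrow> 'e::chilbert_space) \<Rightarrow> real"
  where "Hs_norm a c = sqrt (\<Sum>\<^sub>\<infinity>\<alpha>. (norm (c \<alpha>))\<^sup>2 / multi_coeff a \<alpha>)"

definition Hs_value :: "('d::finite multi_index \<Rightarrow> 'e::chilbert_space) \<Rightarrow> complex ^ 'd \<Rightarrow> 'e"
  where "Hs_value c z = (\<Sum>\<^sub>\<infinity>\<alpha>. monomial z \<alpha> *\<^sub>C c \<alpha>)"


section \<open>Unitarily invariant complete Nevanlinna-Pick kernels\<close>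

definition herm :: "complex ^ 'd::finite \<Rightarrow> complex ^ 'd \<Rightarrow> complex"
  where "herm z w = (\<Sum>i\<in>UNIV. z $ i * cnj (w $ i))"

text \<open>
  Matrix-valued functions are given by their entries \<open>\<Phi> z i k\<close> with \<open>i < m\<close>, \<open>k < n\<close>.
  Multiplication by \<open>\<Phi>\<close> maps \<open>H\<^sub>s \<otimes> \<complex>\<^sup>n\<close> contractively into \<open>H\<^sub>s \<otimes> \<complex>\<^sup>m\<close>.
\<close>

definition contractive_multiplier ::
    "(nat \<Rightarrow> real) \<Rightarrow> nat \<Rightarrow> nat \<Rightarrow> (complex ^ 'd::finite \<Rightarrow> nat \<Rightarrow> nat \<Rightarrow> complex) \<Rightarrow> bool"
  where "contractive_multiplier a m n \<Phi> \<longleftrightarrow>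
    (\<forall>f :: nat \<Rightarrow> 'd multi_index \<Rightarrow> complex. (\<forall>k<n. f k \<in> Hs a UNIV) \<longrightarrow>
      (\<exists>g. (\<forall>i<m. g i \<in> Hs a UNIV) \<and>
        (\<forall>z\<in>ball 0 1. \<forall>i<m. Hs_value (g i) z = (\<Sum>k<n. \<Phi> z i k * Hs_value (f k) z)) \<and>
        (\<Sum>i<m. (Hs_norm a (g i))\<^sup>2) \<le> (\<Sum>k<n. (Hs_norm a (f k))\<^sup>2)))"

text \<open>
  The complete Pick property: for all \<open>m\<close>, \<open>n\<close>, whenever the \<open>Nm \<times> Nm\<close> block matrix
  \<open>[(I - W\<^sub>p W\<^sub>q\<^sup>*) s(x\<^sub>p, x\<^sub>q)]\<close> is positive semidefinite, there is a contractive multiplier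
  taking the value \<open>W\<^sub>p\<close> at \<open>x\<^sub>p\<close> for every \<open>p\<close>.
\<close>

definition complete_Pick ::
    "(complex ^ 'd::finite \<Rightarrow> complex ^ 'd \<Rightarrow> complex) \<Rightarrow> (nat \<Rightarrow> real) \<Rightarrow> bool"
  where "complete_Pick s a \<longleftrightarrow>
    (\<forall>m n N (x :: nat \<Rightarrow> complex ^ 'd) (W :: nat \<Rightarrow> nat \<Rightarrow> nat \<Rightarrow> complex).
      inj_on x {..<N} \<and> x ` {..<N} \<subseteq> ball 0 1 \<and>
      (\<forall>v :: nat \<Rightarrow> nat \<Rightarrow> complex.
        (\<Sum>p<N. \<Sum>q<N. \<Sum>i<m. \<Sum>j<m. cnj (v p i) *
          ((of_bool (i = j) - (\<Sum>k<n. W p i k * cnj (W q j k))) * s (x p) (x q)) * v q j)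
        \<in> \<real>\<^sub>\<ge>\<^sub>0) \<longrightarrow>
      (\<exists>\<Phi>. contractive_multiplier a m n \<Phi> \<and> (\<forall>p<N. \<forall>i<m. \<forall>k<n. \<Phi> (x p) i k = W p i k)))"

definition irreducible_kernel :: "(complex ^ 'd::finite \<Rightarrow> complex ^ 'd \<Rightarrow> complex) \<Rightarrow> bool"
  where "irreducible_kernel s \<longleftrightarrow>
    (\<forall>z\<in>ball 0 1. \<forall>w\<in>ball 0 1. s z w \<noteq> 0) \<and>
    (\<forall>v\<in>ball 0 1. \<forall>w\<in>ball 0 1. v \<noteq> w \<longrightarrow>
      (\<forall>c d. (\<forall>z\<in>ball 0 1. c * s z v + d * s z w = 0) \<longrightarrow> c = 0 \<and> d = 0))"

definition unitarily_invariant_CNP_kernel ::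
    "(complex ^ 'd::finite \<Rightarrow> complex ^ 'd \<Rightarrow> complex) \<Rightarrow> (nat \<Rightarrow> real) \<Rightarrow> bool"
  where "unitarily_invariant_CNP_kernel s a \<longleftrightarrow>
    a 0 = 1 \<and> (\<forall>n. a n > 0) \<and>
    (\<forall>z\<in>ball 0 1. \<forall>w\<in>ball 0 1. (\<lambda>n. complex_of_real (a n) * herm z w ^ n) sums s z w) \<and>
    irreducible_kernel s \<and> complete_Pick s a"

text \<open>\<open>\<Sum>\<^bsub>n\<ge>1\<^esub> b\<^sub>n t\<^sup>n = 1 - 1 / \<Sum>\<^bsub>n\<ge>0\<^esub> a\<^sub>n t\<^sup>n\<close>\<close>

definition reciprocal_coeff :: "(nat \<Rightarrow> real) \<Rightarrow> nat \<Rightarrow> real"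
  where "reciprocal_coeff a n = fps_nth (1 - inverse (Abs_fps a)) n"


section \<open>\<open>1/s\<close>-contractions\<close>

text \<open>
  The fold does not depend on an order of the index type because it is only used for commuting
  tuples.
\<close>

definition op_power :: "('d::finite \<Rightarrow> 'h \<Rightarrow> 'h) \<Rightarrow> 'd multi_index \<Rightarrow> 'h \<Rightarrow> 'h"
  where "op_power T \<alpha> = Finite_Set.fold (\<lambda>i S. (T i ^^ \<alpha> i) \<circ> S) id UNIV"

definition defect_term :: "(nat \<Rightarrow> real) \<Rightarrow> ('d::finite \<Rightarrow> 'h::chilbert_space \<Rightarrow> 'h)
    \<Rightarrow> 'd multi_index \<Rightarrow> 'h \<Rightarrow> 'h"
  where "defect_term a T \<alpha> h =
    multi_coeff (reciprocal_coeff a) \<alpha> *\<^sub>R op_power T \<alpha> (cadjoint (op_power T \<alpha>) h)"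

definition defect :: "(nat \<Rightarrow> real) \<Rightarrow> ('d::finite \<Rightarrow> 'h::chilbert_space \<Rightarrow> 'h) \<Rightarrow> 'h \<Rightarrow> 'h"
  where "defect a T h = h - (\<Sum>\<^sub>\<infinity>\<alpha>\<in>{\<alpha>. \<alpha> \<noteq> (\<lambda>_. 0)}. defect_term a T \<alpha> h)"

definition Delta :: "(nat \<Rightarrow> real) \<Rightarrow> ('d::finite \<Rightarrow> 'h::chilbert_space \<Rightarrow> 'h) \<Rightarrow> 'h \<Rightarrow> 'h"
  where "Delta a T = positive_sqrt (defect a T)"

definition inv_s_contraction :: "(nat \<Rightarrow> real) \<Rightarrow> ('d::finite \<Rightarrow> 'h::chilbert_space \<Rightarrow> 'h) \<Rightarrow> bool"
  where "inv_s_contraction a T \<longleftrightarrow>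
    (\<forall>i. bounded_clinear (T i)) \<and> (\<forall>i j. T i \<circ> T j = T j \<circ> T i) \<and>
    (\<forall>h. (\<lambda>\<alpha>. defect_term a T \<alpha> h) summable_on {\<alpha>. \<alpha> \<noteq> (\<lambda>_. 0)}) \<and>
    positive_op (defect a T)"

definition pure_inv_s_contraction ::
    "(nat \<Rightarrow> real) \<Rightarrow> ('d::finite \<Rightarrow> 'h::chilbert_space \<Rightarrow> 'h) \<Rightarrow> bool"
  where "pure_inv_s_contraction a T \<longleftrightarrow> inv_s_contraction a T \<and>
    (\<forall>h. ((\<lambda>\<alpha>. multi_coeff a \<alpha> *\<^sub>R
      op_power T \<alpha> ((Delta a T ^^ 2) (cadjoint (op_power T \<alpha>) h))) has_sum h) UNIV)"


section \<open>Characteristic functions\<close>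

definition defect_space ::
    "(nat \<Rightarrow> real) \<Rightarrow> ('d::finite \<Rightarrow> 'h::chilbert_space \<Rightarrow> 'h) \<Rightarrow> 'h set"
  where "defect_space a T = closure (range (Delta a T))"

definition V_op :: "(nat \<Rightarrow> real) \<Rightarrow> ('d::finite \<Rightarrow> 'h::chilbert_space \<Rightarrow> 'h)
    \<Rightarrow> 'h \<Rightarrow> 'd multi_index \<Rightarrow> 'h"
  where "V_op a T h = (\<lambda>\<alpha>. multi_coeff a \<alpha> *\<^sub>R Delta a T (cadjoint (op_power T \<alpha>) h))"

definition analytic_on_ball ::
    "(complex ^ 'd::finite \<Rightarrow> 'e::chilbert_space \<Rightarrow>\<^sub>L 'f::chilbert_space) \<Rightarrow> bool"
  where "analytic_on_ball \<theta> \<longleftrightarrow> (\<forall>z\<in>ball 0 1. \<exists>D. (\<theta> has_derivative D) (at z) \<and>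
    (\<forall>c x e. blinfun_apply (D (c *s x)) e = c *\<^sub>C blinfun_apply (D x) e))"

definition mult_op :: "(nat \<Rightarrow> real) \<Rightarrow> 'f::chilbert_space set
    \<Rightarrow> (complex ^ 'd::finite \<Rightarrow> 'e::chilbert_space \<Rightarrow>\<^sub>L 'f)
    \<Rightarrow> ('d multi_index \<Rightarrow> 'e) \<Rightarrow> 'd multi_index \<Rightarrow> 'f"
  where "mult_op a F \<theta> f = (THE g. g \<in> Hs a F \<and>
    (\<forall>z\<in>ball 0 1. Hs_value g z = blinfun_apply (\<theta> z) (Hs_value f z)))"

definition bounded_multiplier :: "(nat \<Rightarrow> real) \<Rightarrow> 'e::chilbert_space set
    \<Rightarrow> 'f::chilbert_space set \<Rightarrow> (complex ^ 'd::finite \<Rightarrow> 'e \<Rightarrow>\<^sub>L 'f) \<Rightarrow> bool"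
  where "bounded_multiplier a E F \<theta> \<longleftrightarrow>
    (\<forall>f\<in>Hs a E. \<exists>g\<in>Hs a F. \<forall>z\<in>ball 0 1. Hs_value g z = blinfun_apply (\<theta> z) (Hs_value f z)) \<and>
    (\<exists>C. \<forall>f\<in>Hs a E. Hs_norm a (mult_op a F \<theta> f) \<le> C * Hs_norm a f)"

text \<open>\<open>I - V V\<^sup>* = M\<^sub>\<theta> M\<^sub>\<theta>\<^sup>*\<close> is an identity of operators on \<open>Hs a (defect_space a T)\<close>.\<close>

definition characteristic_function ::
    "(nat \<Rightarrow> real) \<Rightarrow> ('d::finite \<Rightarrow> 'h::chilbert_space \<Rightarrow> 'h) \<Rightarrow> 'e::chilbert_space set
    \<Rightarrow> (complex ^ 'd \<Rightarrow> 'e \<Rightarrow>\<^sub>L 'h) \<Rightarrow> bool"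
  where "characteristic_function a T E \<theta> \<longleftrightarrow>
    closed_csubspace E \<and>
    (\<forall>z\<in>ball 0 1. \<theta> z \<in> bounded_ops E (defect_space a T)) \<and>
    analytic_on_ball \<theta> \<and>
    bounded_multiplier a E (defect_space a T) \<theta> \<and>
    (\<forall>f\<in>Hs a (defect_space a T).
      (\<lambda>\<alpha>. f \<alpha> - V_op a T (adjoint_on UNIV cinner (Hs_inner a) (V_op a T) f) \<alpha>) =
      mult_op a (defect_space a T) \<theta>
        (adjoint_on (Hs a E) (Hs_inner a) (Hs_inner a) (mult_op a (defect_space a T) \<theta>) f))"

end

theory Submission
  imports Defs "HOL-Library.Function_Algebras"
begin

text \<open>
  Let \<open>P = I - V V\<^sup>*\<close>, on the functions with values in the Hilbert space of \<open>T\<close>. The range of \<open>V\<close> is invariant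
  under the adjoints \<open>(M\<^sup>\<gamma>)\<^sup>*\<close> of the multiplications by monomials, since \<open>(M\<^sup>\<gamma>)\<^sup>* V = V (T\<^sup>\<gamma>)\<^sup>*\<close>; so \<open>P\<close> is the
  projection to a subspace that is invariant under multiplication, and the claim is a
  Beurling theorem for it. Two series relations between the numbers \<open>a\<^sub>n\<close> and \<open>b\<^sub>n\<close> prove it, one for
  each direction of \<open>s \<cdot> (1/s) = 1\<close>:

  \<^item> If all \<open>b\<^sub>n\<close> are nonnegative, then \<open>\<Sum>\<^sub>\<gamma> b\<^sub>\<gamma> M\<^sup>\<gamma> (M\<^sup>\<gamma>)\<^sup>* \<le> I\<close> (\<open>back_shift_contraction\<close>). Together with
    \<open>P (M\<^sup>\<gamma>)\<^sup>* = P (M\<^sup>\<gamma>)\<^sup>* P\<close> this gives positivity of \<open>G = P - \<Sum>\<^sub>\<gamma> b\<^sub>\<gamma> M\<^sup>\<gamma> P (M\<^sup>\<gamma>)\<^sup>*\<close> (\<open>positive_G\<close>).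
  \<^item> Conversely \<open>P = \<Sum>\<^sub>\<alpha> a\<^sub>\<alpha> M\<^sup>\<alpha> G (M\<^sup>\<alpha>)\<^sup>*\<close> (\<open>Gamma_back_shift_finite\<close>, \<open>cinner_U\<close>).

  With \<open>\<Gamma> = \<surd>G\<close> and \<open>\<theta>(z) e = (\<Gamma> e)(z)\<close> the multiplication operator sends \<open>z\<^sup>\<alpha> e\<close> to \<open>M\<^sup>\<alpha> \<Gamma> e\<close>, and the second
  relation reads \<open>M\<^sub>\<theta> M\<^sub>\<theta>\<^sup>* = P\<close>. Analyticity of \<open>\<theta>\<close> is analyticity of the point evaluations in operator
  norm (\<open>eval_op_has_derivative\<close>).

  It remains to derive \<open>b\<^sub>n \<ge> 0\<close> from the complete Pick property (\<open>reciprocal_coeff_nonneg\<close>), the necessity part of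
  the theorem of McCullough and Quiggin. For points \<open>x\<^sub>p\<close> and a base point \<open>c\<close> one shows that the matrix
  \<open>1 - s(x\<^sub>p, c) s(c, x\<^sub>q) / (s(x\<^sub>p, x\<^sub>q) s(c, c))\<close> is positive, by induction on the number of points: factored as
  \<open>W W\<^sup>*\<close>, the matrix for one base point is the data of a solvable interpolation problem, and evaluating the
  interpolating multiplier at a further point yields the matrix for that point as base point
  (\<open>base_gram_change\<close>). At the base point 0 the matrix is \<open>1 - 1/s(x\<^sub>p, x\<^sub>q) = \<Sum>\<^sub>n b\<^sub>n \<langle>x\<^sub>p, x\<^sub>q\<rangle>\<^sup>n\<close>, and roots of
  unity on a circle isolate the sign of each \<open>b\<^sub>n\<close>.

  Square roots of positive operators come from a norm convergent iteration (\<open>positive_sqrt_exists\<close>), and a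
  recursion for multinomial sums (\<open>degree_sum_Suc\<close>) reduces the identities for \<open>a\<^sub>\<alpha>\<close>, \<open>b\<^sub>\<alpha>\<close> to those for \<open>a\<^sub>n\<close>, \<open>b\<^sub>n\<close>.
\<close>

section \<open>Riesz representation, adjoints and projections\<close>

instance chilbert_space \<subseteq> banach ..

lemma bounded_clinearI:
  assumes "\<And>x y. A (x + y) = A x + A y" "\<And>c x. A (c *\<^sub>C x) = c *\<^sub>C A x"
    "\<And>x. norm (A x) \<le> K * norm x"
  shows "bounded_clinear A"
  unfolding bounded_clinear_def
  by (auto intro!: bounded_linear_intro[of A K] simp: assms scaleR_scaleC mult.commute)

lemma bounded_clinearD:
  assumes "bounded_clinear A"
  shows "bounded_linear A" "A (x + y) = A x + A y" "A (x - y) = A x - A y" "A 0 = 0"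
    "A (c *\<^sub>C x) = c *\<^sub>C A x" "A (r *\<^sub>R x) = r *\<^sub>R A x" "A (- x) = - A x"
  using assms unfolding bounded_clinear_def scaleR_scaleC
  by (auto simp: linear_simps)

lemma bounded_clinear_pos_bound:
  assumes "bounded_clinear A"
  obtains K where "K > 0" "\<And>x. norm (A x) \<le> K * norm x"
  using bounded_linear.pos_bounded[OF bounded_clinearD(1)[OF assms]] by (metis mult.commute)

lemma bounded_clinear_compose:
  "bounded_clinear A \<Longrightarrow> bounded_clinear B \<Longrightarrow> bounded_clinear (\<lambda>x. A (B x))"
  unfolding bounded_clinear_def by (auto intro: bounded_linear_compose)

lemma bounded_clinear_id: "bounded_clinear (\<lambda>x. x)"
  unfolding bounded_clinear_def by simp

interpretation cinner: bounded_bilinear "cinner :: 'a::complex_inner \<Rightarrow> 'a \<Rightarrow> complex"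
proof
  show "\<exists>K. \<forall>x y::'a. norm (cinner x y) \<le> norm x * norm y * K"
    by (rule exI[of _ 1]) (simp add: norm_cinner_le)
qed (auto simp: cinner_add_left cinner_add_right scaleR_scaleC cinner_scaleC_left
    cinner_scaleC_right scaleC_complex_def)

declare cinner.zero_left [simp] cinner.zero_right [simp]

interpretation scaleC: bounded_bilinear "scaleC :: complex \<Rightarrow> 'a::complex_inner \<Rightarrow> 'a"
proof
  show "\<exists>K. \<forall>c (x::'a). norm (c *\<^sub>C x) \<le> norm c * norm x * K"
    by (rule exI[of _ 1]) (simp add: norm_scaleC)
qed (auto simp: scaleC_add_left scaleC_add_right scaleR_scaleC scaleC_scaleC mult.commute
    scaleC_complex_def)

lemma bounded_clinear_diff:
  "bounded_clinear A \<Longrightarrow> bounded_clinear B \<Longrightarrow> bounded_clinear (\<lambda>x. A x - B x)"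
  unfolding bounded_clinear_def by (auto intro: bounded_linear_sub simp: scaleC.diff_right)

declare scaleC.zero_left [simp] scaleC.zero_right [simp]

lemma bounded_clinear_cinner_left: "bounded_clinear (\<lambda>x. cinner x y)"
  by (auto simp: bounded_clinear_def cinner.bounded_linear_left cinner_scaleC_left
      scaleC_complex_def)

lemma bounded_clinear_scaleR: "bounded_clinear A \<Longrightarrow> bounded_clinear (\<lambda>x. r *\<^sub>R A x)"
  unfolding bounded_clinear_def
  by (auto intro: bounded_linear_const_scaleR simp: scaleC.scaleR_right)

lemma cinner_ext:
  fixes x y :: "'a::complex_inner"
  assumes "\<And>u. cinner u x = cinner u y"
  shows "x = y"
proof -
  have "cinner (x - y) (x - y) = 0"
    by (simp add: cinner.diff_right assms)
  then show ?thesis by (simp add: cinner_self)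
qed

lemma cinner_ext_left:
  fixes x y :: "'a::complex_inner"
  assumes "\<And>u. cinner x u = cinner y u"
  shows "x = y"
  by (rule cinner_ext) (metis assms cinner_commute)

lemma norm_sq_cinner: "(norm x)\<^sup>2 = Re (cinner x x)"
  by (simp add: cinner_self)

lemma Re_cinner_le: "Re (cinner x y) \<le> norm x * norm y"
  using complex_Re_le_cmod norm_cinner_le order_trans by blast

text \<open>Covers orthogonal projections: the hypothesis says that \<open>P x\<close> is orthogonal to \<open>x - P x\<close>.\<close>

lemma norm_le_if_cinner_self:
  assumes "cinner (P x) (P x) = cinner (P x) x"
  shows "norm (P x) \<le> norm x"
proof (cases "P x = 0")
  case False
  have "(norm (P x))\<^sup>2 \<le> norm (P x) * norm x"
    using Re_cinner_le[of "P x" x] by (simp add: norm_sq_cinner assms)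
  with False show ?thesis by (simp add: power2_eq_square)
qed simp

lemma norm_le_sq_le:
  fixes x :: "'a::real_normed_vector" and y :: "'b::real_normed_vector"
  shows "(norm x)\<^sup>2 \<le> (norm y)\<^sup>2 \<Longrightarrow> norm x \<le> norm y"
  by (rule power2_le_imp_le) simp_all

text \<open>
  A real polynomial \<open>p t\<^sup>2 + 2 b t\<close> that is nowhere negative has no linear term: this turns the
  minimality of a norm into orthogonality.
\<close>

lemma nonneg_quadratic_linear_coeff_zero:
  fixes p b :: real
  assumes "\<And>t. 0 \<le> t\<^sup>2 * p + 2 * t * b" "p \<ge> 0"
  shows "b = 0"
proof (rule ccontr)
  assume "b \<noteq> 0"
  define c where "c = b / (p + 1)"
  have b: "b = c * (p + 1)" using assms(2) by (simp add: c_def)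
  have "0 \<le> (- c)\<^sup>2 * p + 2 * (- c) * b" by (rule assms)
  also have "\<dots> = - (c\<^sup>2 * (p + 2))"
    unfolding b by (simp add: power2_eq_square algebra_simps)
  also have "\<dots> < 0"
    using \<open>b \<noteq> 0\<close> assms(2) b by simp
  finally show False by simp
qed

text \<open>
  The representing vector is the minimiser of \<open>\<parallel>x\<parallel>\<^sup>2 - 2 Re (f x)\<close> on \<open>M\<close>, which exists because the
  parallelogram law makes every minimising sequence Cauchy. Taking the whole space for \<open>M\<close> gives
  adjoints; taking \<open>f x = \<langle>x, y\<rangle>\<close> gives the orthogonal projection of \<open>y\<close> to \<open>M\<close>.
\<close>

lemma riesz_on_subspace:
  fixes f :: "'a::chilbert_space \<Rightarrow> complex"
  assumes M: "closed_csubspace M" and f: "bounded_clinear f"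
  shows "\<exists>m\<in>M. \<forall>x\<in>M. f x = cinner x m"
proof -
  obtain K where K: "K > 0" "\<And>x. norm (f x) \<le> K * norm x"
    using bounded_clinear_pos_bound[OF f] by blast
  define J where "J x = (norm x)\<^sup>2 - 2 * Re (f x)" for x
  have low: "- K\<^sup>2 \<le> J x" for x
  proof -
    have "Re (f x) \<le> K * norm x" using K(2)[of x] complex_Re_le_cmod order_trans by blast
    moreover have "0 \<le> (norm x - K)\<^sup>2" by simp
    ultimately show ?thesis unfolding J_def by (simp add: power2_diff algebra_simps)
  qed
  define j where "j = Inf (J ` M)"
  have M0: "0 \<in> M" using M by (simp add: closed_csubspace_def)
  have jle: "j \<le> J x" if "x \<in> M" for x
    unfolding j_def using that by (intro cInf_lower bdd_belowI2[of _ "- K\<^sup>2"] low) auto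
  have "\<exists>x\<in>M. J x < j + 1 / (n + 1)" for n :: nat
  proof -
    have "Inf (J ` M) < j + 1 / (n + 1)" unfolding j_def by simp
    then show ?thesis using cInf_lessD[of "J ` M"] M0 by blast
  qed
  then have "\<exists>X. \<forall>n::nat. X n \<in> M \<and> J (X n) < j + 1 / real (n + 1)" by (intro choice) blast
  then obtain X where X: "\<And>n::nat. X n \<in> M" "\<And>n. J (X n) < j + 1 / real (n + 1)" by blast
  \<comment> \<open>two almost minimisers are close, because their midpoint cannot do better than \<open>j\<close>\<close>
  have par: "(norm (x - y))\<^sup>2 \<le> 2 * J x + 2 * J y - 4 * j" if "x \<in> M" "y \<in> M" for x y
  proof -
    let ?h = "(1/2 :: complex) *\<^sub>C (x + y)"
    have h: "?h = (1/2::real) *\<^sub>R (x + y)" by (simp add: scaleR_scaleC)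
    have "?h \<in> M" using that M by (simp add: closed_csubspace_def)
    then have "j \<le> J ?h" by (rule jle)
    moreover have "Re (f ?h) = (Re (f x) + Re (f y)) / 2"
      unfolding h bounded_clinearD[OF f] by simp
    moreover have "(norm ?h)\<^sup>2 = (norm (x + y))\<^sup>2 / 4"
      unfolding h by (simp add: power_divide)
    moreover have "(norm (x + y))\<^sup>2 + (norm (x - y))\<^sup>2 = 2 * (norm x)\<^sup>2 + 2 * (norm y)\<^sup>2"
      by (simp add: power2_norm_eq_inner inner_diff inner_add inner_commute)
    ultimately show ?thesis unfolding J_def by (simp add: field_simps)
  qed
  have "Cauchy X"
  proof (rule metric_CauchyI)
    fix e :: real assume e: "0 < e"
    obtain N :: nat where N: "1 / (N + 1) < e\<^sup>2 / 4"
      using reals_Archimedean[of "e\<^sup>2 / 4"] e by (auto simp: inverse_eq_divide add.commute)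
    have "dist (X m) (X n) < e" if "m \<ge> N" "n \<ge> N" for m n
    proof -
      have "1 / real (m + 1) \<le> 1 / (N + 1)" "1 / real (n + 1) \<le> 1 / (N + 1)"
        using that by (auto simp: frac_le)
      then have "(norm (X m - X n))\<^sup>2 < e\<^sup>2"
        using par[OF X(1) X(1), of m n] X(2)[of m] X(2)[of n] N by (simp add: add.commute)
      then show ?thesis using e by (simp add: dist_norm power2_less_imp_less)
    qed
    then show "\<exists>M. \<forall>m\<ge>M. \<forall>n\<ge>M. dist (X m) (X n) < e" by blast
  qed
  then obtain m where m: "X \<longlonglongrightarrow> m" using Cauchy_convergent convergent_def by blast
  have mM: "m \<in> M" using M X(1) m by (auto simp: closed_csubspace_def closed_sequential_limits)
  have "(\<lambda>n. J (X n)) \<longlonglongrightarrow> J m"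
    unfolding J_def by (intro tendsto_intros m bounded_linear.tendsto[OF bounded_clinearD(1)[OF f]])
  moreover have "(\<lambda>n. j + 1 / (real n + 1)) \<longlonglongrightarrow> j + 0"
    using LIMSEQ_inverse_real_of_nat by (intro tendsto_intros) (simp add: inverse_eq_divide add.commute)
  ultimately have Jm: "J m \<le> j"
    using X(2) by (intro LIMSEQ_le[of "\<lambda>n. J (X n)"]) (auto intro: less_imp_le simp: add.commute)
  have re: "Re (f x) = Re (cinner x m)" if x: "x \<in> M" for x
  proof -
    have "0 \<le> t\<^sup>2 * (norm x)\<^sup>2 + 2 * t * (Re (cinner x m) - Re (f x))" for t :: real
    proof -
      have "m + t *\<^sub>R x \<in> M" using mM x M by (simp add: closed_csubspace_def scaleR_scaleC)
      then have "J m \<le> J (m + t *\<^sub>R x)" using jle Jm by fastforce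
      moreover have "(norm (m + t *\<^sub>R x))\<^sup>2 = (norm m)\<^sup>2 + 2 * t * Re (cinner x m) + t\<^sup>2 * (norm x)\<^sup>2"
        unfolding power2_norm_eq_inner inner_eq_Re_cinner[symmetric]
        by (simp add: inner_add inner_commute power2_eq_square algebra_simps)
      moreover have "Re (f (m + t *\<^sub>R x)) = Re (f m) + t * Re (f x)"
        by (simp add: bounded_clinearD[OF f])
      ultimately show ?thesis unfolding J_def by (simp add: algebra_simps)
    qed
    from nonneg_quadratic_linear_coeff_zero[OF this] show ?thesis by simp
  qed
  have "f x = cinner x m" if x: "x \<in> M" for x
  proof -
    \<comment> \<open>the imaginary part follows from the real part at \<open>\<i> x\<close>\<close>
    have "\<i> *\<^sub>C x \<in> M" using x M by (simp add: closed_csubspace_def)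
    from re[OF this] re[OF x] show ?thesis
      by (simp add: bounded_clinearD[OF f] cinner_scaleC_left scaleC_complex_def complex_eq_iff)
  qed
  with mM show ?thesis by blast
qed

lemma closed_csubspace_UNIV: "closed_csubspace UNIV"
  by (simp add: closed_csubspace_def)

lemma cadjoint_unique:
  assumes "\<And>u. cinner (A u) y = cinner u x"
  shows "cadjoint A y = x"
  unfolding adjoint_on_def
  by (rule the_equality) (use assms in \<open>auto intro: cinner_ext\<close>)

lemma cinner_cadjoint:
  assumes "bounded_clinear A"
  shows "cinner (A u) y = cinner u (cadjoint A y)"
proof -
  have "bounded_clinear (\<lambda>u. cinner (A u) y)"
    using bounded_clinear_compose[OF bounded_clinear_cinner_left assms] .
  from riesz_on_subspace[OF closed_csubspace_UNIV this]
  obtain x where x: "\<And>u. cinner (A u) y = cinner u x" by blast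
  with cadjoint_unique[OF x] show ?thesis by simp
qed

lemma cinner_cadjoint_left:
  assumes "bounded_clinear A"
  shows "cinner (cadjoint A y) u = cinner y (A u)"
  by (metis cinner_commute cinner_cadjoint[OF assms])

lemma bounded_clinear_cadjoint:
  assumes A: "bounded_clinear A"
  shows "bounded_clinear (cadjoint A)"
proof -
  obtain K where K: "K > 0" "\<And>x. norm (A x) \<le> K * norm x"
    using bounded_clinear_pos_bound[OF A] by blast
  show ?thesis
  proof (rule bounded_clinearI[of _ K])
    show "cadjoint A (x + y) = cadjoint A x + cadjoint A y" for x y
      by (rule cadjoint_unique) (simp add: cinner_add_right cinner_cadjoint[OF A])
    show "cadjoint A (c *\<^sub>C x) = c *\<^sub>C cadjoint A x" for c x
      by (rule cadjoint_unique) (simp add: cinner_scaleC_right cinner_cadjoint[OF A])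
    show "norm (cadjoint A y) \<le> K * norm y" for y
    proof (cases "cadjoint A y = 0")
      case False
      have "(norm (cadjoint A y))\<^sup>2 = Re (cinner (A (cadjoint A y)) y)"
        by (simp add: norm_sq_cinner cinner_cadjoint[OF A])
      also have "\<dots> \<le> norm (A (cadjoint A y)) * norm y"
        by (rule Re_cinner_le)
      also have "\<dots> \<le> (K * norm (cadjoint A y)) * norm y"
        by (intro mult_right_mono K) simp
      finally show ?thesis using False by (simp add: power2_eq_square ac_simps)
    qed (use K in simp)
  qed
qed

lemma orthogonal_projection:
  fixes M :: "'a::chilbert_space set"
  assumes M: "closed_csubspace M"
  obtains P where "bounded_clinear P" "\<And>x. P x \<in> M" "\<And>x. x \<in> M \<Longrightarrow> P x = x"
    "\<And>x y. cinner (P x) y = cinner x (P y)"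
proof -
  have "\<exists>m\<in>M. \<forall>x\<in>M. cinner x y = cinner x m" for y
    by (rule riesz_on_subspace[OF M bounded_clinear_cinner_left])
  then obtain P where P: "\<And>y. P y \<in> M" "\<And>x y. x \<in> M \<Longrightarrow> cinner x y = cinner x (P y)"
    by metis
  have diff: "x - y \<in> M" if "x \<in> M" "y \<in> M" for x y
  proof -
    have "x + (-1) *\<^sub>C y \<in> M" using that M by (simp add: closed_csubspace_def)
    moreover have "(-1) *\<^sub>C y = - y"
      using scaleR_scaleC[of "-1" y] by simp
    ultimately show ?thesis by simp
  qed
  have uniq: "P y = m" if "m \<in> M" "\<And>x. x \<in> M \<Longrightarrow> cinner x y = cinner x m" for m y
  proof -
    have "cinner (P y - m) (P y - m) = 0"
      using P(2)[OF diff[OF P(1) that(1)]] that(2)[OF diff[OF P(1) that(1)]]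
      by (simp add: cinner.diff_right)
    then show ?thesis by (simp add: cinner_self)
  qed
  have "bounded_clinear P"
  proof (rule bounded_clinearI[of _ 1])
    show "P (x + y) = P x + P y" for x y
      using M P by (intro uniq) (simp_all add: closed_csubspace_def cinner_add_right flip: P(2))
    show "P (c *\<^sub>C x) = c *\<^sub>C P x" for c x
      using M P by (intro uniq) (simp_all add: closed_csubspace_def cinner_scaleC_right flip: P(2))
    show "norm (P y) \<le> 1 * norm y" for y
      using norm_le_if_cinner_self[of P y, OF P(2)[OF P(1), symmetric]] by simp
  qed
  moreover have "cinner (P x) y = cinner x (P y)" for x y
    by (metis P cinner_commute)
  ultimately show ?thesis using that P(1) uniq by metis
qed

section \<open>Square roots of positive operators\<close>

definition hermitian :: "('a::complex_inner \<Rightarrow> 'a) \<Rightarrow> bool"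
  where "hermitian A \<longleftrightarrow> (\<forall>x y. cinner (A x) y = cinner x (A y))"

lemma hermitian_bounded_clinear:
  assumes "hermitian A" "bounded_linear A"
  shows "bounded_clinear A"
proof -
  note h = assms(1)[unfolded hermitian_def, rule_format, symmetric]
  have "A (c *\<^sub>C x) = c *\<^sub>C A x" for c x
    by (rule cinner_ext) (simp add: h cinner_scaleC_right)
  with assms(2) show ?thesis by (simp add: bounded_clinear_def)
qed

text \<open>
  Polarisation: a complex quadratic form with real values comes from a hermitian operator.
\<close>

lemma positive_op_hermitian:
  assumes "positive_op A"
  shows "hermitian A"
  unfolding hermitian_def
proof (intro allI)
  fix x y
  have A: "bounded_clinear A" and im: "\<And>x. Im (cinner (A x) x) = 0"
    using assms unfolding positive_op_def by (auto simp: complex_nonneg_Reals_iff)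
  note simps = bounded_clinearD[OF A] cinner_add_left cinner_add_right cinner_scaleC_left
    cinner_scaleC_right
  have 1: "Im (cinner (A x) y) + Im (cinner (A y) x) = 0"
    using im[of "x + y"] im[of x] im[of y] by (simp add: simps)
  have 2: "Re (cinner (A x) y) = Re (cinner (A y) x)"
    using im[of "x + \<i> *\<^sub>C y"] im[of x] im[of y] by (simp add: simps)
  have "cinner (A x) y = cnj (cinner (A y) x)"
    using 1 2 by (simp add: complex_eq_iff)
  then show "cinner (A x) y = cinner x (A y)" by (metis cinner_commute)
qed

text \<open>
  A positive contraction satisfies \<open>A\<^sup>2 \<le> A\<close>, seen by testing positivity at \<open>x - A x\<close>. Hence
  \<open>I - A\<close> is a contraction, which is where the iteration for the square root starts.
\<close>

lemma positive_op_norm_sq_le: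
  assumes A: "positive_op A" and K: "\<And>x. norm (A x) \<le> norm x"
  shows "(norm (A x))\<^sup>2 \<le> Re (cinner (A x) x)"
proof -
  note h = positive_op_hermitian[OF A, unfolded hermitian_def, rule_format]
  have lin: "bounded_clinear A" using A by (simp add: positive_op_def)
  have "0 \<le> Re (cinner (A (x - A x)) (x - A x))"
    using A by (auto simp: positive_op_def complex_nonneg_Reals_iff)
  also have "\<dots> = Re (cinner (A x) x) - 2 * (norm (A x))\<^sup>2 + Re (cinner (A (A x)) (A x))"
    by (simp add: bounded_clinearD[OF lin] cinner.diff_left cinner.diff_right h norm_sq_cinner)
  also have "Re (cinner (A (A x)) (A x)) \<le> norm (A (A x)) * norm (A x)"
    by (rule Re_cinner_le)
  also have "\<dots> \<le> norm (A x) * norm (A x)"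
    by (intro mult_right_mono K) simp
  finally show ?thesis by (simp add: power2_eq_square)
qed

text \<open>
  With \<open>B = I - A\<close>, an operator \<open>Y\<close> has \<open>(I - Y)\<^sup>2 = A\<close> exactly if \<open>Y = (B + Y\<^sup>2) / 2\<close>. The iterates of
  this fixed point equation are dominated in norm, with all their increments, by the same
  iteration for the number 1 in place of \<open>B\<close>. That scalar sequence increases and is bounded by 1,
  so the operators converge in norm.
\<close>

primrec sqrt_iter :: "('a::real_normed_vector \<Rightarrow>\<^sub>L 'a) \<Rightarrow> nat \<Rightarrow> 'a \<Rightarrow>\<^sub>L 'a" where
  "sqrt_iter B 0 = 0"
| "sqrt_iter B (Suc n) = (1/2) *\<^sub>R (B + (sqrt_iter B n o\<^sub>L sqrt_iter B n))"

primrec sqrt_majorant :: "nat \<Rightarrow> real" where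
  "sqrt_majorant 0 = 0"
| "sqrt_majorant (Suc n) = (1 + (sqrt_majorant n)\<^sup>2) / 2"

lemma sqrt_majorant_bounds: "0 \<le> sqrt_majorant n \<and> sqrt_majorant n \<le> 1"
proof (induction n)
  case (Suc n)
  then have "(sqrt_majorant n)\<^sup>2 \<le> 1" by (simp add: power_le_one)
  then show ?case by simp
qed simp

lemma sqrt_majorant_mono: "sqrt_majorant n \<le> sqrt_majorant (Suc n)"
proof -
  have "0 \<le> (1 - sqrt_majorant n)\<^sup>2" by simp
  then show ?thesis by (simp add: power2_diff)
qed

lemma norm_sqrt_iter_le:
  assumes "norm B \<le> 1"
  shows "norm (sqrt_iter B n) \<le> sqrt_majorant n"
proof (induction n)
  case (Suc n)
  have "norm (sqrt_iter B n o\<^sub>L sqrt_iter B n) \<le> norm (sqrt_iter B n) * norm (sqrt_iter B n)"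
    by (rule norm_blinfun_compose)
  also have "\<dots> \<le> sqrt_majorant n * sqrt_majorant n"
    using Suc by (intro mult_mono) (auto simp: sqrt_majorant_bounds)
  finally have "norm (B + (sqrt_iter B n o\<^sub>L sqrt_iter B n)) \<le> 1 + (sqrt_majorant n)\<^sup>2"
    using assms norm_triangle_ineq[of B "sqrt_iter B n o\<^sub>L sqrt_iter B n"]
    by (simp add: power2_eq_square)
  then show ?case by simp
qed simp

lemma norm_sqrt_iter_step:
  assumes "norm B \<le> 1"
  shows "norm (sqrt_iter B (Suc n) - sqrt_iter B n) \<le> sqrt_majorant (Suc n) - sqrt_majorant n"
proof (induction n)
  case 0
  then show ?case using assms by simp
next
  case (Suc n)
  let ?Y = "sqrt_iter B" and ?y = sqrt_majorant
  have "?Y (Suc (Suc n)) - ?Y (Suc n)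
      = (1/2) *\<^sub>R ((?Y (Suc n) o\<^sub>L (?Y (Suc n) - ?Y n)) + ((?Y (Suc n) - ?Y n) o\<^sub>L ?Y n))"
  proof -
    \<comment> \<open>\<open>V\<^sup>2 - W\<^sup>2 = V (V - W) + (V - W) W\<close> holds without commutativity\<close>
    have "(1/2) *\<^sub>R (B + (V o\<^sub>L V)) - (1/2) *\<^sub>R (B + (W o\<^sub>L W))
        = (1/2) *\<^sub>R ((V o\<^sub>L (V - W)) + ((V - W) o\<^sub>L W))" for V W
      by (rule blinfun_eqI) (simp add: blinfun.bilinear_simps scaleR_right_diff_distrib
          scaleR_add_right)
    then show ?thesis
      by (simp only: sqrt_iter.simps(2)[of B "Suc n"] sqrt_iter.simps(2)[of B n, symmetric])
        (metis sqrt_iter.simps(2))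
  qed
  also have "norm \<dots> \<le> (1/2) * (?y (Suc n) * (?y (Suc n) - ?y n) + (?y (Suc n) - ?y n) * ?y n)"
  proof -
    have "norm (?Y (Suc n) o\<^sub>L (?Y (Suc n) - ?Y n)) \<le> ?y (Suc n) * (?y (Suc n) - ?y n)"
      using Suc norm_sqrt_iter_le[OF assms, of "Suc n"] sqrt_majorant_bounds[of "Suc n"]
      by (intro order_trans[OF norm_blinfun_compose] mult_mono) auto
    moreover have "norm ((?Y (Suc n) - ?Y n) o\<^sub>L ?Y n) \<le> (?y (Suc n) - ?y n) * ?y n"
      using Suc norm_sqrt_iter_le[OF assms, of n] sqrt_majorant_mono[of n]
      by (intro order_trans[OF norm_blinfun_compose] mult_mono) auto
    ultimately show ?thesis by (simp add: norm_triangle_le)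
  qed
  also have "\<dots> = ?y (Suc (Suc n)) - ?y (Suc n)"
    by (simp only: sqrt_majorant.simps(2)[of "Suc n"] sqrt_majorant.simps(2)[of n])
      (simp add: power2_eq_square field_simps)
  finally show ?case .
qed

lemma sqrt_iter_convergent:
  fixes B :: "'a::banach \<Rightarrow>\<^sub>L 'a"
  assumes "norm B \<le> 1"
  shows "convergent (sqrt_iter B)"
proof -
  have diff: "norm (sqrt_iter B (m + k) - sqrt_iter B m) \<le> sqrt_majorant (m + k) - sqrt_majorant m"
    for m k
  proof (induction k)
    case (Suc k)
    have "norm (sqrt_iter B (m + Suc k) - sqrt_iter B m)
        \<le> norm (sqrt_iter B (Suc (m + k)) - sqrt_iter B (m + k)) + norm (sqrt_iter B (m + k) - sqrt_iter B m)"
      using norm_triangle_ineq[of "sqrt_iter B (Suc (m + k)) - sqrt_iter B (m + k)"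
          "sqrt_iter B (m + k) - sqrt_iter B m"] by (simp del: sqrt_iter.simps)
    then show ?case using Suc norm_sqrt_iter_step[OF assms, of "m + k"]
      by (simp del: sqrt_iter.simps sqrt_majorant.simps)
  qed simp
  have "incseq sqrt_majorant" by (intro incseq_SucI sqrt_majorant_mono)
  then have "convergent sqrt_majorant"
    using sqrt_majorant_bounds by (intro Bseq_mono_convergent BseqI'[of _ 1]) (auto simp: incseq_def)
  then have "Cauchy sqrt_majorant" by (rule convergent_Cauchy)
  have diff': "norm (sqrt_iter B m - sqrt_iter B n) \<le> norm (sqrt_majorant m - sqrt_majorant n)" for m n
    using diff[of m "n - m"] diff[of n "m - n"]
    by (cases "m \<le> n") (simp_all add: norm_minus_commute)
  have "Cauchy (sqrt_iter B)"
  proof (rule CauchyI)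
    fix e :: real assume "0 < e"
    then obtain M where M: "\<And>m n. m \<ge> M \<Longrightarrow> n \<ge> M \<Longrightarrow> norm (sqrt_majorant m - sqrt_majorant n) < e"
      using CauchyD[OF \<open>Cauchy sqrt_majorant\<close>] by blast
    then show "\<exists>M. \<forall>m\<ge>M. \<forall>n\<ge>M. norm (sqrt_iter B m - sqrt_iter B n) < e"
      using diff' le_less_trans by blast
  qed
  then show ?thesis by (simp add: Cauchy_convergent_iff)
qed

lemma positive_sqrt_exists:
  fixes A :: "'a::chilbert_space \<Rightarrow> 'a"
  assumes A: "positive_op A"
  shows "\<exists>D. positive_op D \<and> D \<circ> D = A"
proof -
  have lin: "bounded_clinear A" using A by (simp add: positive_op_def)
  obtain K where K: "K > 0" "\<And>x. norm (A x) \<le> K * norm x"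
    using bounded_clinear_pos_bound[OF lin] by blast
  define A' where "A' x = (1 / K) *\<^sub>R A x" for x
  have A': "bounded_clinear A'" unfolding A'_def
    by (rule bounded_clinearI[of _ 1])
      (use K in \<open>simp_all add: bounded_clinearD[OF lin] scaleR_add_right scaleC_scaleC
        scaleR_scaleC[of "1 / K" "_ *\<^sub>C _"] scaleR_scaleC[of "1 / K" "A _"] scaleC_add_right
        norm_scaleC norm_divide mult.commute divide_simps\<close>)
  have pA': "positive_op A'"
    using A' A K(1) by (auto simp: positive_op_def A'_def cinner.scaleR_left complex_nonneg_Reals_iff)
  have nA': "norm (A' x) \<le> norm x" for x
    using K(1) K(2)[of x] by (simp add: A'_def divide_simps mult.commute)
  define B where "B = Blinfun (\<lambda>x. x - A' x)"
  have B: "blinfun_apply B x = x - A' x" for x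
    unfolding B_def by (rule bounded_linear_Blinfun_apply[THEN fun_cong])
      (intro bounded_linear_sub bounded_linear_ident bounded_clinearD(1)[OF A'])
  have "norm B \<le> 1"
  proof (rule norm_blinfun_bound)
    fix x
    have "(norm (x - A' x))\<^sup>2 = (norm x)\<^sup>2 - 2 * Re (cinner (A' x) x) + (norm (A' x))\<^sup>2"
      unfolding power2_norm_eq_inner inner_eq_Re_cinner[symmetric]
      by (simp add: inner_diff inner_commute)
    also have "\<dots> \<le> (norm x)\<^sup>2"
      using positive_op_norm_sq_le[OF pA' nA', of x] zero_le_power2[of "norm (A' x)"] by linarith
    finally have "norm (x - A' x) \<le> norm x" by (rule power2_le_imp_le) simp
    then show "norm (blinfun_apply B x) \<le> 1 * norm x" by (simp add: B)
  qed simp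
  then obtain Y where Y: "sqrt_iter B \<longlonglongrightarrow> Y"
    using sqrt_iter_convergent by (auto simp: convergent_def)
  have fix_point: "Y = (1/2) *\<^sub>R (B + (Y o\<^sub>L Y))"
  proof (rule LIMSEQ_unique)
    show "(\<lambda>n. sqrt_iter B (Suc n)) \<longlonglongrightarrow> Y" using Y by (rule LIMSEQ_Suc)
    show "(\<lambda>n. sqrt_iter B (Suc n)) \<longlonglongrightarrow> (1/2) *\<^sub>R (B + (Y o\<^sub>L Y))"
      unfolding sqrt_iter.simps
      by (intro tendsto_intros Y bounded_bilinear.tendsto[OF bounded_bilinear_blinfun_compose])
  qed
  have "norm Y \<le> 1"
    using norm_sqrt_iter_le[OF \<open>norm B \<le> 1\<close>] sqrt_majorant_bounds
    by (intro tendsto_upperbound[OF tendsto_norm[OF Y]] always_eventually) (auto intro: order_trans)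
  have Blim: "hermitian (blinfun_apply B)"
    using positive_op_hermitian[OF pA']
    by (simp add: hermitian_def B cinner.diff_left cinner.diff_right)
  have "hermitian (blinfun_apply (sqrt_iter B n))" for n
    by (induction n)
      (use Blim in \<open>simp_all add: hermitian_def blinfun.bilinear_simps cinner_add_left
        cinner_add_right cinner.scaleR_left cinner.scaleR_right\<close>)
  then have hY: "hermitian (blinfun_apply Y)"
  proof -
    have lim: "(\<lambda>n. blinfun_apply (sqrt_iter B n) x) \<longlonglongrightarrow> blinfun_apply Y x" for x
      by (intro tendsto_intros Y)
    show ?thesis unfolding hermitian_def
    proof (intro allI)
      fix x y
      have "(\<lambda>n. cinner (blinfun_apply (sqrt_iter B n) x) y) \<longlonglongrightarrow> cinner (blinfun_apply Y x) y"
        by (intro cinner.tendsto lim tendsto_const)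
      moreover have "(\<lambda>n. cinner (blinfun_apply (sqrt_iter B n) x) y)
          \<longlonglongrightarrow> cinner x (blinfun_apply Y y)"
        using \<open>\<And>n. hermitian (blinfun_apply (sqrt_iter B n))\<close> unfolding hermitian_def
        by (simp, intro cinner.tendsto lim tendsto_const)
      ultimately show "cinner (blinfun_apply Y x) y = cinner x (blinfun_apply Y y)"
        by (rule LIMSEQ_unique)
    qed
  qed
  define D where "D x = sqrt K *\<^sub>R (x - blinfun_apply Y x)" for x
  have hD: "hermitian D"
    using hY by (simp add: hermitian_def D_def cinner.diff_left cinner.diff_right
        cinner.scaleR_left cinner.scaleR_right)
  have "bounded_linear D" unfolding D_def
    by (intro bounded_linear_const_scaleR bounded_linear_sub bounded_linear_ident
        blinfun.bounded_linear_right)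
  with hD have lD: "bounded_clinear D" by (rule hermitian_bounded_clinear)
  have "cinner (D x) x \<in> \<real>\<^sub>\<ge>\<^sub>0" for x
  proof -
    have "cinner (D x) x = cnj (cinner (D x) x)"
      using hD by (metis hermitian_def cinner_commute)
    then have "Im (cinner (D x) x) = 0" by (simp add: complex_eq_iff)
    moreover have "Re (cinner (blinfun_apply Y x) x) \<le> (norm x)\<^sup>2"
    proof -
      have "Re (cinner (blinfun_apply Y x) x) \<le> norm (blinfun_apply Y x) * norm x"
        by (rule Re_cinner_le)
      also have "\<dots> \<le> norm Y * norm x * norm x"
        by (intro mult_right_mono norm_blinfun) simp
      also have "\<dots> \<le> 1 * norm x * norm x"
        using \<open>norm Y \<le> 1\<close> by (intro mult_right_mono) auto
      finally show ?thesis by (simp add: power2_eq_square)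
    qed
    ultimately show ?thesis
      using K(1) by (simp add: complex_nonneg_Reals_iff D_def cinner.scaleR_left cinner.diff_left
          norm_sq_cinner)
  qed
  moreover have "D \<circ> D = A"
  proof
    fix x
    have "blinfun_apply Y x = (1/2) *\<^sub>R (x - A' x + blinfun_apply Y (blinfun_apply Y x))"
      using arg_cong[OF fix_point, of "\<lambda>Z. blinfun_apply Z x"]
      by (simp add: blinfun.bilinear_simps B)
    then have "2 *\<^sub>R blinfun_apply Y x = x - A' x + blinfun_apply Y (blinfun_apply Y x)"
      by (metis (no_types, lifting) scaleR_half_double scaleR_scaleR scaleR_2 scaleR_add_right)
    then have "x - blinfun_apply Y x - blinfun_apply Y (x - blinfun_apply Y x) = A' x"
      by (simp add: blinfun.bilinear_simps scaleR_2 algebra_simps)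
    then show "(D \<circ> D) x = A x"
      using K(1) by (simp add: D_def blinfun.bilinear_simps A'_def flip: scaleR_right_diff_distrib)
  qed
  ultimately show ?thesis using lD by (auto simp: positive_op_def)
qed

section \<open>Multi-indices and multinomial sums\<close>

definition unit_index :: "'d \<Rightarrow> 'd multi_index"
  where "unit_index i = (\<lambda>j. of_bool (j = i))"

definition multinomial :: "'d::finite multi_index \<Rightarrow> real"
  where "multinomial \<alpha> = multi_coeff (\<lambda>_. 1) \<alpha>"

text \<open>
  The homogeneous part of degree \<open>n\<close> of \<open>\<Sum>\<^sub>\<alpha> (|\<alpha>|! / \<alpha>!) \<phi> \<alpha>\<close>. Every identity for the weights
  \<open>a\<^sub>\<alpha>\<close> and \<open>b\<^sub>\<alpha>\<close> below reduces to one for \<open>a\<^sub>n\<close> and \<open>b\<^sub>n\<close> by means of these sums.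
\<close>

definition degree_sum :: "nat \<Rightarrow> ('d::finite multi_index \<Rightarrow> 'v::real_vector) \<Rightarrow> 'v"
  where "degree_sum n \<phi> = (\<Sum>\<alpha> | total_degree \<alpha> = n. multinomial \<alpha> *\<^sub>R \<phi> \<alpha>)"

lemma multi_coeff_eq: "multi_coeff a \<alpha> = a (total_degree \<alpha>) * multinomial \<alpha>"
  by (simp add: multinomial_def multi_coeff_def)

lemma multinomial_pos: "multinomial \<alpha> > 0"
  by (auto simp: multinomial_def multi_coeff_def intro!: divide_pos_pos prod_pos)

lemma total_degree_add: "total_degree (\<alpha> + \<beta>) = total_degree \<alpha> + total_degree \<beta>"
  by (simp add: total_degree_def sum.distrib)

lemma total_degree_unit: "total_degree (unit_index i) = 1"
  by (simp add: total_degree_def unit_index_def)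

lemma total_degree_0_iff: "total_degree \<alpha> = 0 \<longleftrightarrow> \<alpha> = 0"
  by (auto simp: total_degree_def fun_eq_iff)

lemma total_degree_zero [simp]: "total_degree 0 = 0"
  by (simp add: total_degree_0_iff)

lemma le_total_degree: "\<alpha> i \<le> total_degree \<alpha>"
  unfolding total_degree_def by (rule member_le_sum) auto

lemma multi_coeff_zero [simp]: "multi_coeff a 0 = a 0"
  by (simp add: multi_coeff_def)

lemma multinomial_zero [simp]: "multinomial 0 = 1"
  by (simp add: multinomial_def)

lemma finite_total_degree_le: "finite {\<alpha> :: 'd::finite multi_index. total_degree \<alpha> \<le> n}"
proof (rule finite_subset)
  show "{\<alpha> :: 'd multi_index. total_degree \<alpha> \<le> n} \<subseteq> Pi\<^sub>E UNIV (\<lambda>_. {..n})"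
    by (auto intro: order_trans[OF le_total_degree])
qed (rule finite_PiE, auto)

lemma finite_total_degree: "finite {\<alpha> :: 'd::finite multi_index. total_degree \<alpha> = n}"
  by (rule finite_subset[OF _ finite_total_degree_le[of n]]) auto

lemma multinomial_unit_step:
  "multinomial (\<alpha> + unit_index i) * real (Suc (\<alpha> i)) = real (Suc (total_degree \<alpha>)) * multinomial \<alpha>"
proof -
  have "(\<Prod>j\<in>UNIV. fact ((\<alpha> + unit_index i) j) :: real)
      = (\<Prod>j\<in>UNIV. (if j = i then real (Suc (\<alpha> i)) else 1) * fact (\<alpha> j))"
    by (rule prod.cong) (auto simp: unit_index_def)
  also have "\<dots> = real (Suc (\<alpha> i)) * (\<Prod>j\<in>UNIV. fact (\<alpha> j))"
    by (simp add: prod.distrib)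
  finally show ?thesis
    unfolding multinomial_def multi_coeff_def total_degree_add total_degree_unit
    by (simp del: of_nat_Suc plus_fun_apply)
qed

lemma multinomial_le_unit_step: "multinomial \<alpha> \<le> multinomial (\<alpha> + unit_index i)"
proof -
  have "real (Suc (\<alpha> i)) * multinomial \<alpha> \<le> real (Suc (total_degree \<alpha>)) * multinomial \<alpha>"
    using le_total_degree[of \<alpha> i] multinomial_pos[of \<alpha>] by (intro mult_right_mono) auto
  then have "real (Suc (\<alpha> i)) * multinomial \<alpha> \<le> real (Suc (\<alpha> i)) * multinomial (\<alpha> + unit_index i)"
    using multinomial_unit_step[of \<alpha> i] by (simp add: mult.commute del: of_nat_Suc)
  then show ?thesis by (simp del: of_nat_Suc)
qed

lemma index_decompose:
  assumes "\<beta> i > 0"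
  shows "\<exists>\<alpha>. \<beta> = \<alpha> + unit_index i"
  by (rule exI[of _ "\<lambda>j. \<beta> j - unit_index i j"]) (use assms in \<open>auto simp: unit_index_def fun_eq_iff\<close>)

lemma bij_betw_add_unit:
  "bij_betw (\<lambda>\<alpha>. \<alpha> + unit_index i) {\<alpha>. total_degree \<alpha> = n}
    {\<beta> :: 'd::finite multi_index. total_degree \<beta> = Suc n \<and> \<beta> i > 0}"
proof -
  have "\<beta> \<in> (\<lambda>\<alpha>. \<alpha> + unit_index i) ` {\<alpha>. total_degree \<alpha> = n}"
    if "total_degree \<beta> = Suc n" "\<beta> i > 0" for \<beta> :: "'d multi_index"
    using index_decompose[of \<beta> i] that by (auto simp: total_degree_add total_degree_unit)
  then show ?thesis
    by (auto simp: bij_betw_def inj_on_def total_degree_add total_degree_unit)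
      (simp add: unit_index_def)
qed

text \<open>
  A multinomial coefficient counts words, and this recursion splits off the last letter. It yields
  both the convolution rule and the multinomial theorem by induction.
\<close>

lemma degree_sum_Suc:
  fixes \<phi> :: "'d::finite multi_index \<Rightarrow> 'v::real_vector"
  shows
  "degree_sum (Suc n) \<phi> = (\<Sum>i\<in>UNIV. degree_sum n (\<lambda>\<alpha>. \<phi> (\<alpha> + unit_index i)))"
proof -
  have "degree_sum n (\<lambda>\<alpha>. \<phi> (\<alpha> + unit_index i))
      = (\<Sum>\<beta> | total_degree \<beta> = Suc n. (real (\<beta> i) / Suc n * multinomial \<beta>) *\<^sub>R \<phi> \<beta>)" for i
  proof -
    have "degree_sum n (\<lambda>\<alpha>. \<phi> (\<alpha> + unit_index i))
        = (\<Sum>\<alpha> | total_degree \<alpha> = n. (real ((\<alpha> + unit_index i) i) / Suc n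
            * multinomial (\<alpha> + unit_index i)) *\<^sub>R \<phi> (\<alpha> + unit_index i))"
      unfolding degree_sum_def
    proof (rule sum.cong)
      fix \<alpha> :: "'d multi_index"
      assume "\<alpha> \<in> {\<alpha>. total_degree \<alpha> = n}"
      then have "multinomial \<alpha> = real ((\<alpha> + unit_index i) i) / Suc n * multinomial (\<alpha> + unit_index i)"
        using multinomial_unit_step[of \<alpha> i] by (auto simp: unit_index_def field_simps)
      then show "multinomial \<alpha> *\<^sub>R \<phi> (\<alpha> + unit_index i) = (real ((\<alpha> + unit_index i) i) / Suc n
            * multinomial (\<alpha> + unit_index i)) *\<^sub>R \<phi> (\<alpha> + unit_index i)" by simp
    qed simp
    also have "\<dots> = (\<Sum>\<beta> | total_degree \<beta> = Suc n \<and> \<beta> i > 0.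
        (real (\<beta> i) / Suc n * multinomial \<beta>) *\<^sub>R \<phi> \<beta>)"
      by (rule sum.reindex_bij_betw[OF bij_betw_add_unit])
    also have "\<dots> = (\<Sum>\<beta> | total_degree \<beta> = Suc n. (real (\<beta> i) / Suc n * multinomial \<beta>) *\<^sub>R \<phi> \<beta>)"
      by (rule sum.mono_neutral_left) (auto simp: finite_total_degree)
    finally show ?thesis .
  qed
  then have "(\<Sum>i\<in>UNIV. degree_sum n (\<lambda>\<alpha>. \<phi> (\<alpha> + unit_index i)))
      = (\<Sum>\<beta> | total_degree \<beta> = Suc n. \<Sum>i\<in>UNIV. (real (\<beta> i) / Suc n * multinomial \<beta>) *\<^sub>R \<phi> \<beta>)"
    by (simp only:) (rule sum.swap)
  also have "\<dots> = (\<Sum>\<beta> | total_degree \<beta> = Suc n. multinomial \<beta> *\<^sub>R \<phi> \<beta>)"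
  proof (rule sum.cong)
    fix \<beta> :: "'d multi_index"
    assume "\<beta> \<in> {\<beta>. total_degree \<beta> = Suc n}"
    then have "(\<Sum>i\<in>UNIV. real (\<beta> i)) = Suc n"
      by (simp add: total_degree_def flip: of_nat_sum)
    then have "(\<Sum>i\<in>UNIV. real (\<beta> i) / Suc n * multinomial \<beta>) = multinomial \<beta>"
      by (simp only: sum_divide_distrib[symmetric] sum_distrib_right[symmetric]) simp
    then show "(\<Sum>i\<in>UNIV. (real (\<beta> i) / Suc n * multinomial \<beta>) *\<^sub>R \<phi> \<beta>) = multinomial \<beta> *\<^sub>R \<phi> \<beta>"
      by (simp only: scaleR_sum_left[symmetric])
  qed simp
  finally show ?thesis by (simp add: degree_sum_def)
qed

lemma degree_sum_0 [simp]: "degree_sum 0 \<phi> = \<phi> 0"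
  by (simp add: degree_sum_def total_degree_0_iff)

lemma degree_sum_diff: "degree_sum n (\<lambda>\<alpha>. \<phi> \<alpha> - \<psi> \<alpha>) = degree_sum n \<phi> - degree_sum n \<psi>"
  by (simp add: degree_sum_def scaleR_diff_right sum_subtractf)

lemma degree_sum_linear:
  "degree_sum n (\<lambda>\<alpha>. \<Sum>k\<in>A. c k *\<^sub>R \<phi> k \<alpha>) = (\<Sum>k\<in>A. c k *\<^sub>R degree_sum n (\<phi> k))"
  unfolding degree_sum_def scaleR_sum_right
  by (subst sum.swap) (simp add: mult.commute)

text \<open>
  Vandermonde's convolution for multinomial coefficients, in a form dual to the usual one.
\<close>

lemma degree_sum_degree_sum:
  "degree_sum m (\<lambda>\<alpha>. degree_sum n (\<lambda>\<beta>. \<phi> (\<alpha> + \<beta>))) = degree_sum (m + n) \<phi>"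
proof (induction m arbitrary: \<phi>)
  case (Suc m)
  have "degree_sum (Suc m) (\<lambda>\<alpha>. degree_sum n (\<lambda>\<beta>. \<phi> (\<alpha> + \<beta>)))
      = (\<Sum>i\<in>UNIV. degree_sum m (\<lambda>\<alpha>. degree_sum n (\<lambda>\<beta>. \<phi> (\<alpha> + \<beta> + unit_index i))))"
    by (simp add: degree_sum_Suc add.assoc add.left_commute add.commute)
  also have "\<dots> = degree_sum (Suc m + n) \<phi>"
    by (simp add: Suc[of "\<lambda>\<gamma>. \<phi> (\<gamma> + unit_index _)"] degree_sum_Suc)
  finally show ?case .
qed simp

lemma prod_power_unit_step:
  fixes x :: "'d::finite \<Rightarrow> 'a::comm_semiring_1"
  shows "(\<Prod>j\<in>UNIV. x j ^ (\<alpha> + unit_index i) j) = x i * (\<Prod>j\<in>UNIV. x j ^ \<alpha> j)"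
proof -
  have "(\<Prod>j\<in>UNIV. x j ^ (\<alpha> + unit_index i) j)
      = (\<Prod>j\<in>UNIV. (if j = i then x i else 1) * x j ^ \<alpha> j)"
    by (rule prod.cong) (auto simp: unit_index_def)
  then show ?thesis by (simp add: prod.distrib)
qed

lemma degree_sum_prod_power:
  fixes x :: "'d::finite \<Rightarrow> 'a::real_normed_field"
  shows "degree_sum n (\<lambda>\<alpha>. \<Prod>i\<in>UNIV. x i ^ \<alpha> i) = (\<Sum>i\<in>UNIV. x i) ^ n"
proof (induction n)
  case (Suc n)
  have "degree_sum n (\<lambda>\<alpha>. x i * (\<Prod>j\<in>UNIV. x j ^ \<alpha> j)) = x i * (\<Sum>i\<in>UNIV. x i) ^ n" for i
    unfolding Suc[symmetric] by (simp add: degree_sum_def sum_distrib_left)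
  then show ?case
    unfolding degree_sum_Suc prod_power_unit_step by (simp add: sum_distrib_right)
qed simp

lemma sum_total_degree_le:
  fixes f :: "'d::finite multi_index \<Rightarrow> 'v::comm_monoid_add"
  shows "(\<Sum>\<alpha> | total_degree \<alpha> \<le> N. f \<alpha>) = (\<Sum>n\<le>N. \<Sum>\<alpha> | total_degree \<alpha> = n. f \<alpha>)"
proof -
  have "{\<alpha>. total_degree \<alpha> \<le> N} = (\<Union>k\<in>{..N}. {\<alpha> :: 'd multi_index. total_degree \<alpha> = k})"
    by auto
  then show ?thesis by (simp add: sum.UNION_disjoint finite_total_degree disjoint_iff)
qed

lemma has_sum_total_degree:
  fixes f :: "'d::finite multi_index \<Rightarrow> 'v::real_normed_vector"
  assumes "(f has_sum s) UNIV"
  shows "(\<lambda>n. \<Sum>\<alpha> | total_degree \<alpha> = n. f \<alpha>) sums s"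
proof -
  have "filterlim (\<lambda>n. {\<alpha> :: 'd multi_index. total_degree \<alpha> \<le> n}) (finite_subsets_at_top UNIV) sequentially"
    unfolding filterlim_finite_subsets_at_top
  proof (intro allI impI)
    fix X :: "'d multi_index set" assume "finite X \<and> X \<subseteq> UNIV"
    then have "\<forall>\<alpha>\<in>X. total_degree \<alpha> \<le> Max (total_degree ` X)" by simp
    then have "X \<subseteq> {\<alpha>. total_degree \<alpha> \<le> n}" if "n \<ge> Max (total_degree ` X)" for n
      using that by fastforce
    then show "\<forall>\<^sub>F n in sequentially. finite {\<alpha> :: 'd multi_index. total_degree \<alpha> \<le> n} \<and>
        X \<subseteq> {\<alpha>. total_degree \<alpha> \<le> n} \<and> {\<alpha> :: 'd multi_index. total_degree \<alpha> \<le> n} \<subseteq> UNIV"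
      unfolding eventually_sequentially using finite_total_degree_le by blast
  qed
  with assms have "(\<lambda>n. \<Sum>\<alpha> | total_degree \<alpha> \<le> n. f \<alpha>) \<longlonglongrightarrow> s"
    unfolding has_sum_def by (rule filterlim_compose)
  then show ?thesis unfolding sums_def_le sum_total_degree_le .
qed

lemma abs_summable_total_degree:
  fixes f :: "'d::finite multi_index \<Rightarrow> real"
  assumes "summable g" "\<And>n. (\<Sum>\<alpha> | total_degree \<alpha> = n. f \<alpha>) \<le> g n" "\<And>\<alpha>. f \<alpha> \<ge> 0"
  shows "f summable_on UNIV"
proof (rule nonneg_bdd_above_summable_on)
  have g: "0 \<le> g n" for n
    by (rule order_trans[OF sum_nonneg assms(2)]) (use assms(3) in auto)
  show "bdd_above (sum f ` {F. F \<subseteq> UNIV \<and> finite F})"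
  proof (rule bdd_aboveI2)
    fix F :: "'d multi_index set" assume "F \<in> {F. F \<subseteq> UNIV \<and> finite F}"
    then have fin: "finite F" by simp
    define N where "N = Max (total_degree ` F)"
    have "F \<subseteq> (\<Union>k\<in>{..N}. {\<alpha>. total_degree \<alpha> = k})"
      using fin by (auto simp: N_def)
    then have "sum f F \<le> sum f (\<Union>k\<in>{..N}. {\<alpha>. total_degree \<alpha> = k})"
      using assms(3) by (intro sum_mono2) (auto simp: finite_total_degree)
    also have "\<dots> = (\<Sum>k\<le>N. \<Sum>\<alpha> | total_degree \<alpha> = k. f \<alpha>)"
      by (simp add: sum.UNION_disjoint finite_total_degree disjoint_iff)
    also have "\<dots> \<le> (\<Sum>k\<le>N. g k)" by (intro sum_mono assms)
    also have "\<dots> \<le> suminf g" using assms(1) g by (intro sum_le_suminf) auto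
    finally show "sum f F \<le> suminf g" .
  qed
qed (use assms in auto)

lemma degree_sum_multi_coeff:
  fixes f :: "'d::finite multi_index \<Rightarrow> 'v::real_vector"
  shows "(\<Sum>\<alpha> | total_degree \<alpha> = n. multi_coeff a \<alpha> *\<^sub>R f \<alpha>) = a n *\<^sub>R degree_sum n f"
  unfolding degree_sum_def scaleR_sum_right by (rule sum.cong) (auto simp: multi_coeff_eq)

lemma sum_multi_coeff_le:
  fixes f :: "'d::finite multi_index \<Rightarrow> 'v::real_vector"
  shows "(\<Sum>\<alpha> | total_degree \<alpha> \<le> N. multi_coeff a \<alpha> *\<^sub>R f \<alpha>) = (\<Sum>n\<le>N. a n *\<^sub>R degree_sum n f)"
  by (simp only: sum_total_degree_le degree_sum_multi_coeff)

section \<open>Coefficients of a reciprocal\<close>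

lemma reciprocal_coeff_0: "a 0 = 1 \<Longrightarrow> reciprocal_coeff a 0 = 0"
  by (simp add: reciprocal_coeff_def)

lemma reciprocal_coeff_conv:
  assumes "a 0 = 1"
  shows "(\<Sum>k\<le>n. reciprocal_coeff a k * a (n - k)) = (if n = 0 then 0 else a n)"
proof -
  let ?A = "Abs_fps a"
  have "inverse ?A * ?A = 1" using assms by (intro inverse_mult_eq_1) simp
  then have "(1 - inverse ?A) * ?A = ?A - 1" by (simp add: algebra_simps)
  then have "fps_nth ((1 - inverse ?A) * ?A) n = fps_nth (?A - 1) n" by simp
  then show ?thesis
    using assms by (simp add: fps_mult_nth reciprocal_coeff_def atMost_atLeast0 del: fps_sub_nth)
      (simp add: fps_sub_nth)
qed

lemma reciprocal_coeff_mult_le: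
  assumes "a 0 = 1" "\<And>n. a n > 0" "\<And>n. reciprocal_coeff a n \<ge> 0"
  shows "reciprocal_coeff a m * a n \<le> a (m + n)"
proof -
  have "reciprocal_coeff a m * a (m + n - m) \<le> (\<Sum>k\<le>m + n. reciprocal_coeff a k * a (m + n - k))"
    using assms(2,3) by (intro member_le_sum) (auto intro: mult_nonneg_nonneg less_imp_le)
  also have "\<dots> \<le> a (m + n)"
    using reciprocal_coeff_conv[where a = a and n = "m + n", OF assms(1)] assms(2)[of 0] by (auto split: if_splits)
  finally show ?thesis by simp
qed

text \<open>
  The sums \<open>\<psi> \<alpha> = \<phi> \<alpha> - \<Sum>\<^sub>\<gamma> b\<^sub>\<gamma> \<phi> (\<alpha> + \<gamma>)\<close> are multiplication by \<open>1/s\<close>, read on coefficients, and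
  \<open>\<Sum>\<^sub>\<alpha> a\<^sub>\<alpha> \<psi> \<alpha>\<close> is multiplication by \<open>s\<close>. They cancel up to the constant term. The bound \<open>N\<close> on
  the degrees makes all sums finite.
\<close>

lemma reciprocal_coeff_telescope:
  fixes \<phi> :: "'d::finite multi_index \<Rightarrow> 'v::real_vector"
  assumes a: "a 0 = 1" and \<phi>: "\<And>\<alpha>. total_degree \<alpha> > N \<Longrightarrow> \<phi> \<alpha> = 0"
  shows "(\<Sum>n\<le>N. a n *\<^sub>R degree_sum n (\<lambda>\<alpha>. \<phi> \<alpha>
    - (\<Sum>m\<le>N. reciprocal_coeff a m *\<^sub>R degree_sum m (\<lambda>\<gamma>. \<phi> (\<alpha> + \<gamma>))))) = \<phi> 0"
proof -
  let ?b = "reciprocal_coeff a" and ?S = "\<lambda>n. degree_sum n \<phi>"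
  have S0: "?S n = 0" if "n > N" for n
    unfolding degree_sum_def using that \<phi> by (intro sum.neutral) auto
  have "(\<Sum>n\<le>N. \<Sum>m\<le>N. (?b m * a n) *\<^sub>R ?S (n + m))
      = (\<Sum>(m, n)\<in>{..N} \<times> {..N}. (?b m * a n) *\<^sub>R ?S (m + n))"
    by (subst sum.swap) (simp add: sum.cartesian_product add.commute)
  also have "\<dots> = (\<Sum>(m, n)\<in>{(m, n). m + n \<le> N}. (?b m * a n) *\<^sub>R ?S (m + n))"
  proof (rule sum.mono_neutral_right)
    show "\<forall>p\<in>{..N} \<times> {..N} - {(m, n). m + n \<le> N}. (case p of (m, n) \<Rightarrow> (?b m * a n) *\<^sub>R ?S (m + n)) = 0"
    proof
      fix p assume "p \<in> {..N} \<times> {..N} - {(m, n). m + n \<le> N}"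
      then have "fst p + snd p > N" by auto
      from S0[OF this] show "(case p of (m, n) \<Rightarrow> (?b m * a n) *\<^sub>R ?S (m + n)) = 0"
        by (simp add: case_prod_unfold)
    qed
  qed auto
  also have "\<dots> = (\<Sum>k\<le>N. \<Sum>m\<le>k. (?b m * a (k - m)) *\<^sub>R ?S k)"
    by (subst sum.triangle_reindex_eq) (intro sum.cong refl, simp)
  also have "\<dots> = (\<Sum>k\<le>N. (if k = 0 then 0 else a k) *\<^sub>R ?S k)"
    by (simp add: scaleR_sum_left[symmetric] reciprocal_coeff_conv[where a = a, OF a])
  finally have conv: "(\<Sum>n\<le>N. \<Sum>m\<le>N. (?b m * a n) *\<^sub>R ?S (n + m))
      = (\<Sum>k\<le>N. (if k = 0 then 0 else a k) *\<^sub>R ?S k)" .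
  have "(\<Sum>n\<le>N. a n *\<^sub>R degree_sum n (\<lambda>\<alpha>. \<phi> \<alpha> - (\<Sum>m\<le>N. ?b m *\<^sub>R degree_sum m (\<lambda>\<gamma>. \<phi> (\<alpha> + \<gamma>)))))
      = (\<Sum>n\<le>N. a n *\<^sub>R ?S n) - (\<Sum>n\<le>N. \<Sum>m\<le>N. (?b m * a n) *\<^sub>R ?S (n + m))"
    by (simp add: degree_sum_diff degree_sum_linear degree_sum_degree_sum scaleR_diff_right
        sum_subtractf scaleR_sum_right mult.commute)
  also have "\<dots> = (\<Sum>k\<le>N. a k *\<^sub>R ?S k - (if k = 0 then 0 else a k) *\<^sub>R ?S k)"
    unfolding conv by (simp add: sum_subtractf)
  also have "\<dots> = (\<Sum>k\<le>N. if k = 0 then \<phi> 0 else 0)"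
    by (rule sum.cong) (auto simp: a)
  finally show ?thesis by simp
qed

text \<open>
  The inequality behind the row contractivity of the weighted shifts: for \<open>b\<^sub>n \<ge> 0\<close> the double sum
  over \<open>m \<le> M\<close>, \<open>n \<le> N\<close> is part of the sum over \<open>m + n \<le> M + N\<close>, which the relation
  \<open>\<Sum>\<^sub>m b\<^sub>m a\<^bsub>k - m\<^esub> = a\<^sub>k\<close> for \<open>k \<ge> 1\<close> evaluates.
\<close>

lemma reciprocal_coeff_contraction:
  fixes \<phi> :: "'d::finite multi_index \<Rightarrow> real"
  assumes a: "a 0 = 1" "\<And>n. a n > 0" "\<And>n. reciprocal_coeff a n \<ge> 0" and \<phi>: "\<And>\<alpha>. \<phi> \<alpha> \<ge> 0"
  shows "(\<Sum>m\<le>M. reciprocal_coeff a m * degree_sum m (\<lambda>\<gamma>. \<Sum>n\<le>N. a n * degree_sum n (\<lambda>\<alpha>. \<phi> (\<gamma> + \<alpha>))))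
    \<le> (\<Sum>k\<le>M + N. a k * degree_sum k \<phi>)"
proof -
  let ?b = "reciprocal_coeff a" and ?S = "\<lambda>n. degree_sum n \<phi>"
  have S: "?S n \<ge> 0" for n
    unfolding degree_sum_def using \<phi> by (intro sum_nonneg) (simp add: less_imp_le[OF multinomial_pos])
  have "(\<Sum>m\<le>M. ?b m * degree_sum m (\<lambda>\<gamma>. \<Sum>n\<le>N. a n * degree_sum n (\<lambda>\<alpha>. \<phi> (\<gamma> + \<alpha>))))
      = (\<Sum>m\<le>M. \<Sum>n\<le>N. (?b m * a n) * ?S (m + n))"
    using degree_sum_linear[of _ a "\<lambda>n \<gamma>. degree_sum n (\<lambda>\<alpha>. \<phi> (\<gamma> + \<alpha>))" "{..N}"]
    by (simp add: degree_sum_degree_sum sum_distrib_left mult.assoc)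
  also have "\<dots> = (\<Sum>(m, n)\<in>{..M} \<times> {..N}. (?b m * a n) * ?S (m + n))"
    by (simp add: sum.cartesian_product)
  also have "\<dots> \<le> (\<Sum>(m, n)\<in>{(m, n). m + n \<le> M + N}. (?b m * a n) * ?S (m + n))"
  proof (rule sum_mono2)
    show "finite {(m, n). m + n \<le> M + N}"
      by (rule finite_subset[of _ "{..M + N} \<times> {..M + N}"]) auto
  qed (use a S in \<open>auto intro!: mult_nonneg_nonneg less_imp_le[OF a(2)]\<close>)
  also have "\<dots> = (\<Sum>k\<le>M + N. \<Sum>m\<le>k. (?b m * a (k - m)) * ?S k)"
    by (subst sum.triangle_reindex_eq) (intro sum.cong refl, simp)
  also have "\<dots> = (\<Sum>k\<le>M + N. (if k = 0 then 0 else a k) * ?S k)"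
    by (simp only: sum_distrib_right[symmetric] reciprocal_coeff_conv[where a = a, OF a(1)])
  also have "\<dots> \<le> (\<Sum>k\<le>M + N. a k * ?S k)"
    using a S by (intro sum_mono mult_right_mono) (auto intro: less_imp_le)
  finally show ?thesis .
qed

section \<open>Coordinates of square-summable families\<close>

lemma ell2_nth_Abs:
  "(\<lambda>i. (norm (x i))\<^sup>2) summable_on UNIV \<Longrightarrow> ell2_nth (Abs_ell2 x) = x"
  by (rule Abs_ell2_inverse) simp

lemma ell2_eqI: "(\<And>i. ell2_nth x i = ell2_nth y i) \<Longrightarrow> x = y"
  by (metis ell2_nth_inject ext)

lemma ell2_norm_summable: "(\<lambda>i. (norm (ell2_nth x i))\<^sup>2) summable_on UNIV"
  using ell2_nth[of x] by simp

lemma ell2_norm_has_sum: "((\<lambda>i. (norm (ell2_nth x i))\<^sup>2) has_sum (norm x)\<^sup>2) UNIV"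
  unfolding norm_ell2_sq using ell2_norm_summable by (rule has_sum_infsum)

lemma ell2_cinner_has_sum:
  "((\<lambda>i. cinner (ell2_nth x i) (ell2_nth y i)) has_sum cinner x y) UNIV"
  unfolding cinner_ell2.rep_eq
  by (rule has_sum_infsum[OF abs_summable_summable[OF
        ell2_cinner_abs_summable[OF ell2_norm_summable ell2_norm_summable]]])

lemma bounded_clinear_ell2_nth: "bounded_clinear (\<lambda>x. ell2_nth x i)"
  by (rule bounded_clinearI[of _ 1])
    (simp_all add: plus_ell2.rep_eq scaleC_ell2.rep_eq norm_ell2_nth_le)

lemma ell2_nth_sum: "ell2_nth (sum f A) i = (\<Sum>j\<in>A. ell2_nth (f j) i)"
  by (induction A rule: infinite_finite_induct) (simp_all add: plus_ell2.rep_eq zero_ell2.rep_eq)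

definition ell2_single :: "'i \<Rightarrow> 'h::complex_inner \<Rightarrow> ('i, 'h) ell2"
  where "ell2_single i h = Abs_ell2 (\<lambda>j. if j = i then h else 0)"

lemma ell2_nth_single: "ell2_nth (ell2_single i h) j = (if j = i then h else 0)"
proof -
  have "(\<lambda>j. (norm (if j = i then h else 0))\<^sup>2) summable_on UNIV"
    by (rule finite_nonzero_values_imp_summable_on) (rule finite_subset[of _ "{i}"], auto)
  then show ?thesis unfolding ell2_single_def by (subst ell2_nth_Abs) auto
qed

lemma cinner_ell2_single: "cinner x (ell2_single i h) = cinner (ell2_nth x i) h"
proof (rule has_sum_unique[OF ell2_cinner_has_sum])
  show "((\<lambda>j. cinner (ell2_nth x j) (ell2_nth (ell2_single i h) j)) has_sum cinner (ell2_nth x i) h) UNIV"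
    by (rule has_sum_finite_neutralI[of "{i}"]) (auto simp: ell2_nth_single cinner.zero_right)
qed

definition ell2_restrict :: "'i set \<Rightarrow> ('i, 'h::complex_inner) ell2 \<Rightarrow> ('i, 'h) ell2"
  where "ell2_restrict F x = (\<Sum>i\<in>F. ell2_single i (ell2_nth x i))"

lemma ell2_nth_restrict:
  "finite F \<Longrightarrow> ell2_nth (ell2_restrict F x) j = (if j \<in> F then ell2_nth x j else 0)"
  unfolding ell2_restrict_def ell2_nth_sum ell2_nth_single by (simp add: sum.delta)

lemma cinner_ell2_restrict:
  "cinner y (ell2_restrict F x) = (\<Sum>i\<in>F. cinner (ell2_nth y i) (ell2_nth x i))"
  unfolding ell2_restrict_def cinner.sum_right cinner_ell2_single ..

lemma norm_ell2_restrict: "finite F \<Longrightarrow> (norm (ell2_restrict F x))\<^sup>2 = (\<Sum>i\<in>F. (norm (ell2_nth x i))\<^sup>2)"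
  unfolding norm_sq_cinner[of "ell2_restrict F x"] cinner_ell2_restrict
  by (simp add: ell2_nth_restrict cinner_self)

lemma norm_ell2_restrict_le: "finite F \<Longrightarrow> norm (ell2_restrict F x) \<le> norm x"
  using norm_ell2_restrict[of F x] ell2_sum_le[of F x] by (auto intro: power2_le_imp_le)

lemma ell2_restrict_tendsto: "((\<lambda>F. ell2_restrict F x) \<longlongrightarrow> x) (finite_subsets_at_top UNIV)"
proof -
  have diff: "(norm (ell2_restrict F x - x))\<^sup>2 = (norm x)\<^sup>2 - (\<Sum>i\<in>F. (norm (ell2_nth x i))\<^sup>2)"
    if "finite F" for F
  proof -
    have "cinner x (ell2_restrict F x) = complex_of_real (\<Sum>i\<in>F. (norm (ell2_nth x i))\<^sup>2)"
      by (simp add: cinner_ell2_restrict cinner_self)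
    then have "inner x (ell2_restrict F x) = (\<Sum>i\<in>F. (norm (ell2_nth x i))\<^sup>2)"
      by (simp add: inner_eq_Re_cinner)
    moreover have "inner (ell2_restrict F x) (ell2_restrict F x) = (\<Sum>i\<in>F. (norm (ell2_nth x i))\<^sup>2)"
      using norm_ell2_restrict[OF that, of x] by (simp add: power2_norm_eq_inner)
    ultimately show ?thesis
      by (simp add: power2_norm_eq_inner[of "_ - _"] power2_norm_eq_inner[of x] inner_diff inner_commute)
  qed
  have "((\<lambda>F. (norm x)\<^sup>2 - (\<Sum>i\<in>F. (norm (ell2_nth x i))\<^sup>2)) \<longlongrightarrow> (norm x)\<^sup>2 - (norm x)\<^sup>2)
      (finite_subsets_at_top UNIV)"
    using ell2_norm_has_sum[of x] unfolding has_sum_def by (intro tendsto_diff tendsto_const)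
  moreover have "\<forall>\<^sub>F F in finite_subsets_at_top UNIV. (norm (ell2_restrict F x - x))\<^sup>2
      = (norm x)\<^sup>2 - (\<Sum>i\<in>F. (norm (ell2_nth x i))\<^sup>2)"
    by (rule eventually_finite_subsets_at_top_weakI) (rule diff)
  ultimately have "((\<lambda>F. (norm (ell2_restrict F x - x))\<^sup>2) \<longlongrightarrow> 0) (finite_subsets_at_top UNIV)"
    by (simp add: tendsto_cong)
  then have "((\<lambda>F. sqrt ((norm (ell2_restrict F x - x))\<^sup>2)) \<longlongrightarrow> sqrt 0) (finite_subsets_at_top UNIV)"
    by (rule tendsto_real_sqrt)
  then show ?thesis
    by (simp add: tendsto_norm_zero_iff LIM_zero_iff)
qed

text \<open>
  A square-summable family of operators is a single operator into \<open>ell2\<close>. The shifts and the operators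
  \<open>V\<close>, \<open>C\<close>, \<open>U\<close> below arise in this way, and bounds on finite partial sums are all that has to be checked.
\<close>

definition column_op :: "('i \<Rightarrow> 'x \<Rightarrow> 'y) \<Rightarrow> 'x \<Rightarrow> ('i, 'y::complex_inner) ell2"
  where "column_op A x = Abs_ell2 (\<lambda>i. A i x)"

lemma column_op:
  assumes A: "\<And>i. bounded_clinear (A i)" and K: "K \<ge> 0"
    and bound: "\<And>F x. finite F \<Longrightarrow> (\<Sum>i\<in>F. (norm (A i x))\<^sup>2) \<le> (K * norm x)\<^sup>2"
  shows ell2_nth_column_op: "ell2_nth (column_op A x) i = A i x"
    and norm_column_op_le: "norm (column_op A x) \<le> K * norm x"
    and bounded_clinear_column_op: "bounded_clinear (column_op A)"
proof -
  have nth: "ell2_nth (column_op A x) = (\<lambda>i. A i x)" for x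
    unfolding column_op_def
    by (intro ell2_nth_Abs nonneg_bdd_above_summable_on bdd_aboveI2[of _ _ "(K * norm x)\<^sup>2"])
      (auto intro: bound)
  then show "ell2_nth (column_op A x) i = A i x" by simp
  have le: "norm (column_op A x) \<le> K * norm x" for x
  proof (rule power2_le_imp_le)
    show "(norm (column_op A x))\<^sup>2 \<le> (K * norm x)\<^sup>2"
      unfolding norm_ell2_sq
      by (rule infsum_le_finite_sums[OF ell2_norm_summable]) (simp only: nth bound)
  qed (use K in simp)
  then show "norm (column_op A x) \<le> K * norm x" .
  show "bounded_clinear (column_op A)"
    by (rule bounded_clinearI[OF _ _ le])
      (auto intro!: ell2_eqI simp: nth plus_ell2.rep_eq scaleC_ell2.rep_eq bounded_clinearD[OF A])
qed

section \<open>Uniqueness of power series coefficients\<close>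

lemma norm_monomial: "cmod (monomial z \<alpha>) = (\<Prod>i\<in>UNIV. cmod (z $ i) ^ \<alpha> i)"
  by (simp add: monomial_def norm_power flip: prod_norm)

definition root_of_unity :: "nat \<Rightarrow> complex"
  where "root_of_unity N = exp (2 * of_real pi * \<i> / of_nat N)"

lemma root_of_unity_power: "root_of_unity N ^ k = exp (2 * of_real pi * \<i> * of_nat k / of_nat N)"
  unfolding root_of_unity_def exp_of_nat_mult[symmetric] by (simp add: mult_ac)

lemma norm_root_of_unity: "cmod (root_of_unity N) = 1"
proof -
  have "2 * complex_of_real pi * \<i> / of_nat N = \<i> * complex_of_real (2 * pi / N)" by simp
  then show ?thesis unfolding root_of_unity_def by (metis norm_exp_i_times)
qed

lemma root_of_unity_power_eq_1: "N > 0 \<Longrightarrow> root_of_unity N ^ N = 1"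
  unfolding root_of_unity_power by simp

lemma root_of_unity_power_inj:
  assumes "p < N" "q < N" "root_of_unity N ^ p = root_of_unity N ^ q"
  shows "p = q"
proof -
  have "exp (2 * of_real pi * \<i> * of_nat p / of_nat N) = exp (2 * of_real pi * \<i> * of_nat q / of_nat N)"
    using assms(3) unfolding root_of_unity_power .
  then show ?thesis using assms complex_root_unity_eq[of N p q] by (simp add: cong_def)
qed

definition root_pairing :: "nat \<Rightarrow> nat \<Rightarrow> nat \<Rightarrow> complex"
  where "root_pairing N p q = (\<Sum>m<N. cnj (root_of_unity N ^ (m * p)) * root_of_unity N ^ (m * q))"

lemma root_pairing_self: "root_pairing N p p = of_nat N"
proof -
  have "cnj (root_of_unity N ^ k) * root_of_unity N ^ k = 1" for k
    using complex_norm_square[of "root_of_unity N ^ k"]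
    by (simp add: norm_power norm_root_of_unity mult.commute)
  then show ?thesis by (simp add: root_pairing_def)
qed

text \<open>
  Characters of the cyclic group of order \<open>N\<close> are orthogonal. Exponents that differ by a multiple of
  \<open>N\<close> are not separated, so averaging over roots of unity isolates a power series coefficient only
  up to terms with an exponent \<open>\<ge> N\<close>.
\<close>

lemma root_pairing_distinct:
  assumes "p < N" "q < N" "p \<noteq> q"
  shows "root_pairing N p q = 0"
proof -
  let ?w = "root_of_unity N"
  define \<zeta> where "\<zeta> = cnj (?w ^ p) * ?w ^ q"
  have 1: "cnj (?w ^ p) * ?w ^ p = 1"
    using complex_norm_square[of "?w ^ p"] by (simp add: norm_power norm_root_of_unity mult.commute)
  have "\<zeta> \<noteq> 1"
  proof
    assume "\<zeta> = 1"
    then have "cnj (?w ^ p) * ?w ^ q = cnj (?w ^ p) * ?w ^ p" using 1 by (simp add: \<zeta>_def)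
    moreover have "?w \<noteq> 0" using norm_root_of_unity[of N] by auto
    ultimately show False using root_of_unity_power_inj[OF assms(2,1)] assms(3) by auto
  qed
  moreover have "\<zeta> ^ N = 1"
  proof -
    have "\<zeta> ^ N = cnj ((?w ^ N) ^ p) * (?w ^ N) ^ q"
      by (simp add: \<zeta>_def power_mult_distrib mult.commute flip: power_mult)
    then show ?thesis using assms by (simp add: root_of_unity_power_eq_1)
  qed
  ultimately have "(\<Sum>m<N. \<zeta> ^ m) = 0" using geometric_sum[of \<zeta> N] by simp
  then show ?thesis
    by (simp add: root_pairing_def \<zeta>_def power_mult_distrib mult.commute flip: power_mult)
qed

lemma norm_root_pairing_le: "cmod (root_pairing N p q) \<le> N"
proof -
  have "cmod (root_pairing N p q)
      \<le> (\<Sum>m<N. cmod (cnj (root_of_unity N ^ (m * p)) * root_of_unity N ^ (m * q)))"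
    unfolding root_pairing_def by (rule norm_sum)
  also have "\<dots> = N" by (simp add: norm_mult norm_power norm_root_of_unity)
  finally show ?thesis .
qed

lemma infsum_tail_small:
  fixes g :: "'i \<Rightarrow> real"
  assumes "g summable_on UNIV" "\<And>i. g i \<ge> 0" "e > 0"
  obtains F where "finite F" "\<And>B. B \<inter> F = {} \<Longrightarrow> infsum g B < e"
proof -
  obtain F where F: "finite F" "dist (sum g F) (infsum g UNIV) \<le> e / 2"
    using infsum_finite_approximation[OF assms(1), of "e / 2"] assms(3) by auto
  have "infsum g B < e" if "B \<inter> F = {}" for B
  proof -
    have "infsum g B \<le> infsum g (- F)"
      using assms that by (intro infsum_mono2) (auto intro: summable_on_subset_banach)
    moreover have "infsum g UNIV = infsum g F + infsum g (- F)"
      using infsum_Un_disjoint[of g F "- F"] assms(1)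
      by (simp add: summable_on_subset_banach[OF assms(1)] F(1) Un_commute)
    ultimately show ?thesis using F assms(3) by (auto simp: dist_real_def abs_if split: if_splits)
  qed
  with F(1) that show ?thesis by blast
qed

lemma has_sum_finite_sum:
  fixes f :: "'k \<Rightarrow> 'i \<Rightarrow> 'v::topological_comm_monoid_add"
  assumes "\<And>k. k \<in> A \<Longrightarrow> (f k has_sum s k) B"
  shows "((\<lambda>x. \<Sum>k\<in>A. f k x) has_sum (\<Sum>k\<in>A. s k)) B"
  using assms by (induction A rule: infinite_finite_induct) (auto intro!: has_sum_add)

text \<open>
  Averaging over the torus of radius \<open>r\<close> against the character of \<open>\<alpha>\<close> leaves the \<open>\<alpha>\<close>-th term and
  aliased terms of high degree; for large \<open>N\<close> these are too small to cancel a nonzero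
  coefficient. With \<open>r = 1 / (2 d)\<close> the torus lies in the unit ball.
\<close>

lemma power_series_unique:
  fixes c :: "'d::finite multi_index \<Rightarrow> 'v::chilbert_space"
  assumes zero: "\<And>z. z \<in> ball 0 1 \<Longrightarrow> ((\<lambda>\<beta>. monomial z \<beta> *\<^sub>C c \<beta>) has_sum 0) UNIV"
    and abs: "\<And>r::real. 0 < r \<Longrightarrow> r * CARD('d) < 1 \<Longrightarrow> (\<lambda>\<beta>. r ^ total_degree \<beta> * norm (c \<beta>)) summable_on UNIV"
  shows "c \<alpha> = 0"
proof (rule ccontr)
  assume nz: "c \<alpha> \<noteq> 0"
  define r :: real where "r = 1 / (2 * CARD('d))"
  have r: "0 < r" "r * CARD('d) < 1" by (auto simp: r_def)
  define g where "g \<beta> = r ^ total_degree \<beta> * norm (c \<beta>)" for \<beta>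
  have g: "g summable_on UNIV" "\<And>\<beta>. g \<beta> \<ge> 0"
    unfolding g_def using abs[OF r] r by auto
  have "g \<alpha> > 0" using nz r by (simp add: g_def)
  with infsum_tail_small[OF g, of "g \<alpha>"]
  obtain F where F: "finite F" "\<And>B. B \<inter> F = {} \<Longrightarrow> infsum g B < g \<alpha>" by metis
  define N where "N = Suc (Max (total_degree ` insert \<alpha> F))"
  have N: "\<beta> i < N" if "\<beta> \<in> insert \<alpha> F" for \<beta> i
  proof -
    have "total_degree \<beta> \<le> Max (total_degree ` insert \<alpha> F)" using that F(1) by (intro Max_ge) auto
    then show ?thesis using le_total_degree[of \<beta> i] by (simp add: N_def)
  qed
  define K where "K = Pi\<^sub>E (UNIV :: 'd set) (\<lambda>_. {..<N})"
  define pt :: "('d \<Rightarrow> nat) \<Rightarrow> complex ^ 'd"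
    where "pt k = (\<chi> i. of_real r * root_of_unity N ^ k i)" for k
  \<comment> \<open>\<open>pt k\<close> are the points of the discrete torus, \<open>co k\<close> the character, \<open>q\<close> the resulting factors\<close>
  define co where "co k = (\<Prod>i\<in>UNIV. cnj (root_of_unity N ^ (k i * \<alpha> i)))" for k :: "'d \<Rightarrow> nat"
  define q where "q \<beta> = (\<Prod>i\<in>UNIV. root_pairing N (\<alpha> i) (\<beta> i))" for \<beta>
  have ball: "pt k \<in> ball 0 1" for k
  proof -
    have "norm (pt k) \<le> (\<Sum>i\<in>UNIV. norm (pt k $ i))"
      unfolding norm_vec_def by (rule L2_set_le_sum) simp
    also have "\<dots> = r * CARD('d)"
      using r by (simp add: pt_def norm_mult norm_power norm_root_of_unity)
    finally show ?thesis using r by simp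
  qed
  have mono: "co k * monomial (pt k) \<beta> = of_real (r ^ total_degree \<beta>)
      * (\<Prod>i\<in>UNIV. cnj (root_of_unity N ^ (k i * \<alpha> i)) * root_of_unity N ^ (k i * \<beta> i))" for k \<beta>
  proof -
    have "monomial (pt k) \<beta> = (\<Prod>i\<in>UNIV. of_real r ^ \<beta> i) * (\<Prod>i\<in>UNIV. root_of_unity N ^ (k i * \<beta> i))"
      unfolding monomial_def pt_def
      by (simp add: power_mult_distrib power_mult flip: prod.distrib)
    also have "(\<Prod>i\<in>UNIV. of_real r ^ \<beta> i) = (of_real (r ^ total_degree \<beta>) :: complex)"
      by (simp add: total_degree_def power_sum)
    finally show ?thesis by (simp add: co_def prod.distrib)
  qed
  have finK: "finite K" unfolding K_def by (rule finite_PiE) auto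
  have "(\<Sum>k\<in>K. co k * monomial (pt k) \<beta>) = of_real (r ^ total_degree \<beta>) * q \<beta>" for \<beta>
    unfolding mono sum_distrib_left[symmetric] q_def K_def root_pairing_def
    by (subst prod_sum_PiE) auto
  then have sum: "(\<Sum>k\<in>K. co k *\<^sub>C monomial (pt k) \<beta> *\<^sub>C c \<beta>) = (of_real (r ^ total_degree \<beta>) * q \<beta>) *\<^sub>C c \<beta>" for \<beta>
    by (simp only: scaleC_scaleC scaleC.sum_left[symmetric])
  have "((\<lambda>\<beta>. \<Sum>k\<in>K. co k *\<^sub>C monomial (pt k) \<beta> *\<^sub>C c \<beta>) has_sum (\<Sum>k\<in>K. co k *\<^sub>C 0)) UNIV"
    by (intro has_sum_finite_sum has_sum_bounded_linear[OF scaleC.bounded_linear_right] zero ball)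
  then have hs: "((\<lambda>\<beta>. (of_real (r ^ total_degree \<beta>) * q \<beta>) *\<^sub>C c \<beta>) has_sum 0) UNIV"
    unfolding sum by simp
  have nq: "cmod (q \<beta>) \<le> real N ^ CARD('d)" for \<beta>
  proof -
    have "cmod (q \<beta>) \<le> (\<Prod>i\<in>(UNIV :: 'd set). real N)"
      unfolding q_def prod_norm[symmetric] by (intro prod_mono) (simp add: norm_root_pairing_le)
    then show ?thesis by simp
  qed
  have q\<alpha>: "q \<alpha> = of_nat N ^ CARD('d)" by (simp add: q_def root_pairing_self)
  have q0: "q \<beta> = 0" if "\<beta> \<noteq> \<alpha>" "\<And>i. \<beta> i < N" for \<beta>
  proof -
    obtain i where "\<alpha> i \<noteq> \<beta> i" using \<open>\<beta> \<noteq> \<alpha>\<close> by (metis ext)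
    then have "root_pairing N (\<alpha> i) (\<beta> i) = 0"
      using that(2) N[of \<alpha>] by (intro root_pairing_distinct) auto
    then show ?thesis unfolding q_def by (intro prod_zero) auto
  qed
  define B where "B = {\<beta> :: 'd multi_index. \<exists>i. \<beta> i \<ge> N}"
  let ?t = "\<lambda>\<beta>. (of_real (r ^ total_degree \<beta>) * q \<beta>) *\<^sub>C c \<beta>"
  have nt: "norm (?t \<beta>) \<le> real N ^ CARD('d) * g \<beta>" for \<beta>
  proof -
    have "norm (?t \<beta>) = cmod (q \<beta>) * g \<beta>"
      using r by (simp add: norm_scaleC norm_mult g_def norm_power)
    also have "\<dots> \<le> real N ^ CARD('d) * g \<beta>" by (intro mult_right_mono nq g)
    finally show ?thesis .
  qed
  have \<alpha>B: "\<alpha> \<notin> B" using N[of \<alpha>] by (auto simp: B_def not_le)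
  have "(?t has_sum 0) (insert \<alpha> B)"
    using hs by (subst has_sum_cong_neutral[where g = ?t and T = UNIV])
      (auto simp: B_def not_le q0)
  then have "(?t has_sum (0 - ?t \<alpha>)) (insert \<alpha> B - {\<alpha>})"
    using has_sum_finite[of "{\<alpha>}" ?t] by (intro has_sum_Diff) auto
  then have tB: "(?t has_sum (- ?t \<alpha>)) B" using \<alpha>B by simp
  have "real N ^ CARD('d) * g \<alpha> = norm (- ?t \<alpha>)"
    using r by (simp add: norm_scaleC norm_mult g_def norm_power q\<alpha>)
  also have "\<dots> \<le> (\<Sum>\<^sub>\<infinity>\<beta>\<in>B. real N ^ CARD('d) * g \<beta>)"
  proof -
    have s: "(\<lambda>\<beta>. real N ^ CARD('d) * g \<beta>) summable_on B"
      by (intro summable_on_cmult_right summable_on_subset_banach[OF g(1)]) simp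
    have t: "(\<lambda>\<beta>. norm (?t \<beta>)) summable_on B"
      by (rule summable_on_comparison_test[OF s nt]) simp
    have "norm (- ?t \<alpha>) \<le> (\<Sum>\<^sub>\<infinity>\<beta>\<in>B. norm (?t \<beta>))"
      using norm_infsum_bound[of ?t B] t infsumI[OF tB] by simp
    also have "\<dots> \<le> (\<Sum>\<^sub>\<infinity>\<beta>\<in>B. real N ^ CARD('d) * g \<beta>)"
      by (rule infsum_mono[OF t s nt])
    finally show ?thesis .
  qed
  also have "\<dots> = real N ^ CARD('d) * infsum g B"
    by (rule infsum_cmult_right')
  also have "\<dots> < real N ^ CARD('d) * g \<alpha>"
  proof (intro mult_strict_left_mono F(2))
    show "B \<inter> F = {}" using N by (auto simp: B_def not_le[symmetric])
    have "0 < N" by (simp add: N_def)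
    then show "0 < real N ^ CARD('d)" by simp
  qed
  finally show False by simp
qed

lemma mult_le_sum_squares:
  fixes p q :: real
  assumes "p \<ge> 0" "q \<ge> 0"
  shows "p * q \<le> p\<^sup>2 + q\<^sup>2"
  using sum_squares_bound[of p q] mult_nonneg_nonneg[OF assms] by (simp only: mult.assoc)

section \<open>Weighted power series spaces\<close>

locale invariant_weights =
  fixes a :: "nat \<Rightarrow> real"
  assumes a_0: "a 0 = 1" and a_pos: "a n > 0"
    and a_summable: "0 \<le> r \<Longrightarrow> r < 1 \<Longrightarrow> summable (\<lambda>n. a n * r ^ n)"
begin

abbreviation wt :: "'d::finite multi_index \<Rightarrow> real"
  where "wt \<equiv> multi_coeff a"

lemma multi_coeff_pos: "wt \<alpha> > 0"
  by (simp add: multi_coeff_eq a_pos multinomial_pos)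

text \<open>
  The unitary from \<open>ell2\<close> to \<open>H\<^sub>s \<otimes> E\<close> that normalises the monomials. Operators are built on \<open>ell2\<close>,
  where norms are available from the type, and carried over at the end.
\<close>

definition Hs_of :: "('d::finite multi_index, 'h::chilbert_space) ell2 \<Rightarrow> 'd multi_index \<Rightarrow> 'h"
  where "Hs_of x \<alpha> = sqrt (wt \<alpha>) *\<^sub>R ell2_nth x \<alpha>"

lemma norm_Hs_of: "(norm (Hs_of x \<alpha>))\<^sup>2 / wt \<alpha> = (norm (ell2_nth x \<alpha>))\<^sup>2"
  using multi_coeff_pos[of \<alpha>] by (simp add: Hs_of_def power_mult_distrib)

lemma closed_csubspace_scaleR: "closed_csubspace E \<Longrightarrow> x \<in> E \<Longrightarrow> r *\<^sub>R x \<in> E"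
  by (simp add: closed_csubspace_def scaleR_scaleC)

lemma Hs_of_in_Hs:
  assumes "closed_csubspace E" "\<And>\<alpha>. ell2_nth x \<alpha> \<in> E"
  shows "Hs_of x \<in> Hs a E"
  unfolding Hs_def
  using assms by (auto simp: norm_Hs_of ell2_norm_summable)
    (simp add: Hs_of_def closed_csubspace_scaleR)

lemma Hs_of_in_Hs_UNIV: "Hs_of x \<in> Hs a UNIV"
  by (simp add: Hs_of_in_Hs closed_csubspace_UNIV)

lemma Hs_of_surj:
  fixes c :: "'d::finite multi_index \<Rightarrow> 'h::chilbert_space"
  assumes E: "closed_csubspace E" and c: "c \<in> Hs a E"
  obtains x where "c = Hs_of x" "\<And>\<alpha>. ell2_nth x \<alpha> \<in> E"
proof -
  define x where "x = Abs_ell2 (\<lambda>\<alpha>. (1 / sqrt (wt \<alpha>)) *\<^sub>R c \<alpha>)"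
  have "(norm ((1 / sqrt (wt \<alpha>)) *\<^sub>R c \<alpha>))\<^sup>2 = (norm (c \<alpha>))\<^sup>2 / wt \<alpha>" for \<alpha>
    using multi_coeff_pos[of \<alpha>] by (simp add: power_mult_distrib power_divide)
  then have x: "ell2_nth x = (\<lambda>\<alpha>. (1 / sqrt (wt \<alpha>)) *\<^sub>R c \<alpha>)"
    unfolding x_def using c by (intro ell2_nth_Abs) (simp add: Hs_def)
  have "c = Hs_of x"
  proof
    show "c \<alpha> = Hs_of x \<alpha>" for \<alpha> using multi_coeff_pos[of \<alpha>] by (simp add: Hs_of_def x)
  qed
  moreover have "ell2_nth x \<alpha> \<in> E" for \<alpha>
    using c E by (simp add: x Hs_def closed_csubspace_scaleR)
  ultimately show ?thesis using that by blast
qed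

lemma Hs_inner_Hs_of: "Hs_inner a (Hs_of x) (Hs_of y) = cinner x y"
proof -
  have "cinner (Hs_of x \<alpha>) (Hs_of y \<alpha>) / complex_of_real (wt \<alpha>)
      = cinner (ell2_nth x \<alpha>) (ell2_nth y \<alpha>)" for \<alpha>
    using multi_coeff_pos[of \<alpha>] by (simp add: Hs_of_def cinner.scaleR_left cinner.scaleR_right
        scaleR_conv_of_real mult.assoc[symmetric] flip: of_real_mult)
  then show ?thesis unfolding Hs_inner_def by (simp add: cinner_ell2.rep_eq)
qed

lemma Hs_norm_Hs_of: "Hs_norm a (Hs_of x) = norm x"
  unfolding Hs_norm_def norm_Hs_of using norm_ell2_sq[of x] by (metis norm_ge_zero real_sqrt_unique)

lemma Hs_of_inject: "Hs_of x = Hs_of y \<longleftrightarrow> x = y"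
proof
  assume eq: "Hs_of x = Hs_of y"
  show "x = y"
  proof (rule ell2_eqI)
    show "ell2_nth x \<alpha> = ell2_nth y \<alpha>" for \<alpha>
      using fun_cong[OF eq, of \<alpha>] multi_coeff_pos[of \<alpha>] by (simp add: Hs_of_def)
  qed
qed simp

section \<open>Point evaluations\<close>

definition kern :: "complex ^ 'd::finite \<Rightarrow> complex ^ 'd \<Rightarrow> complex"
  where "kern z w = (\<Sum>n. of_real (a n) * herm z w ^ n)"

lemma norm_sq_vec: "(norm (z :: complex ^ 'd::finite))\<^sup>2 = (\<Sum>i\<in>UNIV. (cmod (z $ i))\<^sup>2)"
  unfolding norm_vec_def L2_set_def by (simp add: sum_nonneg)

lemma degree_sum_norm_monomial:
  "degree_sum n (\<lambda>\<alpha>. (cmod (monomial z \<alpha>))\<^sup>2) = ((norm z)\<^sup>2) ^ n"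
proof -
  have "(cmod (monomial z \<alpha>))\<^sup>2 = (\<Prod>i\<in>UNIV. ((cmod (z $ i))\<^sup>2) ^ \<alpha> i)" for \<alpha>
    unfolding norm_monomial prod_power_distrib by (simp add: mult.commute flip: power_mult)
  then show ?thesis unfolding norm_sq_vec degree_sum_prod_power[symmetric] by simp
qed

lemma monomial_summable:
  assumes "norm z < 1"
  shows "(\<lambda>\<alpha>. wt \<alpha> * (cmod (monomial z \<alpha>))\<^sup>2) summable_on UNIV"
proof (rule abs_summable_total_degree)
  show "summable (\<lambda>n. a n * ((norm z)\<^sup>2) ^ n)"
    using assms by (intro a_summable) (auto simp: power_less_one_iff abs_square_less_1)
  show "(\<Sum>\<alpha> | total_degree \<alpha> = n. wt \<alpha> * (cmod (monomial z \<alpha>))\<^sup>2) \<le> a n * ((norm z)\<^sup>2) ^ n" for n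
    using degree_sum_multi_coeff[of a "\<lambda>\<alpha>. (cmod (monomial z \<alpha>))\<^sup>2" n]
    by (simp add: degree_sum_norm_monomial)
  show "0 \<le> wt \<alpha> * (cmod (monomial z \<alpha>))\<^sup>2" for \<alpha>
    using multi_coeff_pos[of \<alpha>] by simp
qed

lemma kern_has_sum:
  assumes "norm z < 1" "norm w < 1"
  shows "((\<lambda>\<alpha>. of_real (wt \<alpha>) * (monomial z \<alpha> * cnj (monomial w \<alpha>))) has_sum kern z w) UNIV"
proof -
  let ?f = "\<lambda>\<alpha>. of_real (wt \<alpha>) * (monomial z \<alpha> * cnj (monomial w \<alpha>))"
  have "(\<lambda>\<alpha>. norm (?f \<alpha>)) summable_on UNIV"
  proof (rule summable_on_comparison_test)
    show "(\<lambda>\<alpha>. wt \<alpha> * (cmod (monomial z \<alpha>))\<^sup>2 + wt \<alpha> * (cmod (monomial w \<alpha>))\<^sup>2) summable_on UNIV"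
      by (intro summable_on_add monomial_summable assms)
    show "norm (?f \<alpha>) \<le> wt \<alpha> * (cmod (monomial z \<alpha>))\<^sup>2 + wt \<alpha> * (cmod (monomial w \<alpha>))\<^sup>2" for \<alpha>
    proof -
      have "cmod (monomial z \<alpha>) * cmod (monomial w \<alpha>) \<le> (cmod (monomial z \<alpha>))\<^sup>2 + (cmod (monomial w \<alpha>))\<^sup>2"
        by (rule mult_le_sum_squares) simp_all
      then show ?thesis
        using multi_coeff_pos[of \<alpha>]
        by (simp add: norm_mult distrib_left[symmetric] mult_left_mono)
    qed
  qed simp
  then have hs: "(?f has_sum infsum ?f UNIV) UNIV"
    by (rule has_sum_infsum[OF abs_summable_summable])
  have "(\<Sum>\<alpha> | total_degree \<alpha> = n. ?f \<alpha>) = of_real (a n) * herm z w ^ n" for n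
  proof -
    have "monomial z \<alpha> * cnj (monomial w \<alpha>) = (\<Prod>i\<in>UNIV. (z $ i * cnj (w $ i)) ^ \<alpha> i)" for \<alpha>
      by (simp add: monomial_def power_mult_distrib prod.distrib)
    then show ?thesis
      using degree_sum_multi_coeff[of a "\<lambda>\<alpha>. monomial z \<alpha> * cnj (monomial w \<alpha>)" n]
      by (simp add: degree_sum_prod_power herm_def scaleR_conv_of_real)
  qed
  then have "(\<lambda>n. of_real (a n) * herm z w ^ n) sums infsum ?f UNIV"
    using has_sum_total_degree[OF hs] by simp
  then have "kern z w = infsum ?f UNIV" unfolding kern_def by (rule sums_unique[symmetric])
  with hs show ?thesis by simp
qed

text \<open>
  The vector \<open>s(\<cdot>, z) \<otimes> u\<close> in the orthonormal coordinates: it represents the point evaluation at \<open>z\<close>.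
\<close>

definition kernel_vec :: "complex ^ 'd::finite \<Rightarrow> 'h::chilbert_space \<Rightarrow> ('d multi_index, 'h) ell2"
  where "kernel_vec z u = Abs_ell2 (\<lambda>\<alpha>. (of_real (sqrt (wt \<alpha>)) * cnj (monomial z \<alpha>)) *\<^sub>C u)"

lemma ell2_nth_kernel_vec:
  assumes "norm z < 1"
  shows "ell2_nth (kernel_vec z u) \<alpha> = (of_real (sqrt (wt \<alpha>)) * cnj (monomial z \<alpha>)) *\<^sub>C u"
proof -
  have "(norm ((of_real (sqrt (wt \<alpha>)) * cnj (monomial z \<alpha>)) *\<^sub>C u))\<^sup>2
      = (wt \<alpha> * (cmod (monomial z \<alpha>))\<^sup>2) * (norm u)\<^sup>2" for \<alpha>
    using multi_coeff_pos[of \<alpha>] by (simp add: norm_scaleC norm_mult power_mult_distrib)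
  then show ?thesis
    unfolding kernel_vec_def
    by (subst ell2_nth_Abs) (simp_all add: summable_on_cmult_left monomial_summable assms)
qed

lemma Hs_value_summable:
  assumes "norm z < 1"
  shows "(\<lambda>\<alpha>. norm (monomial z \<alpha> *\<^sub>C Hs_of x \<alpha>)) summable_on UNIV"
proof (rule summable_on_comparison_test)
  show "(\<lambda>\<alpha>. wt \<alpha> * (cmod (monomial z \<alpha>))\<^sup>2 + (norm (ell2_nth x \<alpha>))\<^sup>2) summable_on UNIV"
    by (intro summable_on_add monomial_summable ell2_norm_summable assms)
  show "norm (monomial z \<alpha> *\<^sub>C Hs_of x \<alpha>) \<le> wt \<alpha> * (cmod (monomial z \<alpha>))\<^sup>2 + (norm (ell2_nth x \<alpha>))\<^sup>2" for \<alpha>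
  proof -
    let ?p = "sqrt (wt \<alpha>) * cmod (monomial z \<alpha>)"
    have "?p * norm (ell2_nth x \<alpha>) \<le> ?p\<^sup>2 + (norm (ell2_nth x \<alpha>))\<^sup>2"
      using multi_coeff_pos[of \<alpha>] by (intro mult_le_sum_squares) (simp_all add: less_imp_le)
    then show ?thesis
      using multi_coeff_pos[of \<alpha>] by (simp add: norm_scaleC Hs_of_def power_mult_distrib ac_simps)
  qed
qed simp

lemma Hs_value_has_sum:
  "norm z < 1 \<Longrightarrow> ((\<lambda>\<alpha>. monomial z \<alpha> *\<^sub>C Hs_of x \<alpha>) has_sum Hs_value (Hs_of x) z) UNIV"
  unfolding Hs_value_def by (rule has_sum_infsum[OF abs_summable_summable[OF Hs_value_summable]])

lemma cinner_kernel_vec: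
  assumes "norm z < 1"
  shows "cinner (Hs_value (Hs_of x) z) u = cinner x (kernel_vec z u)"
proof (rule has_sum_unique)
  show "((\<lambda>\<alpha>. cinner (monomial z \<alpha> *\<^sub>C Hs_of x \<alpha>) u) has_sum cinner (Hs_value (Hs_of x) z) u) UNIV"
    by (intro has_sum_bounded_linear[OF cinner.bounded_linear_left] Hs_value_has_sum assms)
  have "cinner (ell2_nth x \<alpha>) (ell2_nth (kernel_vec z u) \<alpha>) = cinner (monomial z \<alpha> *\<^sub>C Hs_of x \<alpha>) u" for \<alpha>
    by (simp add: ell2_nth_kernel_vec[OF assms] Hs_of_def cinner_scaleC_left cinner_scaleC_right
        cinner.scaleR_left scaleR_conv_of_real)
  then show "((\<lambda>\<alpha>. cinner (monomial z \<alpha> *\<^sub>C Hs_of x \<alpha>) u) has_sum cinner x (kernel_vec z u)) UNIV"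
    using ell2_cinner_has_sum[of x "kernel_vec z u"] by simp
qed

lemma cinner_kernel_vec_kernel_vec:
  assumes "norm z < 1" "norm w < 1"
  shows "cinner (kernel_vec w u) (kernel_vec z v) = kern z w * cinner u v"
proof (rule has_sum_unique[OF ell2_cinner_has_sum])
  have "cinner (ell2_nth (kernel_vec w u) \<alpha>) (ell2_nth (kernel_vec z v) \<alpha>)
      = of_real (wt \<alpha>) * (monomial z \<alpha> * cnj (monomial w \<alpha>)) * cinner u v" for \<alpha>
    using multi_coeff_pos[of \<alpha>]
    by (simp add: ell2_nth_kernel_vec assms cinner_scaleC_left cinner_scaleC_right
        flip: of_real_mult)
  then show "((\<lambda>\<alpha>. cinner (ell2_nth (kernel_vec w u) \<alpha>) (ell2_nth (kernel_vec z v) \<alpha>))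
      has_sum (kern z w * cinner u v)) UNIV"
    using has_sum_cmult_left[OF kern_has_sum[OF assms], of "cinner u v"] by simp
qed

lemma norm_kernel_vec:
  assumes "norm z < 1"
  shows "norm (kernel_vec z u) = sqrt (Re (kern z z)) * norm u"
proof -
  have "(norm (kernel_vec z u))\<^sup>2 = Re (kern z z) * (norm u)\<^sup>2"
    using norm_sq_cinner[of "kernel_vec z u"]
    by (simp only: cinner_kernel_vec_kernel_vec[OF assms assms]) (simp add: cinner_self)
  then have "norm (kernel_vec z u) = sqrt (Re (kern z z) * (norm u)\<^sup>2)"
    by (metis norm_ge_zero real_sqrt_unique)
  then show ?thesis by (simp add: real_sqrt_mult)
qed

lemma bounded_clinear_Hs_value:
  assumes "norm z < 1"
  shows "bounded_clinear (\<lambda>x. Hs_value (Hs_of x) z)"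
proof (rule bounded_clinearI)
  let ?K = "sqrt (Re (kern z z))"
  show "Hs_value (Hs_of (x + y)) z = Hs_value (Hs_of x) z + Hs_value (Hs_of y) z" for x y
    by (rule cinner_ext_left) (simp add: cinner_add_left cinner_kernel_vec[OF assms])
  show "Hs_value (Hs_of (c *\<^sub>C x)) z = c *\<^sub>C Hs_value (Hs_of x) z" for c x
    by (rule cinner_ext_left) (simp add: cinner_scaleC_left cinner_kernel_vec[OF assms])
  show "norm (Hs_value (Hs_of x) z) \<le> ?K * norm x" for x
  proof (cases "Hs_value (Hs_of x) z = 0")
    case True
    have "0 \<le> ?K * norm (1::complex)" unfolding norm_kernel_vec[OF assms, symmetric] by simp
    then show ?thesis using True by simp
  next
    case False
    have "(norm (Hs_value (Hs_of x) z))\<^sup>2 = Re (cinner x (kernel_vec z (Hs_value (Hs_of x) z)))"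
      by (simp add: norm_sq_cinner cinner_kernel_vec[OF assms])
    also have "\<dots> \<le> norm x * norm (kernel_vec z (Hs_value (Hs_of x) z))"
      by (rule Re_cinner_le)
    finally show ?thesis
      using False by (simp add: norm_kernel_vec[OF assms] power2_eq_square ac_simps)
  qed
qed

lemma Hs_value_unique:
  assumes "\<And>z. z \<in> ball 0 1 \<Longrightarrow> Hs_value (Hs_of x) z = Hs_value (Hs_of y) z"
  shows "x = y"
proof -
  have zero: "Hs_value (Hs_of (x - y)) z = 0" if "z \<in> ball 0 1" for z
    using bounded_clinearD(3)[OF bounded_clinear_Hs_value, of z x y] assms[OF that] that by simp
  have "Hs_of (x - y) \<alpha> = 0" for \<alpha>
  proof (rule power_series_unique)
    show "((\<lambda>\<beta>. monomial z \<beta> *\<^sub>C Hs_of (x - y) \<beta>) has_sum 0) UNIV" if "z \<in> ball 0 1" for z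
      using Hs_value_has_sum[of z "x - y"] zero[OF that] that by simp
    fix r :: real assume r: "0 < r" "r * CARD('a) < 1"
    let ?z = "(\<chi> i. of_real r) :: complex ^ 'a"
    have "norm ?z \<le> (\<Sum>i\<in>UNIV. norm (?z $ i))" unfolding norm_vec_def by (rule L2_set_le_sum) simp
    then have "norm ?z < 1" using r by (simp add: mult.commute)
    moreover have "cmod (monomial ?z \<beta>) = r ^ total_degree \<beta>" for \<beta>
      unfolding norm_monomial using r by (simp add: total_degree_def power_sum)
    ultimately show "(\<lambda>\<beta>. r ^ total_degree \<beta> * norm (Hs_of (x - y) \<beta>)) summable_on UNIV"
      using Hs_value_summable[of ?z "x - y"] by (simp add: norm_scaleC)
  qed
  then have "Hs_of (x - y) = Hs_of 0" by (auto simp: Hs_of_def zero_ell2.rep_eq)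
  then show ?thesis by (simp add: Hs_of_inject)
qed

end

section \<open>Positive semidefinite matrices\<close>

definition psd :: "nat \<Rightarrow> (nat \<Rightarrow> nat \<Rightarrow> complex) \<Rightarrow> bool"
  where "psd N F \<longleftrightarrow> (\<forall>v. (\<Sum>p<N. \<Sum>q<N. cnj (v p) * F p q * v q) \<in> \<real>\<^sub>\<ge>\<^sub>0)"

lemma bounded_clinear_sum:
  "bounded_clinear A \<Longrightarrow> A (\<Sum>p\<in>S. c p *\<^sub>C x p) = (\<Sum>p\<in>S. c p *\<^sub>C A (x p))"
  by (induction S rule: infinite_finite_induct) (simp_all add: bounded_clinearD)

lemma bounded_clinear_finite_sum:
  assumes "\<And>k. k \<in> S \<Longrightarrow> bounded_clinear (A k)"
  shows "bounded_clinear (\<lambda>x. \<Sum>k\<in>S. A k x)"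
  using assms unfolding bounded_clinear_def
  by (auto intro: bounded_linear_sum simp: scaleC.sum_right)

lemma cnj_mult_self_norm: "z * cnj z = complex_of_real ((cmod z)\<^sup>2)" for z
  using complex_norm_square[of z] by simp

text \<open>
  The Gram vectors are the columns of the square root of the matrix. The matrix is extended by zero
  to the sequence space, so that the square root from above applies; the square root vanishes outside
  the first \<open>N\<close> rows and columns as well, and \<open>N\<close> coordinates suffice.
\<close>

lemma psd_gram:
  assumes "psd N F"
  obtains W where "\<And>p q. p < N \<Longrightarrow> q < N \<Longrightarrow> F p q = (\<Sum>k<N. W p k * cnj (W q k))"
proof -
  define A where "A x = (\<Sum>p<N. (\<Sum>q<N. F p q * ell2_nth x q) *\<^sub>C ell2_single p (1::complex))"
    for x :: "(nat, complex) ell2"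
  have cA: "cinner (A x) y = (\<Sum>p<N. \<Sum>q<N. cnj (ell2_nth y p) * F p q * ell2_nth x q)" for x y
    unfolding A_def cinner.sum_left cinner_scaleC_left
    by (intro sum.cong refl, subst cinner_commute)
      (simp add: cinner_ell2_single cinner_complex_def sum_distrib_left sum_distrib_right mult_ac)
  have "bounded_clinear A"
    unfolding A_def
  proof (intro bounded_clinear_finite_sum)
    fix p
    let ?f = "\<lambda>x. \<Sum>q<N. F p q * ell2_nth x q"
    have f: "bounded_clinear ?f"
      by (intro bounded_clinear_finite_sum)
        (auto simp: bounded_clinear_def scaleC_complex_def algebra_simps
          bounded_clinearD(5)[OF bounded_clinear_ell2_nth]
          intro!: bounded_linear_const_mult bounded_linear_mult_const bounded_clinearD(1)[OF bounded_clinear_ell2_nth])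
    have "bounded_linear (\<lambda>x. ?f x *\<^sub>C ell2_single p (1::complex) :: (nat, complex) ell2)"
      using bounded_linear_compose[OF scaleC.bounded_linear_left bounded_clinearD(1)[OF f]] .
    then show "bounded_clinear (\<lambda>x. ?f x *\<^sub>C ell2_single p (1::complex) :: (nat, complex) ell2)"
      using bounded_clinearD(5)[OF f] by (simp add: bounded_clinear_def scaleC_scaleC scaleC_complex_def)
  qed
  then have "positive_op A"
    using assms by (simp add: positive_op_def cA psd_def)
  then obtain D where D: "positive_op D" "D \<circ> D = A" using positive_sqrt_exists by blast
  have herm: "cinner (D x) (D y) = cinner (A x) y" for x y
    using positive_op_hermitian[OF D(1)] unfolding hermitian_def D(2)[symmetric] by simp
  let ?e = "\<lambda>p. ell2_single p (1::complex) :: (nat, complex) ell2"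
  have zero: "D (?e k) = 0" if "k \<ge> N" for k
  proof -
    have "cinner (D (?e k)) (D (?e k)) = 0"
      unfolding herm cA using that by (intro sum.neutral) (auto simp: ell2_nth_single)
    then show ?thesis by (simp add: cinner_self)
  qed
  have coord: "ell2_nth (D x) k = 0" if "k \<ge> N" for k x
  proof -
    have "ell2_nth (D x) k = cinner (D x) (?e k)"
      by (simp add: cinner_ell2_single cinner_complex_def)
    also have "\<dots> = cinner x (D (?e k))"
      using positive_op_hermitian[OF D(1)] by (simp add: hermitian_def)
    finally show ?thesis using zero[OF that] by simp
  qed
  have "F p q = (\<Sum>k<N. cnj (ell2_nth (D (?e p)) k) * cnj (cnj (ell2_nth (D (?e q)) k)))"
    if "p < N" "q < N" for p q
  proof -
    have "cinner (A (?e q)) (?e p) = F p q"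
    proof -
      have 1: "(\<Sum>j<N. f j * (if j = q then 1 else 0)) = f q" for f :: "nat \<Rightarrow> complex"
        using \<open>q < N\<close> by (simp add: if_distrib[of "(*) _"] cong: if_cong)
      have "cinner (A (?e q)) (?e p) = (\<Sum>i<N. if i = p then F i q else 0)"
        unfolding cA ell2_nth_single 1 by (intro sum.cong refl) simp
      then show ?thesis using that by simp
    qed
    moreover have "cinner (D (?e q)) (D (?e p))
        = (\<Sum>k<N. ell2_nth (D (?e q)) k * cnj (ell2_nth (D (?e p)) k))"
      by (rule has_sum_unique[OF ell2_cinner_has_sum has_sum_finite_neutralI])
        (auto simp: coord cinner_complex_def)
    ultimately show ?thesis by (simp add: herm mult.commute)
  qed
  then show ?thesis by (rule that)
qed

section \<open>Change of base point in the complete Pick property\<close>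

lemma projection_off_vector:
  fixes e :: "'a::complex_inner"
  assumes "e \<noteq> 0"
  defines "P \<equiv> \<lambda>x. x - (cinner x e / cinner e e) *\<^sub>C e"
  shows "bounded_clinear P" "P e = 0" "norm (P x) \<le> norm x"
    "cinner (P x) (P y) = cinner x y - cinner x e * cinner e y / cinner e e"
proof -
  have e: "cinner e e \<noteq> 0" using assms(1) by (simp add: cinner_self)
  have "bounded_clinear (\<lambda>x. (cinner x e / cinner e e) *\<^sub>C e)"
  proof (rule bounded_clinearI)
    fix x
    have "cmod (cinner e e) = (norm e)\<^sup>2" by (simp add: cinner_self norm_power)
    then have "norm ((cinner x e / cinner e e) *\<^sub>C e) = cmod (cinner x e) / norm e"
      using assms(1) by (simp add: norm_scaleC norm_divide power2_eq_square)
    also have "\<dots> \<le> 1 * norm x"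
      using norm_cinner_le[of x e] assms(1) by (simp add: divide_simps)
    finally show "norm ((cinner x e / cinner e e) *\<^sub>C e) \<le> 1 * norm x" .
  qed (simp_all add: cinner_add_left cinner_scaleC_left add_divide_distrib scaleC_add_left scaleC_scaleC)
  then show "bounded_clinear P" unfolding P_def by (intro bounded_clinear_diff bounded_clinear_id)
  show "P e = 0" using e scaleR_scaleC[of 1 e] by (simp add: P_def)
  have ip: "cinner (P x) (P y) = cinner x y - cinner x e * cinner e y / cinner e e" for x y
  proof -
    have "cnj (cinner y e) = cinner e y" by (metis cinner_commute)
    moreover have "cnj (cinner e e) = cinner e e" by (metis cinner_commute)
    ultimately show ?thesis using e
      by (simp add: P_def cinner.diff_left cinner.diff_right cinner_scaleC_left cinner_scaleC_right)
  qed
  then show "cinner (P x) (P y) = cinner x y - cinner x e * cinner e y / cinner e e" .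
  have "(norm (P x))\<^sup>2 = (norm x)\<^sup>2 - Re (cinner x e * cinner e x / cinner e e)"
    by (simp add: norm_sq_cinner ip)
  moreover have "cinner x e * cinner e x / cinner e e = of_real ((cmod (cinner x e))\<^sup>2 / (norm e)\<^sup>2)"
    using cnj_mult_self_norm[of "cinner x e"] cinner_commute[of e x] by (simp add: cinner_self)
  ultimately show "norm (P x) \<le> norm x" by (intro norm_le_sq_le) simp
qed

context invariant_weights
begin

text \<open>
  This is contractivity of the adjoint \<open>s(\<cdot>, x) \<mapsto> \<Phi>(x)\<^sup>* s(\<cdot>, x)\<close> on combinations of kernel functions.
  The multiplier is applied to the vector \<open>f\<close> that the adjoint would produce. By the reproducing
  property \<open>\<parallel>f\<parallel>\<^sup>2 = \<langle>M f, \<Sum> v\<^sub>p s(\<cdot>, x\<^sub>p)\<rangle>\<close>, and the Cauchy-Schwarz inequality finishes the proof.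
\<close>

lemma contractive_multiplier_kernels:
  fixes \<Phi> :: "complex ^ 'd::finite \<Rightarrow> nat \<Rightarrow> nat \<Rightarrow> complex"
  assumes \<Phi>: "contractive_multiplier a 1 n \<Phi>" and x: "\<And>p. p \<in> S \<Longrightarrow> norm (x p) < 1"
  shows "(\<Sum>k<n. (norm (\<Sum>p\<in>S. (v p * cnj (\<Phi> (x p) 0 k)) *\<^sub>C kernel_vec (x p) (1::complex)))\<^sup>2)
    \<le> (norm (\<Sum>p\<in>S. v p *\<^sub>C kernel_vec (x p) (1::complex)))\<^sup>2"
proof -
  let ?\<kappa> = "\<lambda>p. kernel_vec (x p) (1::complex)"
  define f where "f k = (\<Sum>p\<in>S. (v p * cnj (\<Phi> (x p) 0 k)) *\<^sub>C ?\<kappa> p)" for k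
  obtain g where g: "g 0 \<in> Hs a UNIV"
    "\<And>z. norm z < 1 \<Longrightarrow> Hs_value (g 0) z = (\<Sum>k<n. \<Phi> z 0 k * Hs_value (Hs_of (f k)) z)"
    "(Hs_norm a (g 0))\<^sup>2 \<le> (\<Sum>k<n. (Hs_norm a (Hs_of (f k)))\<^sup>2)"
    using \<Phi>[unfolded contractive_multiplier_def, rule_format, of "\<lambda>k. Hs_of (f k)"]
    by (auto simp: Hs_of_in_Hs_UNIV)
  obtain y where y: "g 0 = Hs_of y" using Hs_of_surj[OF closed_csubspace_UNIV g(1)] by metis
  have val: "Hs_value (Hs_of h) (x p) = cinner h (?\<kappa> p)" if "p \<in> S" for h p
    using cinner_kernel_vec[OF x[OF that], of h 1] by (simp add: cinner_complex_def)
  define t where "t = (\<Sum>k<n. (norm (f k))\<^sup>2)"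
  have "of_real t = (\<Sum>k<n. cinner (f k) (f k))" by (simp add: t_def cinner_self)
  also have "\<dots> = (\<Sum>k<n. \<Sum>p\<in>S. cnj (v p) * (\<Phi> (x p) 0 k * cinner (f k) (?\<kappa> p)))"
  proof (intro sum.cong refl)
    fix k
    have "cinner h (f k) = (\<Sum>p\<in>S. cnj (v p) * (\<Phi> (x p) 0 k * cinner h (?\<kappa> p)))" for h
      by (simp add: f_def cinner.sum_right cinner_scaleC_right mult.assoc)
    then show "cinner (f k) (f k) = (\<Sum>p\<in>S. cnj (v p) * (\<Phi> (x p) 0 k * cinner (f k) (?\<kappa> p)))" .
  qed
  also have "\<dots> = (\<Sum>p\<in>S. cnj (v p) * (\<Sum>k<n. \<Phi> (x p) 0 k * cinner (f k) (?\<kappa> p)))"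
    by (subst sum.swap) (simp add: sum_distrib_left)
  also have "\<dots> = (\<Sum>p\<in>S. cnj (v p) * cinner y (?\<kappa> p))"
    using g(2)[OF x] by (intro sum.cong) (simp_all add: y val)
  also have "\<dots> = cinner y (\<Sum>p\<in>S. v p *\<^sub>C ?\<kappa> p)"
    by (simp add: cinner.sum_right cinner_scaleC_right)
  finally have "t = cmod (cinner y (\<Sum>p\<in>S. v p *\<^sub>C ?\<kappa> p))"
    using norm_of_real[of t, where 'a = complex] by (simp add: t_def sum_nonneg del: of_real_sum)
  also have "\<dots> \<le> norm y * norm (\<Sum>p\<in>S. v p *\<^sub>C ?\<kappa> p)" by (rule norm_cinner_le)
  finally have 1: "t \<le> norm y * norm (\<Sum>p\<in>S. v p *\<^sub>C ?\<kappa> p)" .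
  have 2: "(norm y)\<^sup>2 \<le> t" using g(3) by (simp add: y Hs_norm_Hs_of t_def)
  have "t \<le> m\<^sup>2" if "t \<le> norm y * m" "m \<ge> 0" for m
  proof (cases "norm y \<le> m")
    case True
    have "norm y * m \<le> m * m" by (intro mult_right_mono True that)
    with that show ?thesis by (simp add: power2_eq_square)
  next
    case False
    then have "norm y * m < norm y * norm y" using that(2) by (intro mult_strict_left_mono) auto
    with that(1) 2 show ?thesis by (simp add: power2_eq_square)
  qed
  from this[OF 1] have "t \<le> (norm (\<Sum>p\<in>S. v p *\<^sub>C ?\<kappa> p))\<^sup>2" by simp
  then show ?thesis by (simp add: t_def f_def)
qed

lemma kern_commute: "norm z < 1 \<Longrightarrow> norm w < 1 \<Longrightarrow> kern w z = cnj (kern z w)"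
  using cinner_kernel_vec_kernel_vec[of z w 1 "1::complex"] cinner_kernel_vec_kernel_vec[of w z 1 "1::complex"]
    cinner_commute[of "kernel_vec w (1::complex)" "kernel_vec z 1"]
  by (simp add: cinner_complex_def) (metis complex_cnj_cnj)

lemma kern_self_pos:
  assumes "norm (z :: complex ^ 'd::finite) < 1" "kern z z \<noteq> 0"
  obtains r where "kern z z = complex_of_real r" "r > 0"
proof -
  have "kern z z = of_real ((norm (kernel_vec z (1::complex)))\<^sup>2)"
    using cinner_kernel_vec_kernel_vec[OF assms(1) assms(1), of 1 "1::complex"]
    by (simp add: cinner_complex_def cinner_self)
  moreover from this assms(2) have "(norm (kernel_vec z (1::complex)))\<^sup>2 > 0" by auto
  ultimately show ?thesis using that by blast
qed

text \<open>
  \<open>1 - 1/s\<close> for the kernel that is rescaled to be 1 when one argument is the base point \<open>c\<close>. By a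
  theorem of McCullough and Quiggin its positivity characterises the irreducible complete Pick kernels.
\<close>

definition base_gram :: "complex ^ 'd::finite \<Rightarrow> complex ^ 'd \<Rightarrow> complex ^ 'd \<Rightarrow> complex"
  where "base_gram c z w = 1 - kern z c * kern c w / (kern z w * kern c c)"

text \<open>
  Positivity at the base point \<open>c\<close> is used to set up an interpolation problem: write the matrix as
  \<open>W W\<^sup>*\<close>. Then \<open>(1 - W W\<^sup>*) s\<close> has rank one and is positive, so some contractive multiplier takes the
  values \<open>W\<^sub>p\<close>. This multiplier is also defined at \<open>y\<close>. Compressing its adjoint to the complement of
  \<open>s(\<cdot>, y)\<close> replaces \<open>s\<close> by \<open>s\<close> times the matrix at the base point \<open>y\<close>, and the compression is again a
  contraction; as \<open>(1 - W W\<^sup>*) s\<close> has rank one, positivity of the matrix at \<open>y\<close> itself results.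
\<close>

lemma base_gram_change:
  fixes x :: "nat \<Rightarrow> complex ^ 'd::finite"
  assumes pick: "complete_Pick (kern :: complex ^ 'd \<Rightarrow> _) a"
    and nz: "\<And>z w :: complex ^ 'd. norm z < 1 \<Longrightarrow> norm w < 1 \<Longrightarrow> kern z w \<noteq> 0"
    and x: "inj_on x {..<N}" "\<And>p. p < N \<Longrightarrow> norm (x p) < 1" and c: "norm c < 1" and y: "norm y < 1"
    and psd: "psd N (\<lambda>p q. base_gram c (x p) (x q))"
  shows "psd N (\<lambda>p q. base_gram y (x p) (x q))"
proof -
  obtain W where W: "\<And>p q. p < N \<Longrightarrow> q < N \<Longrightarrow> base_gram c (x p) (x q) = (\<Sum>k<N. W p k * cnj (W q k))"
    using psd_gram[OF psd] by blast
  obtain r where r: "kern c c = complex_of_real r" "r > 0" using kern_self_pos[OF c nz[OF c c]] by blast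
  have one_minus: "1 - (\<Sum>k<N. W p k * cnj (W q k)) = kern (x p) c * kern c (x q) / (kern (x p) (x q) * r)"
    if "p < N" "q < N" for p q
    by (simp add: W[OF that, symmetric] base_gram_def r(1))
  have rank1: "(\<Sum>p<N. \<Sum>q<N. cnj (v p) * (kern (x p) c * kern c (x q) / r) * v q) \<in> \<real>\<^sub>\<ge>\<^sub>0" for v
  proof -
    define u where "u = (\<Sum>q<N. kern c (x q) * v q)"
    have "(\<Sum>p<N. \<Sum>q<N. cnj (v p) * (kern (x p) c * kern c (x q) / r) * v q)
        = (\<Sum>p<N. \<Sum>q<N. cnj (kern c (x p) * v p) * (kern c (x q) * v q)) / r"
      unfolding sum_divide_distrib
      by (intro sum.cong refl) (simp add: kern_commute[OF c x(2)] mult_ac)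
    also have "\<dots> = cnj u * u / r" by (simp add: u_def sum_product)
    also have "\<dots> = of_real ((cmod u)\<^sup>2 / r)"
      using cnj_mult_self_norm[of u] by (simp add: mult.commute)
    finally show ?thesis using r(2) by (simp only: nonneg_Reals_of_real_iff) simp
  qed
  let ?q = "\<lambda>v :: nat \<Rightarrow> nat \<Rightarrow> complex. \<Sum>p<N. \<Sum>q<N. \<Sum>i<1. \<Sum>j<1. cnj (v p i) *
      ((of_bool (i = j) - (\<Sum>k<N. W p k * cnj (W q k))) * kern (x p) (x q)) * v q j"
  have "\<exists>\<Phi>. contractive_multiplier a 1 N \<Phi> \<and> (\<forall>p<N. \<forall>i<1. \<forall>k<N. \<Phi> (x p) i k = W p k)"
  proof (rule pick[unfolded complete_Pick_def, THEN spec[of _ 1], THEN spec[of _ N], THEN spec[of _ N],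
        THEN spec[of _ x], THEN spec[of _ "\<lambda>p i k. W p k"], THEN mp])
    show "inj_on x {..<N} \<and> x ` {..<N} \<subseteq> ball 0 1 \<and>
      (\<forall>v . ?q v \<in> \<real>\<^sub>\<ge>\<^sub>0)"
    proof (intro conjI allI)
      fix v :: "nat \<Rightarrow> nat \<Rightarrow> complex"
      have "?q v
        = (\<Sum>p<N. \<Sum>q<N. cnj (v p 0) * (kern (x p) c * kern c (x q) / r) * v q 0)"
        using nz x(2) by (intro sum.cong refl) (simp add: one_minus)
      with rank1[of "\<lambda>p. v p 0"] show "?q v \<in> \<real>\<^sub>\<ge>\<^sub>0"
        by simp
    qed (use x in auto)
  qed
  then obtain \<Phi> where \<Phi>: "contractive_multiplier a 1 N \<Phi>" "\<And>p k. p < N \<Longrightarrow> k < N \<Longrightarrow> \<Phi> (x p) 0 k = W p k"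
    by auto
  let ?\<kappa> = "\<lambda>z. kernel_vec z (1::complex)"
  have ip: "cinner (?\<kappa> w) (?\<kappa> z) = kern z w" if "norm z < 1" "norm w < 1" for z w :: "complex ^ 'd"
    using cinner_kernel_vec_kernel_vec[OF that, of 1 "1::complex"] by (simp add: cinner_complex_def)
  define e where "e = ?\<kappa> y"
  have "e \<noteq> 0" using ip[OF y y] nz[OF y y] by (auto simp: e_def)
  define P where "P h = h - (cinner h e / cinner e e) *\<^sub>C e" for h
  note P = projection_off_vector[OF \<open>e \<noteq> 0\<close>, folded P_def]
  define \<eta> where "\<eta> p = P (?\<kappa> (x p))" for p
  have L: "cinner (\<eta> q) (\<eta> p) = kern (x p) (x q) - kern y (x q) * kern (x p) y / kern y y"
    if "p < N" "q < N" for p q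
    using that x y by (simp add: \<eta>_def P(4) e_def ip)
  let ?A = "\<lambda>v k. norm (\<Sum>p<N. (v p * cnj (W p k)) *\<^sub>C \<eta> p)" and ?B = "\<lambda>v. norm (\<Sum>p<N. v p *\<^sub>C \<eta> p)"
  have main: "(\<Sum>k<N. (?A v k)\<^sup>2) \<le> (?B v)\<^sup>2" for v
  proof -
    define x' where "x' p = (if p < N then x p else y)" for p
    define h where "h = (\<Sum>p<N. v p *\<^sub>C ?\<kappa> (x p))"
    \<comment> \<open>the weight of \<open>s(\<cdot>, y)\<close> makes the whole combination orthogonal to \<open>s(\<cdot>, y)\<close>\<close>
    define v' where "v' p = (if p < N then v p else - (cinner h e / cinner e e))" for p
    let ?X = "\<lambda>k. norm (\<Sum>p<Suc N. (v' p * cnj (\<Phi> (x' p) 0 k)) *\<^sub>C ?\<kappa> (x' p))"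
    have "(\<Sum>k<N. (?X k)\<^sup>2)
      \<le> (norm (\<Sum>p<Suc N. v' p *\<^sub>C ?\<kappa> (x' p)))\<^sup>2"
      by (rule contractive_multiplier_kernels[OF \<Phi>(1)]) (use x y in \<open>auto simp: x'_def\<close>)
    also have "(\<Sum>p<Suc N. v' p *\<^sub>C ?\<kappa> (x' p)) = P h"
      by (simp add: v'_def x'_def h_def P_def e_def scaleC.minus_left)
    also have "P h = (\<Sum>p<N. v p *\<^sub>C \<eta> p)"
      unfolding h_def \<eta>_def by (rule bounded_clinear_sum[OF P(1)])
    finally have le: "(\<Sum>k<N. (?X k)\<^sup>2)
      \<le> (?B v)\<^sup>2" .
    have "(?A v k)\<^sup>2
        \<le> (?X k)\<^sup>2" if "k < N" for k
    proof -
      have "(\<Sum>p<N. (v p * cnj (W p k)) *\<^sub>C \<eta> p) = (\<Sum>p<Suc N. (v' p * cnj (\<Phi> (x' p) 0 k)) *\<^sub>C P (?\<kappa> (x' p)))"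
        using \<Phi>(2)[OF _ that] P(2) by (simp add: x'_def v'_def \<eta>_def e_def)
      also have "\<dots> = P (\<Sum>p<Suc N. (v' p * cnj (\<Phi> (x' p) 0 k)) *\<^sub>C ?\<kappa> (x' p))"
        by (rule bounded_clinear_sum[OF P(1), symmetric])
      finally show ?thesis using P(3) by (simp add: power_mono)
    qed
    then show ?thesis using le by (meson lessThan_iff order_trans sum_mono)
  qed
  have expand: "of_real ((norm (\<Sum>p<N. f p *\<^sub>C \<eta> p))\<^sup>2) = (\<Sum>p<N. \<Sum>q<N. cnj (f p) * cinner (\<eta> q) (\<eta> p) * f q)" for f
    unfolding cinner_self[symmetric] cinner.sum_right cinner.sum_left cinner_scaleC_left cinner_scaleC_right
    by (intro sum.cong refl) (simp add: sum_distrib_left mult_ac)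
  show ?thesis unfolding psd_def
  proof
    fix u :: "nat \<Rightarrow> complex"
    \<comment> \<open>undoes the rank one factor; here the kernel must not vanish\<close>
    define v where "v q = u q / kern c (x q)" for q
    have vu: "kern c (x q) * v q = u q" if "q < N" for q using nz[OF c x(2)[OF that]] by (simp add: v_def)
    have vu': "cnj (v p) * kern (x p) c = cnj (u p)" if "p < N" for p
      using vu[OF that] kern_commute[OF c x(2)[OF that]] by (metis complex_cnj_mult mult.commute)
    have "of_real ((?B v)\<^sup>2 - (\<Sum>k<N. (?A v k)\<^sup>2))
      = (\<Sum>p<N. \<Sum>q<N. cnj (v p) * cinner (\<eta> q) (\<eta> p) * v q)
        - (\<Sum>k<N. \<Sum>p<N. \<Sum>q<N. cnj (v p * cnj (W p k)) * cinner (\<eta> q) (\<eta> p) * (v q * cnj (W q k)))"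
      unfolding of_real_diff of_real_sum expand ..
    also have "(\<Sum>k<N. \<Sum>p<N. \<Sum>q<N. cnj (v p * cnj (W p k)) * cinner (\<eta> q) (\<eta> p) * (v q * cnj (W q k)))
      = (\<Sum>p<N. \<Sum>q<N. cnj (v p) * cinner (\<eta> q) (\<eta> p) * v q * (\<Sum>k<N. W p k * cnj (W q k)))"
      by (subst sum.swap, rule sum.cong[OF refl], subst sum.swap, rule sum.cong[OF refl])
        (simp add: sum_distrib_left mult_ac)
    also have "(\<Sum>p<N. \<Sum>q<N. cnj (v p) * cinner (\<eta> q) (\<eta> p) * v q) - \<dots>
      = (\<Sum>p<N. \<Sum>q<N. cnj (v p) * cinner (\<eta> q) (\<eta> p) * v q * (1 - (\<Sum>k<N. W p k * cnj (W q k))))"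
      by (simp add: right_diff_distrib sum_subtractf)
    also have "\<dots> = (\<Sum>p<N. \<Sum>q<N. cnj (u p) * base_gram y (x p) (x q) * u q) / r"
      unfolding sum_divide_distrib
    proof (intro sum.cong refl)
      fix p q assume "p \<in> {..<N}" "q \<in> {..<N}"
      then have pq: "p < N" "q < N" by auto
      have "cnj (v p) * cinner (\<eta> q) (\<eta> p) * v q * (1 - (\<Sum>k<N. W p k * cnj (W q k)))
        = (cnj (v p) * kern (x p) c) * (cinner (\<eta> q) (\<eta> p) / kern (x p) (x q)) * (kern c (x q) * v q) / r"
        by (simp add: one_minus[OF pq])
      also have "cinner (\<eta> q) (\<eta> p) / kern (x p) (x q) = base_gram y (x p) (x q)"
        using nz[OF x(2) x(2), OF pq] by (simp add: L[OF pq] base_gram_def diff_divide_distrib mult_ac)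
      finally show "cnj (v p) * cinner (\<eta> q) (\<eta> p) * v q * (1 - (\<Sum>k<N. W p k * cnj (W q k)))
        = cnj (u p) * base_gram y (x p) (x q) * u q / r"
        by (simp add: vu[OF pq(2)] vu'[OF pq(1)])
    qed
    finally have "(\<Sum>p<N. \<Sum>q<N. cnj (u p) * base_gram y (x p) (x q) * u q)
      = of_real (r * ((?B v)\<^sup>2 - (\<Sum>k<N. (?A v k)\<^sup>2)))"
      using r(2) by (simp add: divide_simps mult.commute[of "complex_of_real r"])
    also have "\<dots> \<in> \<real>\<^sub>\<ge>\<^sub>0"
      using main[of v] r(2) by (simp only: nonneg_Reals_of_real_iff) simp
    finally show "(\<Sum>p<N. \<Sum>q<N. cnj (u p) * base_gram y (x p) (x q) * u q) \<in> \<real>\<^sub>\<ge>\<^sub>0" .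
  qed
qed

text \<open>
  Induction on the number of points: the matrix based at one of its own points has a zero row and a
  zero column, so \<open>N\<close> points at the base point \<open>x\<^sub>N\<close> count as \<open>N + 1\<close> points; the base point is then moved.
\<close>

lemma base_gram_psd:
  fixes x :: "nat \<Rightarrow> complex ^ 'd::finite"
  assumes pick: "complete_Pick (kern :: complex ^ 'd \<Rightarrow> _) a"
    and nz: "\<And>z w :: complex ^ 'd. norm z < 1 \<Longrightarrow> norm w < 1 \<Longrightarrow> kern z w \<noteq> 0"
    and x: "inj_on x {..<N}" "\<And>p. p < N \<Longrightarrow> norm (x p) < 1" and y: "norm y < 1"
  shows "psd N (\<lambda>p q. base_gram y (x p) (x q))"
  using x y
proof (induction N arbitrary: y)
  case 0
  then show ?case by (simp add: psd_def)
next
  case (Suc N)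
  let ?c = "x N"
  have c: "norm ?c < 1" using Suc.prems by simp
  have "psd N (\<lambda>p q. base_gram ?c (x p) (x q))"
    using Suc.prems c by (intro Suc.IH) (auto intro: inj_on_subset)
  moreover have "base_gram ?c ?c z = 0" "base_gram ?c z ?c = 0" if "norm z < 1" for z
    using nz[OF c c] nz[OF c that] nz[OF that c] by (simp_all add: base_gram_def)
  ultimately have "psd (Suc N) (\<lambda>p q. base_gram ?c (x p) (x q))"
    using Suc.prems by (simp add: psd_def)
  then show ?case using Suc.prems c by (intro base_gram_change[OF pick nz, of x "Suc N" ?c y]) auto
qed

end

section \<open>Nonnegativity of the reciprocal coefficients\<close>

lemma herm_axis: "herm (axis i u :: complex ^ 'd::finite) (axis i v) = u * cnj v"
proof -
  have "herm (axis i u :: complex ^ 'd) (axis i v) = (\<Sum>j\<in>UNIV. if j = i then u * cnj v else 0)"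
    unfolding herm_def by (intro sum.cong refl) (simp add: axis_def)
  then show ?thesis by simp
qed

lemma norm_axis_complex: "norm (axis i u :: complex ^ 'd::finite) = cmod u"
proof -
  have "(\<Sum>j\<in>UNIV. (cmod ((axis i u :: complex ^ 'd) $ j))\<^sup>2) = (\<Sum>j\<in>UNIV. if j = i then (cmod u)\<^sup>2 else 0)"
    by (intro sum.cong refl) (simp add: axis_def)
  then show ?thesis by (simp add: norm_vec_def L2_set_def)
qed

context invariant_weights
begin

lemma reciprocal_summable:
  obtains t where "0 < t" "t < 1" "summable (\<lambda>n. \<bar>reciprocal_coeff a n\<bar> * t ^ n)"
proof -
  let ?f = "Abs_fps a"
  have "fps_conv_radius ?f \<ge> norm (1/2 :: real)"
    unfolding fps_conv_radius_def using a_summable[of "1/2"] by (intro conv_radius_geI) simp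
  then have "fps_conv_radius ?f > 0" by (rule less_le_trans[rotated]) simp
  then have "fps_conv_radius (inverse ?f) > 0" by (intro fps_conv_radius_inverse_pos) (simp_all add: a_0)
  then have "fps_conv_radius (1 - inverse ?f) > 0"
    using fps_conv_radius_diff[of 1 "inverse ?f"] by (simp add: min_def split: if_splits)
  then have "0 < min 1 (fps_conv_radius (1 - inverse ?f))" by simp
  then obtain t :: real where t: "0 < ereal t" "ereal t < min 1 (fps_conv_radius (1 - inverse ?f))"
    using ereal_dense2 by blast
  then have "summable (\<lambda>n. norm (fps_nth (1 - inverse ?f) n * t ^ n))"
    by (intro norm_summable_fps) simp
  then have "summable (\<lambda>n. \<bar>reciprocal_coeff a n\<bar> * t ^ n)"
    using t by (simp add: abs_mult reciprocal_coeff_def power_abs)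
  moreover have "0 < t" "t < 1" using t by simp_all
  ultimately show ?thesis using that by blast
qed

lemma reciprocal_sums:
  fixes t :: complex
  assumes "cmod t \<le> r" "r < 1" "summable (\<lambda>n. \<bar>reciprocal_coeff a n\<bar> * r ^ n)"
    and nz: "(\<Sum>n. of_real (a n) * t ^ n) \<noteq> 0"
  shows "(\<lambda>n. of_real (reciprocal_coeff a n) * t ^ n) sums (1 - 1 / (\<Sum>n. of_real (a n) * t ^ n))"
proof -
  let ?b = "\<lambda>n. of_real (reciprocal_coeff a n) * t ^ n" and ?a = "\<lambda>n. complex_of_real (a n) * t ^ n"
  have sb: "summable (\<lambda>n. norm (?b n))"
    by (rule summable_comparison_test'[OF assms(3), of 0])
      (use assms(1) in \<open>simp add: norm_mult norm_power mult_left_mono power_mono\<close>)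
  have "0 \<le> r" using assms(1) norm_ge_zero order_trans by blast
  from a_summable[OF this assms(2)] have sa: "summable (\<lambda>n. norm (?a n))"
    by (rule summable_comparison_test'[of _ 0])
      (use assms(1) in \<open>simp add: norm_mult norm_power mult_left_mono power_mono less_imp_le[OF a_pos]\<close>)
  have "(\<lambda>k. \<Sum>i\<le>k. ?b i * ?a (k - i)) sums ((\<Sum>k. ?b k) * (\<Sum>k. ?a k))"
    by (rule Cauchy_product_sums[OF sb sa])
  moreover have "(\<Sum>i\<le>k. ?b i * ?a (k - i)) = (if k = 0 then 0 else ?a k)" for k
  proof -
    have "(\<Sum>i\<le>k. ?b i * ?a (k - i)) = (\<Sum>i\<le>k. of_real (reciprocal_coeff a i * a (k - i)) * t ^ k)"
      by (intro sum.cong refl) (simp add: power_add[symmetric])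
    also have "\<dots> = of_real (\<Sum>i\<le>k. reciprocal_coeff a i * a (k - i)) * t ^ k"
      by (simp add: sum_distrib_right)
    finally show ?thesis by (simp add: reciprocal_coeff_conv[where a = a, OF a_0])
  qed
  ultimately have 1: "(\<lambda>k. if k = 0 then 0 else ?a k) sums ((\<Sum>k. ?b k) * (\<Sum>k. ?a k))" by simp
  have 2: "(\<lambda>k. ?a k - (if k = 0 then 1 else 0)) sums ((\<Sum>k. ?a k) - 1)"
    using sums_single[of 0 "\<lambda>_. 1 :: complex"] summable_sums[OF summable_norm_cancel[OF sa]]
    by (intro sums_diff) (simp_all add: eq_commute)
  have "(\<lambda>k. ?a k - (if k = 0 then 1 else 0)) = (\<lambda>k. if k = 0 then 0 else ?a k)"
    by (auto simp: a_0)
  then have "(\<Sum>k. ?b k) * (\<Sum>k. ?a k) = (\<Sum>k. ?a k) - 1"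
    using sums_unique2[OF 1] 2 by simp
  then have "(\<Sum>k. ?b k) = 1 - 1 / (\<Sum>k. ?a k)" using nz by (simp add: field_simps)
  then show ?thesis using summable_sums[OF summable_norm_cancel[OF sb]] by simp
qed

lemma kern_zero: "kern z 0 = 1" "kern 0 z = 1"
proof -
  have "(\<lambda>n. complex_of_real (a n) * 0 ^ n) sums (of_real (a 0))" by (rule powser_sums_zero)
  then have "(\<Sum>n. complex_of_real (a n) * 0 ^ n) = 1" using sums_unique by (fastforce simp: a_0)
  then show "kern z 0 = 1" "kern 0 z = 1" by (simp_all add: kern_def herm_def)
qed

text \<open>
  With the origin as base point the positive matrix is \<open>1 - 1/s = \<Sum>\<^sub>k b\<^sub>k \<langle>x\<^sub>p, x\<^sub>q\<rangle>\<^sup>k\<close>. On the points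
  \<open>x\<^sub>p = \<surd>t \<omega>\<^sup>p\<close> of a coordinate axis, with \<open>\<omega>\<close> an \<open>N\<close>-th root of unity, the vector \<open>(\<omega>\<^bsup>p n\<^esup>)\<^sub>p\<close> tests it to
  \<open>N\<^sup>2 \<Sum> b\<^sub>k t\<^sup>k\<close> over \<open>k \<equiv> n\<close> modulo \<open>N\<close>. For large \<open>N\<close> the term \<open>k = n\<close> decides the sign.
\<close>

lemma reciprocal_coeff_nonneg:
  assumes pick: "complete_Pick (kern :: complex ^ 'd::finite \<Rightarrow> _) a"
    and nz: "\<And>z w :: complex ^ 'd. norm z < 1 \<Longrightarrow> norm w < 1 \<Longrightarrow> kern z w \<noteq> 0"
  shows "reciprocal_coeff a n \<ge> 0"
proof (rule ccontr)
  assume "\<not> reciprocal_coeff a n \<ge> 0"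
  then have neg: "reciprocal_coeff a n < 0" by simp
  let ?b = "reciprocal_coeff a"
  obtain t where t: "0 < t" "t < 1" "summable (\<lambda>n. \<bar>?b n\<bar> * t ^ n)" by (rule reciprocal_summable)
  let ?u = "\<lambda>k. \<bar>?b k\<bar> * t ^ k"
  have upos: "?u n > 0" using neg t(1) by (intro mult_pos_pos) simp_all
  obtain N0 where N0: "\<And>N. N \<ge> N0 \<Longrightarrow> norm (\<Sum>i. ?u (i + N)) < ?u n"
    using suminf_exist_split[OF upos t(3)] by blast
  define N where "N = max N0 (Suc n)"
  have N: "n < N" "N > 0" "(\<Sum>i. ?u (i + N)) < ?u n" using N0[of N] by (auto simp: N_def)
  define i0 :: 'd where "i0 = undefined"
  define \<omega> where "\<omega> = root_of_unity N"
  define x :: "nat \<Rightarrow> complex ^ 'd" where "x p = axis i0 (of_real (sqrt t) * \<omega> ^ p)" for p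
  have nx: "norm (x p) < 1" for p
    using t by (simp add: x_def norm_axis_complex norm_mult norm_power \<omega>_def norm_root_of_unity)
  have inj: "inj_on x {..<N}"
  proof (rule inj_onI)
    fix p q assume pq: "p \<in> {..<N}" "q \<in> {..<N}" and "x p = x q"
    then have "x p $ i0 = x q $ i0" by simp
    then have "\<omega> ^ p = \<omega> ^ q" using t by (simp add: x_def axis_def)
    with pq show "p = q" using root_of_unity_power_inj[of p N q] by (simp add: \<omega>_def)
  qed
  let ?Q = "\<Sum>p<N. \<Sum>q<N. cnj (\<omega> ^ (p * n)) * base_gram 0 (x p) (x q) * \<omega> ^ (q * n)"
  let ?T = "\<lambda>k. \<Sum>p<N. \<Sum>q<N. cnj (\<omega> ^ (p * n)) * (of_real (?b k * t ^ k) * (\<omega> ^ (p * k) * cnj (\<omega> ^ (q * k)))) * \<omega> ^ (q * n)"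
  have "psd N (\<lambda>p q. base_gram 0 (x p) (x q))"
    by (rule base_gram_psd[OF pick nz inj nx]) simp_all
  then have pos: "?Q \<in> \<real>\<^sub>\<ge>\<^sub>0"
    unfolding psd_def by (rule spec[of _ "\<lambda>p. \<omega> ^ (p * n)"])
  have base: "(\<lambda>k. of_real (?b k * t ^ k) * (\<omega> ^ (p * k) * cnj (\<omega> ^ (q * k)))) sums base_gram 0 (x p) (x q)" for p q
  proof -
    let ?s = "of_real t * (\<omega> ^ p * cnj (\<omega> ^ q))"
    have "herm (x p) (x q) = ?s"
      using t by (simp add: x_def herm_axis flip: of_real_mult)
    then have kern: "kern (x p) (x q) = (\<Sum>k. of_real (a k) * ?s ^ k)" by (simp add: kern_def)
    have "(\<lambda>k. of_real (?b k) * ?s ^ k) sums (1 - 1 / kern (x p) (x q))"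
      unfolding kern
    proof (rule reciprocal_sums[OF _ t(2,3)])
      show "cmod ?s \<le> t" using t by (simp add: norm_mult norm_power \<omega>_def norm_root_of_unity)
      show "(\<Sum>k. of_real (a k) * ?s ^ k) \<noteq> 0" using nz[OF nx nx, of p q] by (simp add: kern)
    qed
    moreover have "of_real (?b k) * ?s ^ k = of_real (?b k * t ^ k) * (\<omega> ^ (p * k) * cnj (\<omega> ^ (q * k)))" for k
      by (simp add: power_mult_distrib flip: power_mult)
    moreover have "1 - 1 / kern (x p) (x q) = base_gram 0 (x p) (x q)"
      by (simp add: base_gram_def kern_zero)
    ultimately show ?thesis by (simp only:)
  qed
  let ?m = "\<lambda>k. (cmod (root_pairing N n k))\<^sup>2"
  have "?T
      sums ?Q"
    by (intro sums_sum sums_mult sums_mult2 base)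
  moreover have "?T k
      = of_real (?b k * t ^ k * ?m k)" for k
  proof -
    have "?T k
      = of_real (?b k * t ^ k) * (root_pairing N n k * cnj (root_pairing N n k))"
    proof -
      have "root_pairing N n k * cnj (root_pairing N n k) = (\<Sum>p<N. \<Sum>q<N.
          cnj (\<omega> ^ (p * n)) * \<omega> ^ (p * k) * cnj (cnj (\<omega> ^ (q * n)) * \<omega> ^ (q * k)))"
        by (simp only: root_pairing_def cnj_sum sum_product \<omega>_def)
      then show ?thesis
        by (simp only: sum_distrib_left) (intro sum.cong refl, simp add: mult_ac)
    qed
    then show ?thesis by (simp add: cnj_mult_self_norm)
  qed
  ultimately have "(\<lambda>k. complex_of_real (?b k * t ^ k * ?m k))
      sums ?Q" by simp
  then have "(\<lambda>k. Re (complex_of_real (?b k * t ^ k * ?m k)))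
      sums Re ?Q" by (rule sums_Re)
  then obtain S where S: "(\<lambda>k. ?b k * t ^ k * ?m k) sums S" "S \<ge> 0"
    using pos by (auto simp: complex_nonneg_Reals_iff)
  have m: "?m k \<le> (real N)\<^sup>2" for k by (intro power_mono norm_root_pairing_le) simp
  have init: "(\<Sum>k<N. ?b k * t ^ k * ?m k) = ?b n * t ^ n * (real N)\<^sup>2"
  proof -
    have "(\<Sum>k<N. ?b k * t ^ k * ?m k) = (\<Sum>k<N. if k = n then ?b n * t ^ n * (real N)\<^sup>2 else 0)"
      using N(1) by (intro sum.cong refl) (auto simp: root_pairing_self root_pairing_distinct)
    then show ?thesis using N(1) by simp
  qed
  have sum_tail: "summable (\<lambda>i. ?u (i + N))" using t(3) by (rule summable_ignore_initial_segment)
  have "S = (\<Sum>i. ?b (i + N) * t ^ (i + N) * ?m (i + N)) + (\<Sum>k<N. ?b k * t ^ k * ?m k)"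
    using suminf_split_initial_segment[OF sums_summable[OF S(1)], of N] sums_unique[OF S(1)] by simp
  moreover have "(\<Sum>i. ?b (i + N) * t ^ (i + N) * ?m (i + N)) \<le> (\<Sum>i. ?u (i + N) * (real N)\<^sup>2)"
  proof (rule suminf_le)
    show "?b (i + N) * t ^ (i + N) * ?m (i + N) \<le> ?u (i + N) * (real N)\<^sup>2" for i
      using t(1) by (intro mult_mono m mult_right_mono) auto
    show "summable (\<lambda>i. ?b (i + N) * t ^ (i + N) * ?m (i + N))"
      using summable_ignore_initial_segment[OF sums_summable[OF S(1)], of N] .
    show "summable (\<lambda>i. ?u (i + N) * (real N)\<^sup>2)" by (intro summable_mult2 sum_tail)
  qed
  moreover have "(\<Sum>i. ?u (i + N) * (real N)\<^sup>2) = (\<Sum>i. ?u (i + N)) * (real N)\<^sup>2"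
    by (rule suminf_mult2[OF sum_tail, symmetric])
  moreover have "(\<Sum>i. ?u (i + N)) * (real N)\<^sup>2 < ?u n * (real N)\<^sup>2"
    using N by (intro mult_strict_right_mono) auto
  moreover have "?u n = - (?b n * t ^ n)" using neg by simp
  ultimately have "S < 0" using init by simp
  with S(2) show False by simp
qed

end

lemma unitarily_invariant_CNP_kernel_weights:
  fixes s :: "complex ^ 'd::finite \<Rightarrow> complex ^ 'd \<Rightarrow> complex"
  assumes "unitarily_invariant_CNP_kernel s a"
  shows "invariant_weights a" "reciprocal_coeff a n \<ge> 0"
proof -
  note s = assms[unfolded unitarily_invariant_CNP_kernel_def]
  show w: "invariant_weights a"
  proof
    fix r :: real assume r: "0 \<le> r" "r < 1"
    define z :: "complex ^ 'd" where "z = axis undefined (of_real (sqrt r))"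
    have "z \<in> ball 0 1" using r by (simp add: z_def norm_axis_complex)
    moreover have "herm z z = of_real r" using r by (simp add: z_def herm_axis flip: of_real_mult)
    ultimately have "summable (\<lambda>n. complex_of_real (a n) * of_real r ^ n)"
      using s by (metis sums_summable)
    then have "summable (\<lambda>n. complex_of_real (a n * r ^ n))" by simp
    then show "summable (\<lambda>n. a n * r ^ n)" by (simp only: summable_of_real_iff)
  qed (use s in auto)
  interpret invariant_weights a by (rule w)
  have eq: "s z w = kern z w" if "norm z < 1" "norm w < 1" for z w
    using s that unfolding kern_def by (simp add: sums_unique)
  have "complete_Pick (kern :: complex ^ 'd \<Rightarrow> _) a"
    unfolding complete_Pick_def
  proof (intro allI impI)
    fix m n N and x :: "nat \<Rightarrow> complex ^ 'd" and W :: "nat \<Rightarrow> nat \<Rightarrow> nat \<Rightarrow> complex"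
    let ?q = "\<lambda>k v. \<Sum>p<N. \<Sum>q<N. \<Sum>i<m. \<Sum>j<m. cnj (v p i) *
        ((of_bool (i = j) - (\<Sum>l<n. W p i l * cnj (W q j l))) * k (x p) (x q)) * v q j"
    assume asm: "inj_on x {..<N} \<and> x ` {..<N} \<subseteq> ball 0 1 \<and>
      (\<forall>v :: nat \<Rightarrow> nat \<Rightarrow> complex. ?q kern v \<in> \<real>\<^sub>\<ge>\<^sub>0)"
    have "kern (x p) (x q) = s (x p) (x q)" if "p \<in> {..<N}" "q \<in> {..<N}" for p q
      using asm that by (intro eq[symmetric]) auto
    then have "?q kern v
        = ?q s v" for v
      by (intro sum.cong refl) simp
    note eq_sum = this
    have "complete_Pick s a" using s by simp
    then show "\<exists>\<Phi>. contractive_multiplier a m n \<Phi> \<and> (\<forall>p<N. \<forall>i<m. \<forall>k<n. \<Phi> (x p) i k = W p i k)"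
      unfolding complete_Pick_def
    proof (elim allE impE)
      show "inj_on x {..<N} \<and> x ` {..<N} \<subseteq> ball 0 1 \<and>
        (\<forall>v :: nat \<Rightarrow> nat \<Rightarrow> complex. ?q s v \<in> \<real>\<^sub>\<ge>\<^sub>0)"
        using asm unfolding eq_sum .
    qed
  qed
  then show "reciprocal_coeff a n \<ge> 0"
  proof (rule reciprocal_coeff_nonneg)
    show "kern z w \<noteq> 0" if "norm z < 1" "norm w < 1" for z w :: "complex ^ 'd"
      using s that unfolding irreducible_kernel_def eq[OF that, symmetric] by simp
  qed
qed

section \<open>Backward shifts\<close>

lemma monomial_add: "monomial z (\<alpha> + \<beta>) = monomial z \<alpha> * monomial z \<beta>"
  by (simp add: monomial_def power_add prod.distrib)

locale nonneg_reciprocal = invariant_weights +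
  assumes reciprocal_nonneg: "reciprocal_coeff a n \<ge> 0"
begin

lemma multi_coeff_nonzero [simp]: "wt \<alpha> \<noteq> 0"
  using multi_coeff_pos[of \<alpha>] by simp

text \<open>
  Boundedness of the shifts: \<open>b\<^sub>1 a\<^sub>n \<le> a\<^bsub>n + 1\<^esub>\<close>, and \<open>b\<^sub>1 = a\<^sub>1 > 0\<close>.
\<close>

lemma multi_coeff_shift_bound:
  fixes \<gamma> :: "'d::finite multi_index"
  shows "\<exists>K. \<forall>\<alpha>. wt \<alpha> \<le> K * wt (\<alpha> + \<gamma>)"
proof (induction "total_degree \<gamma>" arbitrary: \<gamma>)
  case 0
  then have "\<gamma> = 0" by (simp add: total_degree_0_iff)
  then show ?case by (intro exI[of _ 1]) simp
next
  case (Suc n)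
  then have "\<gamma> \<noteq> 0" by auto
  then obtain i where "\<gamma> i > 0" by (auto simp: fun_eq_iff)
  from index_decompose[of \<gamma>, OF this] obtain \<delta> where \<delta>: "\<gamma> = \<delta> + unit_index i" by (rule exE)
  then have "n = total_degree \<delta>" using Suc.hyps(2) by (simp add: total_degree_add total_degree_unit)
  then obtain K where K: "\<And>\<alpha>. wt \<alpha> \<le> K * wt (\<alpha> + \<delta>)" using Suc.hyps(1) by blast
  have "0 < K * wt \<delta>" using K[of 0] a_pos[of 0] by simp
  then have "K > 0" using multi_coeff_pos[of \<delta>] by (simp add: zero_less_mult_iff)
  have "reciprocal_coeff a 1 = a 1"
    using reciprocal_coeff_conv[where a = a, OF a_0, of 1] reciprocal_coeff_0[of a, OF a_0] by (simp add: a_0)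
  then have step: "a 1 * a m \<le> a (Suc m)" for m
    using reciprocal_coeff_mult_le[of a 1 m, OF a_0 a_pos reciprocal_nonneg] by simp
  have "wt \<beta> \<le> (1 / a 1) * wt (\<beta> + unit_index i)" for \<beta>
  proof -
    have "a 1 * a (total_degree \<beta>) * multinomial \<beta> \<le> a (Suc (total_degree \<beta>)) * multinomial (\<beta> + unit_index i)"
      by (intro mult_mono step multinomial_le_unit_step less_imp_le[OF a_pos] less_imp_le[OF multinomial_pos])
    then show ?thesis using a_pos[of 1]
      by (simp add: multi_coeff_eq total_degree_add total_degree_unit field_simps)
  qed
  note unit = this
  have "wt \<alpha> \<le> K * ((1 / a 1) * wt (\<alpha> + \<delta> + unit_index i))" for \<alpha>
  proof -
    have "K * wt (\<alpha> + \<delta>) \<le> K * ((1 / a 1) * wt (\<alpha> + \<delta> + unit_index i))"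
      using \<open>K > 0\<close> by (intro mult_left_mono unit) simp
    with K[of \<alpha>] show ?thesis by linarith
  qed
  then show ?case unfolding \<delta> by (intro exI[of _ "K * (1 / a 1)"]) (simp add: add.assoc mult.assoc)
qed

text \<open>
  The adjoint of multiplication by \<open>z\<^sup>\<gamma>\<close> on \<open>H\<^sub>s \<otimes> E\<close>, in orthonormal coordinates.
\<close>

definition back_shift :: "'d::finite multi_index \<Rightarrow> ('d multi_index, 'h::chilbert_space) ell2 \<Rightarrow> ('d multi_index, 'h) ell2"
  where "back_shift \<gamma> = column_op (\<lambda>\<alpha> x. sqrt (wt \<alpha> / wt (\<alpha> + \<gamma>)) *\<^sub>R ell2_nth x (\<alpha> + \<gamma>))"

lemma norm_shift_term:
  "(norm (sqrt (wt \<alpha> / wt (\<alpha> + \<gamma>)) *\<^sub>R h))\<^sup>2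
    = wt \<alpha> / wt (\<alpha> + \<gamma>) * (norm h)\<^sup>2"
  using multi_coeff_pos[of \<alpha>] multi_coeff_pos[of "\<alpha> + \<gamma>"] by (simp add: power_mult_distrib)

lemma back_shift_props:
  fixes x :: "('d::finite multi_index, 'h::chilbert_space) ell2"
  shows ell2_nth_back_shift:
      "ell2_nth (back_shift \<gamma> x) \<alpha> = sqrt (wt \<alpha> / wt (\<alpha> + \<gamma>)) *\<^sub>R ell2_nth x (\<alpha> + \<gamma>)"
    and bounded_clinear_back_shift:
      "bounded_clinear (back_shift \<gamma> :: ('d multi_index, 'h) ell2 \<Rightarrow> _)"
proof -
  obtain K where K: "\<And>\<alpha>. wt \<alpha> \<le> K * wt (\<alpha> + \<gamma>)"
    using multi_coeff_shift_bound by blast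
  let ?r = "\<lambda>\<alpha>. wt \<alpha> / wt (\<alpha> + \<gamma>)"
  have r: "?r \<alpha> \<le> K" for \<alpha>
    using K[of \<alpha>] multi_coeff_pos[of "\<alpha> + \<gamma>"] by (simp add: pos_divide_le_eq)
  have "0 < ?r 0" by (intro divide_pos_pos multi_coeff_pos)
  with r[of 0] have K0: "K > 0" by simp
  have lin: "bounded_clinear (\<lambda>x :: ('d multi_index, 'h) ell2. sqrt (?r \<alpha>) *\<^sub>R ell2_nth x (\<alpha> + \<gamma>))" for \<alpha>
    by (rule bounded_clinear_scaleR[OF bounded_clinear_ell2_nth])
  have bound: "(\<Sum>\<alpha>\<in>F. (norm (sqrt (?r \<alpha>) *\<^sub>R ell2_nth x (\<alpha> + \<gamma>)))\<^sup>2) \<le> (sqrt K * norm x)\<^sup>2"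
    if F: "finite F" for F and x :: "('d multi_index, 'h) ell2"
  proof -
    have "(\<Sum>\<alpha>\<in>F. (norm (sqrt (?r \<alpha>) *\<^sub>R ell2_nth x (\<alpha> + \<gamma>)))\<^sup>2) \<le> (\<Sum>\<alpha>\<in>F. K * (norm (ell2_nth x (\<alpha> + \<gamma>)))\<^sup>2)"
      unfolding norm_shift_term by (intro sum_mono mult_right_mono r) simp
    also have "\<dots> = K * (\<Sum>\<beta>\<in>(\<lambda>\<alpha>. \<alpha> + \<gamma>) ` F. (norm (ell2_nth x \<beta>))\<^sup>2)"
      by (subst sum.reindex) (auto simp: inj_on_def sum_distrib_left)
    also have "\<dots> \<le> K * (norm x)\<^sup>2"
      using K0 F by (intro mult_left_mono ell2_sum_le) auto
    finally show ?thesis using K0 by (simp add: power_mult_distrib)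
  qed
  note col = column_op[of "\<lambda>\<alpha> x. sqrt (?r \<alpha>) *\<^sub>R ell2_nth x (\<alpha> + \<gamma>)", OF lin _ bound, folded back_shift_def]
  show "ell2_nth (back_shift \<gamma> x) \<alpha> = sqrt (?r \<alpha>) *\<^sub>R ell2_nth x (\<alpha> + \<gamma>)"
    and "bounded_clinear (back_shift \<gamma> :: ('d multi_index, 'h) ell2 \<Rightarrow> _)"
    using K0 col by simp_all
qed

lemma back_shift_back_shift: "back_shift \<gamma> (back_shift \<delta> x) = back_shift (\<gamma> + \<delta>) x"
proof (rule ell2_eqI)
  fix \<alpha>
  have "sqrt (wt \<alpha> / wt (\<alpha> + \<gamma>)) * sqrt (wt (\<alpha> + \<gamma>) / wt (\<alpha> + \<gamma> + \<delta>))
      = sqrt (wt \<alpha> / wt (\<alpha> + \<gamma> + \<delta>))"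
    using multi_coeff_pos[of "\<alpha> + \<gamma>"] by (simp add: real_sqrt_mult[symmetric])
  then show "ell2_nth (back_shift \<gamma> (back_shift \<delta> x)) \<alpha> = ell2_nth (back_shift (\<gamma> + \<delta>) x) \<alpha>"
    by (simp add: ell2_nth_back_shift add.assoc)
qed

lemma back_shift_zero: "back_shift 0 x = x"
  by (rule ell2_eqI) (simp add: ell2_nth_back_shift)

lemma back_shift_kernel_vec:
  assumes "norm z < 1"
  shows "back_shift \<gamma> (kernel_vec z u) = cnj (monomial z \<gamma>) *\<^sub>C kernel_vec z u"
proof (rule ell2_eqI)
  fix \<alpha>
  have "sqrt (wt \<alpha> / wt (\<alpha> + \<gamma>)) * sqrt (wt (\<alpha> + \<gamma>)) = sqrt (wt \<alpha>)"
    using multi_coeff_pos[of "\<alpha> + \<gamma>"] by (simp add: real_sqrt_mult[symmetric])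
  then have "complex_of_real (sqrt (wt \<alpha> / wt (\<alpha> + \<gamma>))) * complex_of_real (sqrt (wt (\<alpha> + \<gamma>)))
      = complex_of_real (sqrt (wt \<alpha>))" by (metis of_real_mult)
  then show "ell2_nth (back_shift \<gamma> (kernel_vec z u)) \<alpha> = ell2_nth (cnj (monomial z \<gamma>) *\<^sub>C kernel_vec z u) \<alpha>"
    by (simp add: ell2_nth_back_shift ell2_nth_kernel_vec[OF assms] scaleC_ell2.rep_eq monomial_add
        scaleR_scaleC scaleC_scaleC mult.assoc[symmetric]) (simp add: mult_ac)
qed

lemma back_shift_eq_0:
  assumes "\<And>\<beta>. total_degree \<beta> > N \<Longrightarrow> ell2_nth x \<beta> = 0" "total_degree \<alpha> > N"
  shows "back_shift \<alpha> x = 0"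
  by (rule ell2_eqI) (use assms in \<open>simp add: ell2_nth_back_shift zero_ell2.rep_eq total_degree_add\<close>)

text \<open>
  This says \<open>\<Sum>\<^sub>\<gamma> b\<^sub>\<gamma> M\<^sup>\<gamma> (M\<^sup>\<gamma>)\<^sup>* \<le> I\<close>, that is, the coordinate multiplications form a \<open>1/s\<close>-contraction.
  It rests on \<open>b\<^sub>n \<ge> 0\<close>.
\<close>

lemma back_shift_contraction:
  fixes x :: "('d::finite multi_index, 'h::chilbert_space) ell2"
  assumes "finite F"
  shows "(\<Sum>\<gamma>\<in>F. multi_coeff (reciprocal_coeff a) \<gamma> * (norm (back_shift \<gamma> x))\<^sup>2) \<le> (norm x)\<^sup>2"
proof -
  let ?b = "multi_coeff (reciprocal_coeff a)"
  have b: "?b \<gamma> \<ge> 0" for \<gamma> :: "'d multi_index"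
    by (simp add: multi_coeff_eq reciprocal_nonneg less_imp_le[OF multinomial_pos])
  define \<phi> where "\<phi> \<beta> = (norm (ell2_nth x \<beta>))\<^sup>2 / wt \<beta>" for \<beta>
  have \<phi>: "\<phi> \<beta> \<ge> 0" for \<beta> using multi_coeff_pos[of \<beta>] by (simp add: \<phi>_def less_imp_le)
  define M where "M = Max (total_degree ` F)"
  have F: "F \<subseteq> {\<gamma>. total_degree \<gamma> \<le> M}" using assms by (auto simp: M_def)
  have lim: "(\<lambda>N. \<Sum>n\<le>N. a n * degree_sum n (\<lambda>\<alpha>. \<phi> (\<gamma> + \<alpha>))) \<longlonglongrightarrow> (norm (back_shift \<gamma> x))\<^sup>2" for \<gamma>
  proof -
    have "(norm (ell2_nth (back_shift \<gamma> x) \<alpha>))\<^sup>2 = wt \<alpha> *\<^sub>R \<phi> (\<gamma> + \<alpha>)" for \<alpha>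
      unfolding ell2_nth_back_shift norm_shift_term by (simp add: \<phi>_def add.commute)
    then have "((\<lambda>\<alpha>. wt \<alpha> *\<^sub>R \<phi> (\<gamma> + \<alpha>)) has_sum (norm (back_shift \<gamma> x))\<^sup>2) UNIV"
      using ell2_norm_has_sum[of "back_shift \<gamma> x"] by simp
    from has_sum_total_degree[OF this] show ?thesis
      unfolding sums_def_le degree_sum_multi_coeff by simp
  qed
  \<comment> \<open>the degrees of the inner sums are cut off at \<open>N\<close>, and \<open>N\<close> tends to infinity\<close>
  have "(\<Sum>\<gamma> | total_degree \<gamma> \<le> M. ?b \<gamma> * (norm (back_shift \<gamma> x))\<^sup>2) \<le> (norm x)\<^sup>2"
  proof (rule LIMSEQ_le_const2)
    show "(\<lambda>N. \<Sum>\<gamma> | total_degree \<gamma> \<le> M. ?b \<gamma> * (\<Sum>n\<le>N. a n * degree_sum n (\<lambda>\<alpha>. \<phi> (\<gamma> + \<alpha>))))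
      \<longlonglongrightarrow> (\<Sum>\<gamma> | total_degree \<gamma> \<le> M. ?b \<gamma> * (norm (back_shift \<gamma> x))\<^sup>2)"
      by (intro tendsto_intros lim)
    have "(\<Sum>\<gamma> | total_degree \<gamma> \<le> M. ?b \<gamma> * (\<Sum>n\<le>N. a n * degree_sum n (\<lambda>\<alpha>. \<phi> (\<gamma> + \<alpha>)))) \<le> (norm x)\<^sup>2" for N
    proof -
      have "(\<Sum>\<gamma> | total_degree \<gamma> \<le> M. ?b \<gamma> * (\<Sum>n\<le>N. a n * degree_sum n (\<lambda>\<alpha>. \<phi> (\<gamma> + \<alpha>))))
        = (\<Sum>m\<le>M. reciprocal_coeff a m * degree_sum m (\<lambda>\<gamma>. \<Sum>n\<le>N. a n * degree_sum n (\<lambda>\<alpha>. \<phi> (\<gamma> + \<alpha>))))"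
        using sum_multi_coeff_le[where a = "reciprocal_coeff a" and N = M
            and f = "\<lambda>\<gamma>. \<Sum>n\<le>N. a n * degree_sum n (\<lambda>\<alpha>. \<phi> (\<gamma> + \<alpha>))"] by simp
      also have "\<dots> \<le> (\<Sum>k\<le>M + N. a k * degree_sum k \<phi>)"
        by (rule reciprocal_coeff_contraction[OF a_0 a_pos reciprocal_nonneg \<phi>])
      also have "\<dots> = (\<Sum>\<beta> | total_degree \<beta> \<le> M + N. wt \<beta> *\<^sub>R \<phi> \<beta>)"
        using sum_multi_coeff_le[where a = a and N = "M + N" and f = \<phi>] by simp
      also have "\<dots> = (\<Sum>\<beta> | total_degree \<beta> \<le> M + N. (norm (ell2_nth x \<beta>))\<^sup>2)"
        by (intro sum.cong refl) (simp add: \<phi>_def)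
      also have "\<dots> \<le> (norm x)\<^sup>2" by (rule ell2_sum_le[OF finite_total_degree_le])
      finally show ?thesis .
    qed
    then show "\<exists>N. \<forall>n\<ge>N. (\<Sum>\<gamma> | total_degree \<gamma> \<le> M. ?b \<gamma> * (\<Sum>n\<le>n. a n * degree_sum n (\<lambda>\<alpha>. \<phi> (\<gamma> + \<alpha>)))) \<le> (norm x)\<^sup>2"
      by blast
  qed
  moreover have "(\<Sum>\<gamma>\<in>F. ?b \<gamma> * (norm (back_shift \<gamma> x))\<^sup>2) \<le> (\<Sum>\<gamma> | total_degree \<gamma> \<le> M. ?b \<gamma> * (norm (back_shift \<gamma> x))\<^sup>2)"
    using F b by (intro sum_mono2 finite_total_degree_le) auto
  ultimately show ?thesis by linarith
qed

end

section \<open>Powers of a commuting tuple\<close>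

lemma funpow_comp_commute:
  assumes "f \<circ> g = g \<circ> f"
  shows "(f ^^ m) \<circ> (g ^^ n) = (g ^^ n) \<circ> (f ^^ m)"
proof -
  have 0: "f (g x) = g (f x)" for x using fun_cong[OF assms, of x] by simp
  have 1: "f ((g ^^ n) x) = (g ^^ n) (f x)" for n x by (induction n) (simp_all add: 0)
  have "(f ^^ m) ((g ^^ n) x) = (g ^^ n) ((f ^^ m) x)" for x by (induction m) (simp_all add: 1)
  then show ?thesis by (simp add: fun_eq_iff)
qed

text \<open>
  Induction over the set of coordinates; commutativity moves a new factor past the powers that are
  already collected.
\<close>

lemma op_power_facts:
  fixes T :: "'d::finite \<Rightarrow> 'h::chilbert_space \<Rightarrow> 'h"
  assumes comm: "\<And>i j. T i \<circ> T j = T j \<circ> T i" and lin: "\<And>i. bounded_clinear (T i)"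
  shows "op_power T (\<alpha> + \<beta>) = op_power T \<alpha> \<circ> op_power T \<beta>" "bounded_clinear (op_power T \<alpha>)"
proof -
  define f where "f \<alpha> i S = (T i ^^ \<alpha> i) \<circ> S" for \<alpha> :: "'d multi_index" and i and S :: "'h \<Rightarrow> 'h"
  have cfc: "comp_fun_commute (f \<alpha>)" for \<alpha>
  proof
    show "f \<alpha> i \<circ> f \<alpha> j = f \<alpha> j \<circ> f \<alpha> i" for i j
    proof
      fix S
      have "(f \<alpha> i \<circ> f \<alpha> j) S = ((T i ^^ \<alpha> i) \<circ> (T j ^^ \<alpha> j)) \<circ> S" by (simp add: f_def comp_assoc)
      also have "\<dots> = (f \<alpha> j \<circ> f \<alpha> i) S"
        by (simp only: funpow_comp_commute[OF comm[of i j]]) (simp add: f_def comp_assoc)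
      finally show "(f \<alpha> i \<circ> f \<alpha> j) S = (f \<alpha> j \<circ> f \<alpha> i) S" .
    qed
  qed
  define p where "p A \<alpha> = Finite_Set.fold (f \<alpha>) id A" for A \<alpha>
  have p_empty: "p {} \<alpha> = id" for \<alpha> by (simp add: p_def)
  have p_insert: "p (insert i A) \<alpha> = (T i ^^ \<alpha> i) \<circ> p A \<alpha>" if "finite A" "i \<notin> A" for i A \<alpha>
    using comp_fun_commute_on.fold_insert[OF cfc[unfolded comp_fun_commute_def'] _ that, simplified] by (simp add: p_def f_def)
  have p_comm: "(T j ^^ n) \<circ> p A \<alpha> = p A \<alpha> \<circ> (T j ^^ n)" if "finite A" for A j n \<alpha>
    using that
  proof (induction A rule: finite_induct)
    case (insert i A)
    have "(T j ^^ n) \<circ> p (insert i A) \<alpha> = ((T j ^^ n) \<circ> (T i ^^ \<alpha> i)) \<circ> p A \<alpha>"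
      by (simp add: p_insert insert.hyps comp_assoc)
    also have "\<dots> = (T i ^^ \<alpha> i) \<circ> ((T j ^^ n) \<circ> p A \<alpha>)"
      by (simp only: funpow_comp_commute[OF comm[of j i]] comp_assoc)
    also have "\<dots> = p (insert i A) \<alpha> \<circ> (T j ^^ n)"
      by (simp only: insert.IH p_insert[OF insert.hyps] comp_assoc)
    finally show ?case .
  qed (simp add: p_empty)
  have p_add: "p A (\<alpha> + \<beta>) = p A \<alpha> \<circ> p A \<beta>" if "finite A" for A
    using that
  proof (induction A rule: finite_induct)
    case (insert i A)
    have "p (insert i A) (\<alpha> + \<beta>) = (T i ^^ \<alpha> i) \<circ> ((T i ^^ \<beta> i) \<circ> p A \<alpha>) \<circ> p A \<beta>"
      by (simp add: p_insert insert funpow_add comp_def)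
    also have "\<dots> = (T i ^^ \<alpha> i) \<circ> (p A \<alpha> \<circ> (T i ^^ \<beta> i)) \<circ> p A \<beta>"
      by (simp only: p_comm[OF insert.hyps(1)])
    also have "\<dots> = p (insert i A) \<alpha> \<circ> p (insert i A) \<beta>"
      by (simp add: p_insert insert.hyps comp_assoc)
    finally show ?case .
  qed (simp add: p_empty)
  have op: "op_power T \<alpha> = p UNIV \<alpha>" for \<alpha>
    by (simp add: op_power_def p_def f_def[abs_def])
  show "op_power T (\<alpha> + \<beta>) = op_power T \<alpha> \<circ> op_power T \<beta>" by (simp add: op p_add)
  have pow: "bounded_clinear (T i ^^ n)" for i n
  proof (induction n)
    case 0
    then show ?case using bounded_clinear_id by (simp add: id_def)
  next
    case (Suc n)
    then show ?case using bounded_clinear_compose[OF lin Suc] by (simp add: comp_def)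
  qed
  have "bounded_clinear (p A \<alpha>)" if "finite A" for A
    using that
  proof (induction A rule: finite_induct)
    case empty
    then show ?case using bounded_clinear_id by (simp add: p_empty id_def)
  next
    case (insert i A)
    then show ?case using bounded_clinear_compose[OF pow insert.IH] by (simp add: p_insert comp_def)
  qed
  then show "bounded_clinear (op_power T \<alpha>)" by (simp add: op)
qed

section \<open>The factorization\<close>

locale pure_contraction = nonneg_reciprocal a for a +
  fixes T :: "'d::finite \<Rightarrow> 'h::chilbert_space \<Rightarrow> 'h"
  assumes pure: "pure_inv_s_contraction a T"
begin

abbreviation "T_adj \<alpha> \<equiv> cadjoint (op_power T \<alpha>)"
abbreviation "\<Delta> \<equiv> Delta a T"

lemma contraction: "inv_s_contraction a T"
  using pure by (simp add: pure_inv_s_contraction_def)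

lemma op_power_add: "op_power T (\<alpha> + \<beta>) = op_power T \<alpha> \<circ> op_power T \<beta>"
  and bounded_clinear_op_power: "bounded_clinear (op_power T \<alpha>)"
  using contraction unfolding inv_s_contraction_def by (auto intro: op_power_facts)

lemma bounded_clinear_T_adj: "bounded_clinear (T_adj \<alpha>)"
  by (rule bounded_clinear_cadjoint[OF bounded_clinear_op_power])

lemma T_adj_add: "T_adj (\<alpha> + \<beta>) h = T_adj \<alpha> (T_adj \<beta> h)"
proof (rule cadjoint_unique)
  fix u
  have "op_power T (\<alpha> + \<beta>) u = op_power T \<beta> (op_power T \<alpha> u)"
    using op_power_add[of \<beta> \<alpha>] by (simp add: add.commute)
  then show "cinner (op_power T (\<alpha> + \<beta>) u) h = cinner u (T_adj \<alpha> (T_adj \<beta> h))"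
    by (simp add: cinner_cadjoint[OF bounded_clinear_op_power])
qed

lemma positive_Delta: "positive_op \<Delta>"
proof -
  have "positive_op (defect a T)" using contraction by (simp add: inv_s_contraction_def)
  from someI_ex[OF positive_sqrt_exists[OF this]] show ?thesis
    by (simp add: Delta_def positive_sqrt_def)
qed

lemma bounded_clinear_Delta: "bounded_clinear \<Delta>"
  using positive_Delta by (simp add: positive_op_def)

lemma Delta_herm: "cinner (\<Delta> x) y = cinner x (\<Delta> y)"
  using positive_op_hermitian[OF positive_Delta] by (simp add: hermitian_def)

text \<open>
  Pureness, tested against vectors: it says that \<open>V\<close> below preserves inner products.
\<close>

lemma pure_cinner_has_sum:
  "((\<lambda>\<alpha>. of_real (wt \<alpha>) * cinner (\<Delta> (T_adj \<alpha> h)) (\<Delta> (T_adj \<alpha> u))) has_sum cinner h u) UNIV"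
proof -
  have "((\<lambda>\<alpha>. cinner (wt \<alpha> *\<^sub>R op_power T \<alpha> ((\<Delta> ^^ 2) (T_adj \<alpha> h))) u) has_sum cinner h u) UNIV"
    using pure by (intro has_sum_bounded_linear[OF cinner.bounded_linear_left]) (simp add: pure_inv_s_contraction_def)
  moreover have "cinner (wt \<alpha> *\<^sub>R op_power T \<alpha> ((\<Delta> ^^ 2) (T_adj \<alpha> h))) u
    = of_real (wt \<alpha>) * cinner (\<Delta> (T_adj \<alpha> h)) (\<Delta> (T_adj \<alpha> u))" for \<alpha>
    by (simp add: cinner.scaleR_left cinner_cadjoint[OF bounded_clinear_op_power] numeral_2_eq_2 Delta_herm
        scaleR_conv_of_real)
  ultimately show ?thesis by simp
qed

definition V :: "'h \<Rightarrow> ('d multi_index, 'h) ell2"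
  where "V = column_op (\<lambda>\<alpha> h. sqrt (wt \<alpha>) *\<^sub>R \<Delta> (T_adj \<alpha> h))"

lemma ell2_nth_V: "ell2_nth (V h) \<alpha> = sqrt (wt \<alpha>) *\<^sub>R \<Delta> (T_adj \<alpha> h)"
  and bounded_clinear_V: "bounded_clinear V"
proof -
  have lin: "bounded_clinear (\<lambda>h. sqrt (wt \<alpha>) *\<^sub>R \<Delta> (T_adj \<alpha> h))" for \<alpha>
    by (intro bounded_clinear_scaleR bounded_clinear_compose[OF bounded_clinear_Delta bounded_clinear_T_adj])
  have bound: "(\<Sum>\<alpha>\<in>F. (norm (sqrt (wt \<alpha>) *\<^sub>R \<Delta> (T_adj \<alpha> h)))\<^sup>2) \<le> (1 * norm h)\<^sup>2"
    if "finite F" for F h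
  proof -
    have sq: "(norm (sqrt (wt \<alpha>) *\<^sub>R \<Delta> (T_adj \<alpha> h)))\<^sup>2
        = Re (of_real (wt \<alpha>) * cinner (\<Delta> (T_adj \<alpha> h)) (\<Delta> (T_adj \<alpha> h)))" for \<alpha>
      using multi_coeff_pos[of \<alpha>] by (simp add: power_mult_distrib cinner_self)
    have "((\<lambda>\<alpha>. (norm (sqrt (wt \<alpha>) *\<^sub>R \<Delta> (T_adj \<alpha> h)))\<^sup>2) has_sum (norm h)\<^sup>2) UNIV"
      unfolding sq norm_sq_cinner[of h] by (rule has_sum_Re[OF pure_cinner_has_sum])
    from finite_sum_le_has_sum[OF this that] show ?thesis by simp
  qed
  note col = column_op[of "\<lambda>\<alpha> h. sqrt (wt \<alpha>) *\<^sub>R \<Delta> (T_adj \<alpha> h)", OF lin _ bound, folded V_def]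
  show "ell2_nth (V h) \<alpha> = sqrt (wt \<alpha>) *\<^sub>R \<Delta> (T_adj \<alpha> h)" and "bounded_clinear V"
    using col by simp_all
qed

lemma cinner_V: "cinner (V h) (V u) = cinner h u"
proof (rule has_sum_unique[OF ell2_cinner_has_sum])
  have "cinner (ell2_nth (V h) \<alpha>) (ell2_nth (V u) \<alpha>)
    = of_real (wt \<alpha>) * cinner (\<Delta> (T_adj \<alpha> h)) (\<Delta> (T_adj \<alpha> u))" for \<alpha>
    using multi_coeff_pos[of \<alpha>]
    by (simp add: ell2_nth_V cinner.scaleR_left cinner.scaleR_right scaleR_conv_of_real mult.assoc[symmetric]
        less_imp_le flip: of_real_mult)
  then show "((\<lambda>\<alpha>. cinner (ell2_nth (V h) \<alpha>) (ell2_nth (V u) \<alpha>)) has_sum cinner h u) UNIV"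
    using pure_cinner_has_sum by simp
qed

lemma V_op_eq: "V_op a T h = Hs_of (V h)"
proof
  show "V_op a T h \<alpha> = Hs_of (V h) \<alpha>" for \<alpha>
    using multi_coeff_pos[of \<alpha>] by (simp add: V_op_def Hs_of_def ell2_nth_V less_imp_le)
qed

text \<open>
  The range of \<open>V\<close> is invariant under all backward shifts. Hence its orthogonal complement, the range
  of \<open>P\<close>, is invariant under multiplication by the coordinates.
\<close>

lemma back_shift_V: "back_shift \<gamma> (V h) = V (T_adj \<gamma> h)"
proof (rule ell2_eqI)
  fix \<alpha>
  have "sqrt (wt \<alpha> / wt (\<alpha> + \<gamma>)) * sqrt (wt (\<alpha> + \<gamma>)) = sqrt (wt \<alpha>)"
    using multi_coeff_pos[of "\<alpha> + \<gamma>"] by (simp add: real_sqrt_mult[symmetric])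
  then show "ell2_nth (back_shift \<gamma> (V h)) \<alpha> = ell2_nth (V (T_adj \<gamma> h)) \<alpha>"
    by (simp add: ell2_nth_back_shift ell2_nth_V T_adj_add)
qed

lemma adj_V_V: "cadjoint V (V h) = h"
  by (rule cadjoint_unique) (rule cinner_V)

definition P :: "('d multi_index, 'h) ell2 \<Rightarrow> ('d multi_index, 'h) ell2"
  where "P x = x - V (cadjoint V x)"

lemma bounded_clinear_P: "bounded_clinear P"
  unfolding P_def by (intro bounded_clinear_diff bounded_clinear_id
      bounded_clinear_compose[OF bounded_clinear_V bounded_clinear_cadjoint[OF bounded_clinear_V]])

lemma P_V: "P (V h) = 0"
  by (simp add: P_def adj_V_V)

lemma P_P: "P (P x) = P x"
  by (simp add: P_def[of x] bounded_clinearD[OF bounded_clinear_P] P_V)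

lemma P_herm: "cinner (P x) y = cinner x (P y)"
  by (simp add: P_def cinner.diff_left cinner.diff_right cinner_cadjoint[OF bounded_clinear_V]
      cinner_cadjoint_left[OF bounded_clinear_V, symmetric])

lemma cinner_P_P: "cinner (P x) (P y) = cinner (P x) y"
  by (metis P_P P_herm)

lemma norm_P_le: "norm (P x) \<le> norm x"
  by (rule norm_le_if_cinner_self) (rule cinner_P_P)

lemma P_back_shift_P: "P (back_shift \<gamma> (P x)) = P (back_shift \<gamma> x)"
  by (simp add: P_def[of x] bounded_clinearD[OF bounded_clinear_back_shift] bounded_clinearD[OF bounded_clinear_P]
      back_shift_V P_V)

abbreviation "b \<equiv> multi_coeff (reciprocal_coeff a)"

lemma b_nonneg: "b (\<gamma> :: 'd multi_index) \<ge> 0"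
  by (simp add: multi_coeff_eq reciprocal_nonneg less_imp_le[OF multinomial_pos])

text \<open>
  \<open>C\<^sup>* C = \<Sum>\<^sub>\<gamma> b\<^sub>\<gamma> M\<^sup>\<gamma> P (M\<^sup>\<gamma>)\<^sup>*\<close>. Realising this sum through a single operator avoids a strongly convergent
  series of operators.
\<close>

definition C :: "('d multi_index, 'h) ell2 \<Rightarrow> ('d multi_index, ('d multi_index, 'h) ell2) ell2"
  where "C = column_op (\<lambda>\<gamma> x. sqrt (b \<gamma>) *\<^sub>R P (back_shift \<gamma> x))"

lemma C_sum:
  assumes "finite F"
  shows "(\<Sum>\<gamma>\<in>F. (norm (sqrt (b \<gamma>) *\<^sub>R P (back_shift \<gamma> x)))\<^sup>2) \<le> (norm (P x))\<^sup>2"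
proof (rule order_trans[OF sum_mono back_shift_contraction[OF assms]])
  fix \<gamma>
  have "(norm (P (back_shift \<gamma> (P x))))\<^sup>2 \<le> (norm (back_shift \<gamma> (P x)))\<^sup>2"
    by (intro power_mono norm_P_le) simp
  then show "(norm (sqrt (b \<gamma>) *\<^sub>R P (back_shift \<gamma> x)))\<^sup>2 \<le> b \<gamma> * (norm (back_shift \<gamma> (P x)))\<^sup>2"
    using b_nonneg[of \<gamma>] by (simp add: power_mult_distrib mult_left_mono P_back_shift_P)
qed

lemma ell2_nth_C: "ell2_nth (C x) \<gamma> = sqrt (b \<gamma>) *\<^sub>R P (back_shift \<gamma> x)"
  and bounded_clinear_C: "bounded_clinear C"
proof -
  have lin: "bounded_clinear (\<lambda>x. sqrt (b \<gamma>) *\<^sub>R P (back_shift \<gamma> x))" for \<gamma>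
    by (intro bounded_clinear_scaleR bounded_clinear_compose[OF bounded_clinear_P bounded_clinear_back_shift])
  have bound: "(\<Sum>\<gamma>\<in>F. (norm (sqrt (b \<gamma>) *\<^sub>R P (back_shift \<gamma> x)))\<^sup>2) \<le> (1 * norm x)\<^sup>2" if "finite F" for F x
    using order_trans[OF C_sum[OF that, of x] power_mono[OF norm_P_le[of x] norm_ge_zero]] by simp
  note col = column_op[of "\<lambda>\<gamma> x. sqrt (b \<gamma>) *\<^sub>R P (back_shift \<gamma> x)", OF lin _ bound, folded C_def]
  show "ell2_nth (C x) \<gamma> = sqrt (b \<gamma>) *\<^sub>R P (back_shift \<gamma> x)" and "bounded_clinear C"
    using col by simp_all
qed

lemma norm_C_le: "norm (C x) \<le> norm (P x)"
proof (rule norm_le_sq_le)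
  show "(norm (C x))\<^sup>2 \<le> (norm (P x))\<^sup>2"
    unfolding norm_ell2_sq[of "C x"]
    by (rule infsum_le_finite_sums[OF ell2_norm_summable]) (simp only: ell2_nth_C C_sum)
qed

text \<open>
  Dividing the kernel of \<open>P\<close> by \<open>s\<close> gives the kernel of \<open>G\<close>. On the range of \<open>P\<close> it is the defect
  operator of the restricted multiplication tuple, which inherits being a \<open>1/s\<close>-contraction.
\<close>

definition G :: "('d multi_index, 'h) ell2 \<Rightarrow> ('d multi_index, 'h) ell2"
  where "G x = P x - cadjoint C (C x)"

lemma cinner_G: "cinner (G x) y = cinner (P x) y - cinner (C x) (C y)"
  by (simp add: G_def cinner.diff_left cinner_cadjoint_left[OF bounded_clinear_C])

lemma positive_G: "positive_op G"
  unfolding positive_op_def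
proof (intro conjI allI)
  show "bounded_clinear G" unfolding G_def
    by (intro bounded_clinear_diff bounded_clinear_P
      bounded_clinear_compose[OF bounded_clinear_cadjoint[OF bounded_clinear_C] bounded_clinear_C])
  fix x
  have "cinner (G x) x = of_real ((norm (P x))\<^sup>2 - (norm (C x))\<^sup>2)"
    by (simp add: cinner_G cinner_P_P[symmetric] cinner_self)
  also have "\<dots> \<in> \<real>\<^sub>\<ge>\<^sub>0"
    using power_mono[OF norm_C_le, of x 2] by (simp only: nonneg_Reals_of_real_iff) simp
  finally show "cinner (G x) x \<in> \<real>\<^sub>\<ge>\<^sub>0" .
qed

definition \<Gamma> :: "('d multi_index, 'h) ell2 \<Rightarrow> ('d multi_index, 'h) ell2"
  where "\<Gamma> = positive_sqrt G"

lemma positive_Gamma: "positive_op \<Gamma>" and Gamma_Gamma: "\<Gamma> (\<Gamma> x) = G x"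
  using someI_ex[OF positive_sqrt_exists[OF positive_G]] unfolding \<Gamma>_def positive_sqrt_def
  by (auto simp: fun_eq_iff)

lemma bounded_clinear_Gamma: "bounded_clinear \<Gamma>"
  using positive_Gamma by (simp add: positive_op_def)

lemma Gamma_herm: "cinner (\<Gamma> x) y = cinner x (\<Gamma> y)"
  using positive_op_hermitian[OF positive_Gamma] by (simp add: hermitian_def)

lemma cinner_Gamma: "cinner (\<Gamma> x) (\<Gamma> y) = cinner (P x) y - cinner (C x) (C y)"
  by (simp add: Gamma_herm[symmetric] Gamma_Gamma cinner_G)

lemma cinner_C_finite:
  assumes "\<And>\<gamma>. total_degree \<gamma> > N \<Longrightarrow> back_shift \<gamma> x = 0"
  shows "cinner (C x) (C y) = (\<Sum>m\<le>N. reciprocal_coeff a m *\<^sub>R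
    degree_sum m (\<lambda>\<gamma>. cinner (P (back_shift \<gamma> x)) (back_shift \<gamma> y)))"
proof -
  have "cinner (C x) (C y) = (\<Sum>\<gamma> | total_degree \<gamma> \<le> N. b \<gamma> *\<^sub>R cinner (P (back_shift \<gamma> x)) (back_shift \<gamma> y))"
  proof (rule has_sum_unique[OF ell2_cinner_has_sum has_sum_finite_neutralI[OF finite_total_degree_le]])
    show "(\<Sum>\<gamma> | total_degree \<gamma> \<le> N. b \<gamma> *\<^sub>R cinner (P (back_shift \<gamma> x)) (back_shift \<gamma> y))
      = (\<Sum>\<gamma> | total_degree \<gamma> \<le> N. cinner (ell2_nth (C x) \<gamma>) (ell2_nth (C y) \<gamma>))"
      using b_nonneg by (intro sum.cong refl)
        (simp add: ell2_nth_C cinner.scaleR_left cinner.scaleR_right cinner_P_P mult.assoc[symmetric] flip: of_real_mult)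
    show "cinner (ell2_nth (C x) \<gamma>) (ell2_nth (C y) \<gamma>) = 0"
      if "\<gamma> \<in> UNIV - {\<gamma>. total_degree \<gamma> \<le> N}" for \<gamma>
      using assms[of \<gamma>] that by (simp add: ell2_nth_C bounded_clinearD[OF bounded_clinear_P])
  qed auto
  then show ?thesis by (simp only: sum_multi_coeff_le)
qed

text \<open>
  Multiplication by \<open>s\<close> recovers \<open>P\<close> from \<open>G\<close>: \<open>P = \<Sum>\<^sub>\<alpha> a\<^sub>\<alpha> M\<^sup>\<alpha> G (M\<^sup>\<alpha>)\<^sup>*\<close>. On polynomials \<open>x\<close> the backward
  shifts vanish for large \<open>\<alpha>\<close>, and the identity is the telescoping of the coefficients.
\<close>

lemma Gamma_back_shift_finite:
  assumes x: "\<And>\<beta>. total_degree \<beta> > N \<Longrightarrow> ell2_nth x \<beta> = 0"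
  shows "(\<Sum>\<alpha> | total_degree \<alpha> \<le> N. wt \<alpha> *\<^sub>R cinner (\<Gamma> (back_shift \<alpha> x)) (\<Gamma> (back_shift \<alpha> y))) = cinner (P x) y"
proof -
  define \<phi> where "\<phi> \<alpha> = cinner (P (back_shift \<alpha> x)) (back_shift \<alpha> y)" for \<alpha>
  have zero: "back_shift \<alpha> x = 0" if "total_degree \<alpha> > N" for \<alpha>
    using back_shift_eq_0[OF x that] .
  have \<phi>: "\<phi> \<alpha> = 0" if "total_degree \<alpha> > N" for \<alpha>
    by (simp add: \<phi>_def zero[OF that] bounded_clinearD[OF bounded_clinear_P])
  have "cinner (\<Gamma> (back_shift \<alpha> x)) (\<Gamma> (back_shift \<alpha> y))
    = \<phi> \<alpha> - (\<Sum>m\<le>N. reciprocal_coeff a m *\<^sub>R degree_sum m (\<lambda>\<gamma>. \<phi> (\<alpha> + \<gamma>)))" for \<alpha>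
  proof -
    have "back_shift \<gamma> (back_shift \<alpha> x) = 0" if "total_degree \<gamma> > N" for \<gamma>
      unfolding back_shift_back_shift using that by (intro zero) (simp add: total_degree_add)
    from cinner_C_finite[OF this] show ?thesis
      by (simp add: cinner_Gamma \<phi>_def back_shift_back_shift add.commute)
  qed
  then have "(\<Sum>\<alpha> | total_degree \<alpha> \<le> N. wt \<alpha> *\<^sub>R cinner (\<Gamma> (back_shift \<alpha> x)) (\<Gamma> (back_shift \<alpha> y)))
    = (\<Sum>n\<le>N. a n *\<^sub>R degree_sum n (\<lambda>\<alpha>. \<phi> \<alpha> - (\<Sum>m\<le>N. reciprocal_coeff a m *\<^sub>R degree_sum m (\<lambda>\<gamma>. \<phi> (\<alpha> + \<gamma>)))))"
    by (simp only: sum_multi_coeff_le)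
  also have "\<dots> = \<phi> 0" by (rule reciprocal_coeff_telescope[where a = a and \<phi> = \<phi> and N = N, OF a_0 \<phi>])
  finally show ?thesis by (simp add: \<phi>_def back_shift_zero)
qed

lemma restrict_support:
  assumes "finite F"
  obtains N where "\<And>\<beta>. total_degree \<beta> > N \<Longrightarrow> ell2_nth (ell2_restrict F x) \<beta> = 0"
proof
  show "ell2_nth (ell2_restrict F x) \<beta> = 0" if "total_degree \<beta> > Max (total_degree ` F)" for \<beta>
  proof -
    have "\<beta> \<notin> F" using that assms by (meson Max_ge finite_imageI imageI leD)
    then show ?thesis by (simp add: ell2_nth_restrict[OF assms])
  qed
qed

text \<open>
  The adjoint of the multiplication operator that is to be constructed. The identity \<open>U\<^sup>* U = P\<close> extends
  from polynomials by continuity, for which the uniform bound in \<open>U_sum\<close> is needed first.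
\<close>

definition U :: "('d multi_index, 'h) ell2 \<Rightarrow> ('d multi_index, ('d multi_index, 'h) ell2) ell2"
  where "U = column_op (\<lambda>\<alpha> x. sqrt (wt \<alpha>) *\<^sub>R \<Gamma> (back_shift \<alpha> x))"

lemma U_sum:
  assumes F: "finite F"
  shows "(\<Sum>\<alpha>\<in>F. wt \<alpha> * (norm (\<Gamma> (back_shift \<alpha> x)))\<^sup>2) \<le> (norm x)\<^sup>2"
proof (rule tendsto_upperbound)
  let ?x = "\<lambda>H. ell2_restrict H x"
  have "bounded_linear (\<lambda>x. \<Gamma> (back_shift \<alpha> x))" for \<alpha>
    by (rule bounded_clinearD(1)[OF bounded_clinear_compose[OF bounded_clinear_Gamma bounded_clinear_back_shift]])
  from bounded_linear.tendsto[OF this ell2_restrict_tendsto]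
  show "((\<lambda>H. \<Sum>\<alpha>\<in>F. wt \<alpha> * (norm (\<Gamma> (back_shift \<alpha> (?x H))))\<^sup>2)
      \<longlongrightarrow> (\<Sum>\<alpha>\<in>F. wt \<alpha> * (norm (\<Gamma> (back_shift \<alpha> x)))\<^sup>2)) (finite_subsets_at_top UNIV)"
    by (intro tendsto_intros)
  show "\<forall>\<^sub>F H in finite_subsets_at_top UNIV. (\<Sum>\<alpha>\<in>F. wt \<alpha> * (norm (\<Gamma> (back_shift \<alpha> (?x H))))\<^sup>2) \<le> (norm x)\<^sup>2"
  proof (rule eventually_finite_subsets_at_top_weakI)
    fix H :: "'d multi_index set" assume H: "finite H"
    obtain N0 where N0: "\<And>\<beta>. total_degree \<beta> > N0 \<Longrightarrow> ell2_nth (?x H) \<beta> = 0"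
      using restrict_support[OF H] by blast
    define N where "N = max N0 (Max (total_degree ` F))"
    have "F \<subseteq> {\<alpha>. total_degree \<alpha> \<le> N}" using F by (auto simp: N_def le_max_iff_disj)
    then have "(\<Sum>\<alpha>\<in>F. wt \<alpha> * (norm (\<Gamma> (back_shift \<alpha> (?x H))))\<^sup>2)
      \<le> (\<Sum>\<alpha> | total_degree \<alpha> \<le> N. wt \<alpha> * (norm (\<Gamma> (back_shift \<alpha> (?x H))))\<^sup>2)"
      by (intro sum_mono2 finite_total_degree_le) (auto intro!: mult_nonneg_nonneg less_imp_le[OF multi_coeff_pos])
    also have "\<dots> = Re (\<Sum>\<alpha> | total_degree \<alpha> \<le> N. wt \<alpha> *\<^sub>R cinner (\<Gamma> (back_shift \<alpha> (?x H))) (\<Gamma> (back_shift \<alpha> (?x H))))"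
      by (simp add: norm_sq_cinner)
    also have "\<dots> = Re (cinner (P (?x H)) (?x H))"
      using N0 by (subst Gamma_back_shift_finite) (auto simp: N_def)
    also have "\<dots> = (norm (P (?x H)))\<^sup>2" by (simp add: norm_sq_cinner cinner_P_P)
    also have "\<dots> \<le> (norm x)\<^sup>2"
      using norm_P_le[of "?x H"] norm_ell2_restrict_le[OF H, of x] by (intro power_mono) auto
    finally show "(\<Sum>\<alpha>\<in>F. wt \<alpha> * (norm (\<Gamma> (back_shift \<alpha> (?x H))))\<^sup>2) \<le> (norm x)\<^sup>2" .
  qed
qed simp

lemma ell2_nth_U: "ell2_nth (U x) \<alpha> = sqrt (wt \<alpha>) *\<^sub>R \<Gamma> (back_shift \<alpha> x)"
  and bounded_clinear_U: "bounded_clinear U"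
proof -
  have lin: "bounded_clinear (\<lambda>x. sqrt (wt \<alpha>) *\<^sub>R \<Gamma> (back_shift \<alpha> x))" for \<alpha>
    by (intro bounded_clinear_scaleR bounded_clinear_compose[OF bounded_clinear_Gamma bounded_clinear_back_shift])
  have bound: "(\<Sum>\<alpha>\<in>F. (norm (sqrt (wt \<alpha>) *\<^sub>R \<Gamma> (back_shift \<alpha> x)))\<^sup>2) \<le> (1 * norm x)\<^sup>2" if "finite F" for F x
    using U_sum[OF that, of x] by (simp add: power_mult_distrib less_imp_le[OF multi_coeff_pos])
  note col = column_op[of "\<lambda>\<alpha> x. sqrt (wt \<alpha>) *\<^sub>R \<Gamma> (back_shift \<alpha> x)", OF lin _ bound, folded U_def]
  show "ell2_nth (U x) \<alpha> = sqrt (wt \<alpha>) *\<^sub>R \<Gamma> (back_shift \<alpha> x)" and "bounded_clinear U"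
    using col by simp_all
qed

lemma cinner_U: "cinner (U x) (U y) = cinner (P x) y"
proof (rule tendsto_unique)
  let ?R = "\<lambda>H. ell2_restrict H x"
  show "((\<lambda>H. cinner (U (?R H)) (U y)) \<longlongrightarrow> cinner (U x) (U y)) (finite_subsets_at_top UNIV)"
    by (intro cinner.tendsto tendsto_const bounded_linear.tendsto[OF bounded_clinearD(1)[OF bounded_clinear_U]]
        ell2_restrict_tendsto)
  have "((\<lambda>H. cinner (P (?R H)) y) \<longlongrightarrow> cinner (P x) y) (finite_subsets_at_top UNIV)"
    by (intro cinner.tendsto tendsto_const bounded_linear.tendsto[OF bounded_clinearD(1)[OF bounded_clinear_P]]
        ell2_restrict_tendsto)
  moreover have "\<forall>\<^sub>F H in finite_subsets_at_top UNIV. cinner (U (?R H)) (U y) = cinner (P (?R H)) y"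
  proof (rule eventually_finite_subsets_at_top_weakI)
    fix H :: "'d multi_index set" assume H: "finite H"
    obtain N where N: "\<And>\<beta>. total_degree \<beta> > N \<Longrightarrow> ell2_nth (?R H) \<beta> = 0"
      using restrict_support[OF H] by blast
    have "cinner (U (?R H)) (U y) = (\<Sum>\<alpha> | total_degree \<alpha> \<le> N. wt \<alpha> *\<^sub>R cinner (\<Gamma> (back_shift \<alpha> (?R H))) (\<Gamma> (back_shift \<alpha> y)))"
    proof (rule has_sum_unique[OF ell2_cinner_has_sum has_sum_finite_neutralI[OF finite_total_degree_le]])
      show "(\<Sum>\<alpha> | total_degree \<alpha> \<le> N. wt \<alpha> *\<^sub>R cinner (\<Gamma> (back_shift \<alpha> (?R H))) (\<Gamma> (back_shift \<alpha> y)))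
        = (\<Sum>\<alpha> | total_degree \<alpha> \<le> N. cinner (ell2_nth (U (?R H)) \<alpha>) (ell2_nth (U y) \<alpha>))"
        by (intro sum.cong refl)
          (simp add: less_imp_le[OF multi_coeff_pos] ell2_nth_U cinner.scaleR_left cinner.scaleR_right mult.assoc[symmetric] flip: of_real_mult)
      show "cinner (ell2_nth (U (?R H)) \<alpha>) (ell2_nth (U y) \<alpha>) = 0"
        if "\<alpha> \<in> UNIV - {\<alpha>. total_degree \<alpha> \<le> N}" for \<alpha>
      proof -
        have "back_shift \<alpha> (?R H) = 0" by (rule back_shift_eq_0[OF N]) (use that in auto)
        then show ?thesis by (simp add: ell2_nth_U bounded_clinearD[OF bounded_clinear_Gamma])
      qed
    qed auto
    also have "\<dots> = cinner (P (?R H)) y" by (rule Gamma_back_shift_finite[OF N])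
    finally show "cinner (U (?R H)) (U y) = cinner (P (?R H)) y" .
  qed
  ultimately show "((\<lambda>H. cinner (U (?R H)) (U y)) \<longlongrightarrow> cinner (P x) y) (finite_subsets_at_top UNIV)"
    by (simp add: tendsto_cong)
qed simp

lemma adj_U_U: "cadjoint U (U x) = P x"
  by (rule cadjoint_unique) (simp add: cinner_U P_herm)

lemma U_kernel_vec:
  assumes "norm z < 1"
  shows "U (kernel_vec z u) = kernel_vec z (\<Gamma> (kernel_vec z u))"
  by (rule ell2_eqI)
    (simp add: ell2_nth_U back_shift_kernel_vec[OF assms] ell2_nth_kernel_vec[OF assms]
      bounded_clinearD[OF bounded_clinear_Gamma] scaleR_scaleC scaleC_scaleC)

text \<open>
  \<open>U\<^sup>*\<close> is multiplication by the operator function \<open>z \<mapsto> (e \<mapsto> (\<Gamma> e)(z))\<close>, because \<open>U\<close> maps a kernel vector at \<open>z\<close> to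
  a kernel vector at \<open>z\<close>.
\<close>

lemma Hs_value_adj_U:
  assumes "norm z < 1"
  shows "Hs_value (Hs_of (cadjoint U f)) z = Hs_value (Hs_of (\<Gamma> (Hs_value (Hs_of f) z))) z"
proof (rule cinner_ext_left)
  fix u
  have "cinner (Hs_value (Hs_of (cadjoint U f)) z) u = cinner f (U (kernel_vec z u))"
    by (simp add: cinner_kernel_vec[OF assms] cinner_cadjoint_left[OF bounded_clinear_U])
  also have "\<dots> = cinner (Hs_value (Hs_of f) z) (\<Gamma> (kernel_vec z u))"
    by (simp add: U_kernel_vec[OF assms] cinner_kernel_vec[OF assms])
  also have "\<dots> = cinner (Hs_value (Hs_of (\<Gamma> (Hs_value (Hs_of f) z))) z) u"
    by (simp add: cinner_kernel_vec[OF assms] Gamma_herm)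
  finally show "cinner (Hs_value (Hs_of (cadjoint U f)) z) u = cinner (Hs_value (Hs_of (\<Gamma> (Hs_value (Hs_of f) z))) z) u" .
qed

end

section \<open>Analyticity of point evaluation\<close>

text \<open>
  Bounded linear maps form a real vector space; complex multiples are taken pointwise.
\<close>

definition cmul_blinfun :: "complex \<Rightarrow> ('x::complex_inner \<Rightarrow>\<^sub>L 'y::complex_inner) \<Rightarrow> 'x \<Rightarrow>\<^sub>L 'y"
  where "cmul_blinfun c A = Blinfun (\<lambda>x. c *\<^sub>C blinfun_apply A x)"

lemma cmul_blinfun_apply [simp]: "blinfun_apply (cmul_blinfun c A) x = c *\<^sub>C blinfun_apply A x"
  unfolding cmul_blinfun_def
  by (subst bounded_linear_Blinfun_apply)
    (auto intro: bounded_linear_compose[OF scaleC.bounded_linear_right blinfun.bounded_linear_right])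

lemma bounded_linear_cmul_blinfun: "bounded_linear (\<lambda>c. cmul_blinfun c A)"
proof (rule bounded_linear_intro[of _ "norm A"])
  show "norm (cmul_blinfun c A) \<le> norm c * norm A" for c
  proof (rule norm_blinfun_bound)
    show "norm (blinfun_apply (cmul_blinfun c A) x) \<le> norm c * norm A * norm x" for x
      using mult_left_mono[OF norm_blinfun[of A x], of "norm c"] by (simp add: norm_scaleC mult.assoc)
  qed simp
qed (auto intro!: blinfun_eqI simp: blinfun.bilinear_simps scaleC_add_left scaleC.scaleR_left)

definition monomial_partial :: "complex ^ 'd::finite \<Rightarrow> 'd multi_index \<Rightarrow> 'd \<Rightarrow> complex"
  where "monomial_partial z \<beta> i = of_nat (\<beta> i) * z $ i ^ (\<beta> i - 1) * (\<Prod>j\<in>UNIV - {i}. z $ j ^ \<beta> j)"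

lemma has_derivative_monomial:
  "((\<lambda>z. monomial z \<beta>) has_derivative (\<lambda>h. \<Sum>i\<in>UNIV. h $ i * monomial_partial z \<beta> i)) (at z within S)"
proof -
  have "((\<lambda>z. \<Prod>i\<in>UNIV. z $ i ^ \<beta> i) has_derivative
      (\<lambda>h. \<Sum>i\<in>UNIV. of_nat (\<beta> i) * h $ i * z $ i ^ (\<beta> i - 1) * (\<Prod>j\<in>UNIV - {i}. z $ j ^ \<beta> j))) (at z within S)"
    by (intro has_derivative_prod has_derivative_power bounded_linear_imp_has_derivative bounded_linear_vec_nth)
  then show ?thesis by (simp add: monomial_def monomial_partial_def mult_ac)
qed

lemma monomial_partial_step:
  "monomial_partial z (\<alpha> + unit_index i) i = of_nat (Suc (\<alpha> i)) * monomial z \<alpha>"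
proof -
  have "(\<Prod>j\<in>UNIV - {i}. z $ j ^ (\<alpha> + unit_index i) j) = (\<Prod>j\<in>UNIV - {i}. z $ j ^ \<alpha> j)"
    by (rule prod.cong) (auto simp: unit_index_def)
  moreover have "monomial z \<alpha> = z $ i ^ \<alpha> i * (\<Prod>j\<in>UNIV - {i}. z $ j ^ \<alpha> j)"
    unfolding monomial_def by (rule prod.remove) auto
  moreover have "(\<alpha> + unit_index i) i = Suc (\<alpha> i)" by (simp add: unit_index_def)
  ultimately show ?thesis by (simp add: monomial_partial_def mult_ac)
qed

context invariant_weights
begin

lemma degree_sum_monomial_partial_le:
  fixes z :: "complex ^ 'd::finite"
  shows "degree_sum (Suc m) (\<lambda>\<beta>. (cmod (monomial_partial z \<beta> i))\<^sup>2) \<le> (real (Suc m) * norm z ^ m)\<^sup>2"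
proof -
  have "degree_sum (Suc m) (\<lambda>\<beta>. (cmod (monomial_partial z \<beta> i))\<^sup>2)
    = (\<Sum>\<beta> | total_degree \<beta> = Suc m \<and> \<beta> i > 0. multinomial \<beta> * (cmod (monomial_partial z \<beta> i))\<^sup>2)"
    unfolding degree_sum_def real_scaleR_def
    by (rule sum.mono_neutral_right) (auto simp: finite_total_degree monomial_partial_def)
  also have "\<dots> = (\<Sum>\<alpha> | total_degree \<alpha> = m. multinomial (\<alpha> + unit_index i)
      * (cmod (monomial_partial z (\<alpha> + unit_index i) i))\<^sup>2)"
    by (rule sum.reindex_bij_betw[OF bij_betw_add_unit, symmetric])
  also have "\<dots> \<le> (\<Sum>\<alpha> | total_degree \<alpha> = m. (real (Suc m))\<^sup>2 * (multinomial \<alpha> * (cmod (monomial z \<alpha>))\<^sup>2))"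
  proof (rule sum_mono)
    fix \<alpha> :: "'d multi_index" assume "\<alpha> \<in> {\<alpha>. total_degree \<alpha> = m}"
    then have m: "total_degree \<alpha> = m" by simp
    have "multinomial (\<alpha> + unit_index i) * (cmod (monomial_partial z (\<alpha> + unit_index i) i))\<^sup>2
      = (multinomial (\<alpha> + unit_index i) * real (Suc (\<alpha> i))) * (real (Suc (\<alpha> i)) * (cmod (monomial z \<alpha>))\<^sup>2)"
      unfolding monomial_partial_step norm_mult norm_of_nat by (simp add: power2_eq_square mult_ac)
    also have "\<dots> = real (Suc m) * multinomial \<alpha> * (real (Suc (\<alpha> i)) * (cmod (monomial z \<alpha>))\<^sup>2)"
      by (simp only: multinomial_unit_step m)
    also have "\<dots> \<le> real (Suc m) * multinomial \<alpha> * (real (Suc m) * (cmod (monomial z \<alpha>))\<^sup>2)"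
      using le_total_degree[of \<alpha> i] m
      by (intro mult_left_mono mult_right_mono) (auto intro!: mult_nonneg_nonneg less_imp_le[OF multinomial_pos])
    finally show "multinomial (\<alpha> + unit_index i) * (cmod (monomial_partial z (\<alpha> + unit_index i) i))\<^sup>2
      \<le> (real (Suc m))\<^sup>2 * (multinomial \<alpha> * (cmod (monomial z \<alpha>))\<^sup>2)"
      by (simp add: power2_eq_square mult_ac)
  qed
  also have "\<dots> = (real (Suc m))\<^sup>2 * degree_sum m (\<lambda>\<alpha>. (cmod (monomial z \<alpha>))\<^sup>2)"
    unfolding degree_sum_def by (simp add: sum_distrib_left del: of_nat_Suc)
  also have "\<dots> = (real (Suc m) * norm z ^ m)\<^sup>2"
    unfolding degree_sum_norm_monomial by (simp add: power_mult_distrib power_mult[symmetric] mult.commute)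
  finally show ?thesis .
qed

definition coeff_op :: "'d::finite multi_index \<Rightarrow> ('d multi_index, 'h::chilbert_space) ell2 \<Rightarrow>\<^sub>L 'h"
  where "coeff_op \<beta> = Blinfun (\<lambda>x. Hs_of x \<beta>)"

lemma coeff_op_apply [simp]: "blinfun_apply (coeff_op \<beta>) x = Hs_of x \<beta>"
  unfolding coeff_op_def Hs_of_def
  by (subst bounded_linear_Blinfun_apply)
    (auto intro: bounded_linear_compose[OF bounded_linear_scaleR_right bounded_clinearD(1)[OF bounded_clinear_ell2_nth]])

text \<open>
  The homogeneous part of degree \<open>n\<close> of the point evaluation, as an operator-valued polynomial in \<open>z\<close>.
\<close>

definition eval_part :: "nat \<Rightarrow> complex ^ 'd::finite \<Rightarrow> ('d multi_index, 'h::chilbert_space) ell2 \<Rightarrow>\<^sub>L 'h"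
  where "eval_part n z = (\<Sum>\<beta> | total_degree \<beta> = n. cmul_blinfun (monomial z \<beta>) (coeff_op \<beta>))"

definition eval_part_deriv ::
    "nat \<Rightarrow> complex ^ 'd::finite \<Rightarrow> complex ^ 'd \<Rightarrow> ('d multi_index, 'h::chilbert_space) ell2 \<Rightarrow>\<^sub>L 'h"
  where "eval_part_deriv n z h = (\<Sum>\<beta> | total_degree \<beta> = n.
    cmul_blinfun (\<Sum>i\<in>UNIV. h $ i * monomial_partial z \<beta> i) (coeff_op \<beta>))"

lemma has_derivative_eval_part: "(eval_part n has_derivative eval_part_deriv n z) (at z within S)"
  unfolding eval_part_def[abs_def] eval_part_deriv_def[abs_def]
  by (intro has_derivative_sum bounded_linear.has_derivative[OF bounded_linear_cmul_blinfun] has_derivative_monomial)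

text \<open>
  Two applications of the Cauchy-Schwarz inequality, over the multi-indices and over the coordinates, reduce
  the operator norm to sums of squared partial derivatives of monomials, which the multinomial
  theorem evaluates.
\<close>

lemma norm_eval_part_deriv_le:
  fixes z :: "complex ^ 'd::finite"
  assumes "norm z \<le> r"
  shows "norm (eval_part_deriv (Suc m) z h :: ('d multi_index, 'h::chilbert_space) ell2 \<Rightarrow>\<^sub>L 'h)
    \<le> sqrt (a (Suc m) * CARD('d)) * (real (Suc m) * r ^ m) * norm h"
proof (rule norm_blinfun_bound)
  let ?R = "sqrt (a (Suc m) * CARD('d)) * (real (Suc m) * r ^ m) * norm h"
  have r: "0 \<le> r" using assms norm_ge_zero order_trans by blast
  then show "0 \<le> ?R"
    using a_pos[of "Suc m"] by simp
  fix x :: "('d multi_index, 'h) ell2"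
  let ?D = "{\<beta> :: 'd multi_index. total_degree \<beta> = Suc m}"
  let ?d = "\<lambda>\<beta>. \<Sum>i\<in>UNIV. h $ i * monomial_partial z \<beta> i"
  let ?S = "sqrt (\<Sum>\<beta>\<in>?D. wt \<beta> * (cmod (?d \<beta>))\<^sup>2)"
  have d: "(cmod (?d \<beta>))\<^sup>2 \<le> (norm h)\<^sup>2 * (\<Sum>i\<in>UNIV. (cmod (monomial_partial z \<beta> i))\<^sup>2)" for \<beta>
  proof -
    have "cmod (?d \<beta>) \<le> (\<Sum>i\<in>UNIV. cmod (h $ i) * cmod (monomial_partial z \<beta> i))"
      by (rule order_trans[OF norm_sum]) (simp add: norm_mult)
    also have "\<dots> \<le> norm h * L2_set (\<lambda>i. cmod (monomial_partial z \<beta> i)) UNIV"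
      unfolding norm_vec_def using L2_set_mult_ineq[of "\<lambda>i. cmod (h $ i)" "\<lambda>i. cmod (monomial_partial z \<beta> i)" UNIV] by simp
    finally have "(cmod (?d \<beta>))\<^sup>2 \<le> (norm h * L2_set (\<lambda>i. cmod (monomial_partial z \<beta> i)) UNIV)\<^sup>2"
      by (rule power_mono) simp
    then show ?thesis by (simp add: power_mult_distrib L2_set_def sum_nonneg)
  qed
  have "(\<Sum>\<beta>\<in>?D. wt \<beta> * (cmod (?d \<beta>))\<^sup>2)
    \<le> (\<Sum>\<beta>\<in>?D. wt \<beta> * ((norm h)\<^sup>2 * (\<Sum>i\<in>UNIV. (cmod (monomial_partial z \<beta> i))\<^sup>2)))"
    by (intro sum_mono mult_left_mono d less_imp_le[OF multi_coeff_pos])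
  also have "\<dots> = (norm h)\<^sup>2 * (\<Sum>i\<in>UNIV. \<Sum>\<beta>\<in>?D. wt \<beta> *\<^sub>R (cmod (monomial_partial z \<beta> i))\<^sup>2)"
    unfolding sum_distrib_left by (subst sum.swap) (simp add: mult_ac)
  also have "\<dots> = (norm h)\<^sup>2 * (\<Sum>i\<in>UNIV. a (Suc m) * degree_sum (Suc m) (\<lambda>\<beta>. (cmod (monomial_partial z \<beta> i))\<^sup>2))"
    unfolding degree_sum_multi_coeff by simp
  also have "\<dots> \<le> (norm h)\<^sup>2 * (\<Sum>i\<in>(UNIV :: 'd set). a (Suc m) * (real (Suc m) * r ^ m)\<^sup>2)"
  proof (intro mult_left_mono sum_mono)
    show "degree_sum (Suc m) (\<lambda>\<beta>. (cmod (monomial_partial z \<beta> i))\<^sup>2) \<le> (real (Suc m) * r ^ m)\<^sup>2" for i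
      by (rule order_trans[OF degree_sum_monomial_partial_le], intro power_mono mult_left_mono)
        (use assms in auto)
  qed (auto intro: less_imp_le[OF a_pos])
  also have "\<dots> = (?R)\<^sup>2"
    using a_pos[of "Suc m"] by (simp add: power_mult_distrib mult_ac del: of_nat_Suc)
  finally have "?S
      \<le> sqrt ((?R)\<^sup>2)"
    by (rule real_sqrt_le_mono)
  then have first: "?S
      \<le> ?R"
    using r a_pos[of "Suc m"] by (simp add: abs_mult del: of_nat_Suc)
  have "norm (blinfun_apply (eval_part_deriv (Suc m) z h) x) \<le> (\<Sum>\<beta>\<in>?D. norm (?d \<beta> *\<^sub>C Hs_of x \<beta>))"
    unfolding eval_part_deriv_def blinfun.sum_left cmul_blinfun_apply coeff_op_apply by (rule norm_sum)
  also have "\<dots> = (\<Sum>\<beta>\<in>?D. \<bar>sqrt (wt \<beta>) * cmod (?d \<beta>)\<bar> * \<bar>norm (ell2_nth x \<beta>)\<bar>)"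
    by (intro sum.cong refl) (simp add: norm_scaleC Hs_of_def abs_mult mult_ac)
  also have "\<dots> \<le> L2_set (\<lambda>\<beta>. sqrt (wt \<beta>) * cmod (?d \<beta>)) ?D * L2_set (\<lambda>\<beta>. norm (ell2_nth x \<beta>)) ?D"
    by (rule L2_set_mult_ineq)
  also have "L2_set (\<lambda>\<beta>. sqrt (wt \<beta>) * cmod (?d \<beta>)) ?D = ?S"
    unfolding L2_set_def by (simp add: power_mult_distrib less_imp_le[OF multi_coeff_pos])
  also have "L2_set (\<lambda>\<beta>. norm (ell2_nth x \<beta>)) ?D \<le> norm x"
    unfolding L2_set_def using ell2_sum_le[OF finite_total_degree[of "Suc m"], of x] by (intro real_le_lsqrt) auto
  then have "?S * L2_set (\<lambda>\<beta>. norm (ell2_nth x \<beta>)) ?D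
      \<le> ?R * norm x"
    using r a_pos[of "Suc m"] by (intro mult_mono first) (auto simp: L2_set_nonneg intro!: mult_nonneg_nonneg)
  finally show "norm (blinfun_apply (eval_part_deriv (Suc m) z h) x)
      \<le> ?R * norm x" .
qed

lemma eval_part_deriv_0: "eval_part_deriv 0 z h = 0"
  by (simp add: eval_part_deriv_def total_degree_0_iff monomial_partial_def
      linear_0[OF bounded_linear.linear[OF bounded_linear_cmul_blinfun]])

text \<open>
  Comparison with the derivative of a geometric series: for \<open>r < \<rho> < 1\<close> the convergence of
  \<open>\<Sum> a\<^sub>n \<rho>\<^bsup>2 n\<^esup>\<close> gives \<open>\<surd>a\<^sub>n \<le> const / \<rho>\<^sup>n\<close>.
\<close>

lemma deriv_bound_summable:
  assumes "0 < r" "r < 1" "0 \<le> D"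
  shows "summable (\<lambda>m. sqrt (a (Suc m) * D) * (real (Suc m) * r ^ m))"
proof -
  obtain \<rho> where \<rho>: "r < \<rho>" "\<rho> < 1" using dense assms by blast
  then have \<rho>0: "0 < \<rho>" using assms by simp
  have "summable (\<lambda>n. a n * (\<rho>\<^sup>2) ^ n)" using \<rho> \<rho>0 by (intro a_summable) (auto simp: power_less_one_iff abs_square_less_1)
  then have "Bseq (\<lambda>n. a n * (\<rho>\<^sup>2) ^ n)" by (intro convergent_imp_Bseq) (auto simp: convergent_def dest: summable_LIMSEQ_zero)
  then obtain K where K: "K > 0" "\<And>n. norm (a n * (\<rho>\<^sup>2) ^ n) \<le> K" by (rule BseqE) blast
  define x where "x = r / \<rho>"
  have x: "0 < x" "x < 1" using assms \<rho> \<rho>0 by (auto simp: x_def)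
  have "summable (\<lambda>m. real (Suc m) * x ^ m)"
    using geometric_deriv_sums[of x] x by (auto simp: sums_iff)
  then have s: "summable (\<lambda>m. sqrt (K * \<bar>D\<bar>) / \<rho> * (real (Suc m) * x ^ m))" by (rule summable_mult)
  show ?thesis
  proof (rule summable_comparison_test'[OF s, of 0])
    fix m
    have "(\<rho>\<^sup>2) ^ Suc m = (\<rho> ^ Suc m)\<^sup>2" by (simp only: power_mult[symmetric] mult.commute)
    then have "\<bar>a (Suc m) * D\<bar> * (\<rho> ^ Suc m)\<^sup>2 = norm (a (Suc m) * (\<rho>\<^sup>2) ^ Suc m) * \<bar>D\<bar>"
      by (simp add: abs_mult del: power_Suc)
    also have "\<dots> \<le> K * \<bar>D\<bar>" by (intro mult_right_mono K) simp
    finally have "sqrt (\<bar>a (Suc m) * D\<bar> * (\<rho> ^ Suc m)\<^sup>2) \<le> sqrt (K * \<bar>D\<bar>)" by (rule real_sqrt_le_mono)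
    then have "sqrt \<bar>a (Suc m) * D\<bar> * \<rho> ^ Suc m \<le> sqrt (K * \<bar>D\<bar>)"
      using \<rho>0 by (simp add: real_sqrt_mult)
    then have "sqrt \<bar>a (Suc m) * D\<bar> \<le> sqrt (K * \<bar>D\<bar>) / \<rho> ^ Suc m"
      using \<rho>0 by (simp add: pos_le_divide_eq del: power_Suc)
    then have "sqrt \<bar>a (Suc m) * D\<bar> * (real (Suc m) * r ^ m) \<le> sqrt (K * \<bar>D\<bar>) / \<rho> ^ Suc m * (real (Suc m) * r ^ m)"
      using assms by (intro mult_right_mono) auto
    also have "\<dots> = sqrt (K * \<bar>D\<bar>) / \<rho> * (real (Suc m) * x ^ m)"
      by (simp add: x_def power_divide)
    finally show "norm (sqrt (a (Suc m) * D) * (real (Suc m) * r ^ m)) \<le> sqrt (K * \<bar>D\<bar>) / \<rho> * (real (Suc m) * x ^ m)"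
      using assms less_imp_le[OF a_pos[of "Suc m"]] by (simp add: abs_mult del: of_nat_Suc)
  qed
qed

definition eval_op :: "complex ^ 'd::finite \<Rightarrow> ('d multi_index, 'h::chilbert_space) ell2 \<Rightarrow>\<^sub>L 'h"
  where "eval_op z = Blinfun (\<lambda>x. Hs_value (Hs_of x) z)"

lemma eval_op_apply: "norm z < 1 \<Longrightarrow> blinfun_apply (eval_op z) x = Hs_value (Hs_of x) z"
  unfolding eval_op_def
  by (subst bounded_linear_Blinfun_apply) (auto intro: bounded_clinearD(1)[OF bounded_clinear_Hs_value])

lemma eval_part_apply: "blinfun_apply (eval_part n z) x = (\<Sum>\<beta> | total_degree \<beta> = n. monomial z \<beta> *\<^sub>C Hs_of x \<beta>)"
  by (simp add: eval_part_def blinfun.sum_left)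

text \<open>
  The homogeneous parts are differentiated term by term, the derivatives converging uniformly in
  operator norm on smaller balls. Convergence of the parts themselves has to be known at one
  point only, and at the origin it is trivial.
\<close>

lemma eval_op_has_derivative:
  fixes z :: "complex ^ 'd::finite"
  assumes z: "norm z < 1"
  obtains D :: "complex ^ 'd \<Rightarrow> ('d multi_index, 'h::chilbert_space) ell2 \<Rightarrow>\<^sub>L 'h"
  where "(eval_op has_derivative D) (at z)"
    "\<And>c h x. blinfun_apply (D (c *s h)) x = c *\<^sub>C blinfun_apply (D h) x"
proof -
  obtain r where "norm z < r" "r < 1" using dense z by blast
  then have r: "norm z < r" "0 < r" "r < 1" using norm_ge_zero[of z] by linarith+
  define B where "B n = (case n of 0 \<Rightarrow> 0 | Suc m \<Rightarrow> sqrt (a (Suc m) * CARD('d)) * (real (Suc m) * r ^ m))" for n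
  have "summable (\<lambda>n. B (Suc n))" unfolding B_def using deriv_bound_summable[OF r(2,3), of "CARD('d)"] by simp
  then have B: "summable B" by (simp add: summable_Suc_iff)
  let ?p' = "eval_part_deriv :: nat \<Rightarrow> complex ^ 'd \<Rightarrow> complex ^ 'd \<Rightarrow> ('d multi_index, 'h) ell2 \<Rightarrow>\<^sub>L 'h"
  have bound: "norm (?p' n w h) \<le> B n * norm h" if "norm w < r" for n w h
    using norm_eval_part_deriv_le[of w r] that by (cases n) (auto simp: B_def eval_part_deriv_0)
  have summ: "summable (\<lambda>n. norm (?p' n w h))" if "norm w < r" for w h
    by (rule summable_comparison_test'[OF summable_mult2[OF B, of "norm h"], of 0]) (simp add: bound[OF that])
  define D where "D w h = (\<Sum>n. ?p' n w h)" for w h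
  have tail: "\<forall>\<^sub>F n in sequentially. \<forall>w\<in>ball 0 r. \<forall>h. norm (sum (\<lambda>i. ?p' i w h) {..<n} - D w h) \<le> e * norm h"
    if e: "e > 0" for e
  proof -
    obtain N where N: "\<And>n. n \<ge> N \<Longrightarrow> norm (\<Sum>i. B (i + n)) < e" using suminf_exist_split[OF e B] by blast
    have "norm (sum (\<lambda>i. ?p' i w h) {..<n} - D w h) \<le> e * norm h" if n: "n \<ge> N" and w: "w \<in> ball 0 r" for n w h
    proof -
      have w': "norm w < r" using w by simp
      have "D w h = (\<Sum>i. ?p' (i + n) w h) + sum (\<lambda>i. ?p' i w h) {..<n}"
        unfolding D_def by (rule suminf_split_initial_segment[OF summable_norm_cancel[OF summ[OF w']]])
      then have "norm (sum (\<lambda>i. ?p' i w h) {..<n} - D w h) = norm (\<Sum>i. ?p' (i + n) w h)" by simp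
      also have "\<dots> \<le> (\<Sum>i. norm (?p' (i + n) w h))"
        by (rule summable_norm[OF summable_ignore_initial_segment[OF summ[OF w']]])
      also have "\<dots> \<le> (\<Sum>i. B (i + n) * norm h)"
        by (intro suminf_le bound w' summable_mult2 summable_ignore_initial_segment[OF B]
            summable_ignore_initial_segment[OF summ[OF w']])
      also have "\<dots> = (\<Sum>i. B (i + n)) * norm h"
        by (rule suminf_mult2[OF summable_ignore_initial_segment[OF B], symmetric])
      also have "\<dots> \<le> e * norm h" using N[OF n] by (intro mult_right_mono) auto
      finally show ?thesis .
    qed
    then show ?thesis unfolding eventually_sequentially by blast
  qed
  have "(\<lambda>n. eval_part n 0 :: ('d multi_index, 'h) ell2 \<Rightarrow>\<^sub>L 'h) sums (\<Sum>n\<in>{0}. eval_part n 0)"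
  proof (rule sums_finite)
    fix n :: nat assume "n \<notin> {0}"
    have "monomial (0 :: complex ^ 'd) \<beta> = 0" if b: "total_degree \<beta> = n" for \<beta>
    proof -
      have "\<beta> \<noteq> 0" using b \<open>n \<notin> {0}\<close> by auto
      then obtain i where "\<beta> i > 0" by (auto simp: fun_eq_iff)
      then show ?thesis unfolding monomial_def by (intro prod_zero) (auto intro!: bexI[of _ i])
    qed
    then show "(eval_part n 0 :: ('d multi_index, 'h) ell2 \<Rightarrow>\<^sub>L 'h) = 0"
      by (intro blinfun_eqI) (simp add: eval_part_apply)
  qed simp
  from has_derivative_series[where S = "ball 0 r" and x = 0,
      OF convex_ball has_derivative_eval_part tail _ this] r(2)
  obtain g where "\<forall>w\<in>ball 0 r. (\<lambda>n. eval_part n w) sums (g w) \<and> (g has_derivative D w) (at w within ball 0 r)"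
    by auto
  then have g: "\<And>w. w \<in> ball 0 r \<Longrightarrow> (\<lambda>n. eval_part n w) sums (g w)"
    "\<And>w. w \<in> ball 0 r \<Longrightarrow> (g has_derivative D w) (at w within ball 0 r)" by blast+
  have eq: "g w = eval_op w" if w: "w \<in> ball 0 r" for w
  proof (rule blinfun_eqI)
    fix x
    have "(\<lambda>n. blinfun_apply (eval_part n w) x) sums blinfun_apply (g w) x"
      by (rule bounded_linear.sums[OF blinfun.bounded_linear_left g(1)[OF w]])
    moreover have "norm w < 1" using w r by simp
    ultimately show "blinfun_apply (g w) x = blinfun_apply (eval_op w) x"
      using has_sum_total_degree[OF Hs_value_has_sum[of w x]] sums_unique2
      by (simp add: eval_part_apply eval_op_apply) blast
  qed
  have zb: "z \<in> ball 0 r" using r by simp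
  have "(g has_derivative D z) (at z)" using g(2)[OF zb] by (simp add: at_within_open[OF zb])
  then have "(eval_op has_derivative D z) (at z)"
    by (rule has_derivative_transform_within_open[OF _ open_ball zb eq])
  moreover have "blinfun_apply (D z (c *s h)) x = c *\<^sub>C blinfun_apply (D z h) x" for c h x
  proof -
    have app: "blinfun_apply (D z h) x = (\<Sum>n. blinfun_apply (?p' n z h) x)"
      "summable (\<lambda>n. blinfun_apply (?p' n z h) x)" for h
      unfolding D_def using summable_norm_cancel[OF summ[OF r(1)]]
      by (auto intro: bounded_linear.suminf[OF blinfun.bounded_linear_left]
          bounded_linear.summable[OF blinfun.bounded_linear_left])
    have "blinfun_apply (?p' n z (c *s h)) x = c *\<^sub>C blinfun_apply (?p' n z h) x" for n
      by (simp add: eval_part_deriv_def blinfun.sum_left scaleC.sum_right scaleC_scaleC sum_distrib_left mult.assoc)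
    then show ?thesis
      by (simp add: app bounded_linear.suminf[OF scaleC.bounded_linear_right app(2), symmetric])
  qed
  ultimately show ?thesis by (rule that)
qed

end

section \<open>The characteristic function\<close>

lemma closed_csubspace_closure_range:
  assumes A: "bounded_clinear A"
  shows "closed_csubspace (closure (range A))"
  unfolding closed_csubspace_def
proof (intro conjI ballI allI)
  show "0 \<in> closure (range A)"
    using bounded_clinearD(4)[OF A] closure_subset[of "range A"] by (metis rangeI subsetD)
  fix x assume "x \<in> closure (range A)"
  then obtain f where f: "\<And>n. f n \<in> range A" "f \<longlonglongrightarrow> x" unfolding closure_sequential by blast
  show "c *\<^sub>C x \<in> closure (range A)" for c
    unfolding closure_sequential
  proof (intro exI conjI allI)
    show "c *\<^sub>C f n \<in> range A" for n using f(1)[of n] by (auto simp flip: bounded_clinearD(5)[OF A])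
    show "(\<lambda>n. c *\<^sub>C f n) \<longlonglongrightarrow> c *\<^sub>C x" by (intro scaleC.tendsto tendsto_const f)
  qed
  fix y assume "y \<in> closure (range A)"
  then obtain g where g: "\<And>n. g n \<in> range A" "g \<longlonglongrightarrow> y" unfolding closure_sequential by blast
  show "x + y \<in> closure (range A)"
    unfolding closure_sequential
  proof (intro exI conjI allI)
    show "f n + g n \<in> range A" for n
      using f(1)[of n] g(1)[of n] by (auto simp flip: bounded_clinearD(2)[OF A])
    show "(\<lambda>n. f n + g n) \<longlonglongrightarrow> x + y" by (intro tendsto_add f g)
  qed
qed simp

lemma Hs_value_map:
  fixes A :: "'h::chilbert_space \<Rightarrow> 'h"
  assumes "bounded_clinear A" "(\<lambda>\<alpha>. norm (monomial z \<alpha> *\<^sub>C c \<alpha>)) summable_on UNIV"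
  shows "Hs_value (\<lambda>\<alpha>. A (c \<alpha>)) z = A (Hs_value c z)"
proof -
  have "((\<lambda>\<alpha>. A (monomial z \<alpha> *\<^sub>C c \<alpha>)) has_sum A (Hs_value c z)) UNIV"
    unfolding Hs_value_def
    by (rule has_sum_bounded_linear[OF bounded_clinearD(1)[OF assms(1)]
          has_sum_infsum[OF abs_summable_summable[OF assms(2)]]])
  then show ?thesis
    unfolding Hs_value_def[of "\<lambda>\<alpha>. A (c \<alpha>)"] by (simp add: infsumI bounded_clinearD(5)[OF assms(1)])
qed

context invariant_weights
begin

lemma mult_op_eqI:
  fixes \<theta> :: "complex ^ 'd::finite \<Rightarrow> 'e::chilbert_space \<Rightarrow>\<^sub>L 'f::chilbert_space"
  assumes F: "closed_csubspace F" "\<And>\<alpha>. ell2_nth y \<alpha> \<in> F"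
    and val: "\<And>z. z \<in> ball 0 1 \<Longrightarrow> Hs_value (Hs_of y) z = blinfun_apply (\<theta> z) (Hs_value f z)"
  shows "mult_op a F \<theta> f = Hs_of y"
  unfolding mult_op_def
proof (rule the_equality)
  show "Hs_of y \<in> Hs a F \<and> (\<forall>z\<in>ball 0 1. Hs_value (Hs_of y) z = blinfun_apply (\<theta> z) (Hs_value f z))"
    using val by (simp add: Hs_of_in_Hs F)
  fix g assume g: "g \<in> Hs a F \<and> (\<forall>z\<in>ball 0 1. Hs_value g z = blinfun_apply (\<theta> z) (Hs_value f z))"
  then obtain x where x: "g = Hs_of x" using Hs_of_surj[OF F(1)] by blast
  have "x = y" by (rule Hs_value_unique) (use g x val in auto)
  then show "g = Hs_of y" by (simp add: x)
qed

lemma adjoint_on_Hs_eqI: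
  fixes x :: "('d::finite multi_index, 'e::chilbert_space) ell2"
    and S :: "('d multi_index \<Rightarrow> 'e) \<Rightarrow> 'y"
  assumes E: "closed_csubspace E" "\<And>\<alpha>. ell2_nth x \<alpha> \<in> E"
    and adj: "\<And>y. (\<And>\<alpha>. ell2_nth y \<alpha> \<in> E) \<Longrightarrow> ip (S (Hs_of y)) f = cinner y x"
  shows "adjoint_on (Hs a E) (Hs_inner a) ip S f = Hs_of x"
  unfolding adjoint_on_def
proof (rule the_equality)
  show "Hs_of x \<in> Hs a E \<and> (\<forall>u\<in>Hs a E. ip (S u) f = Hs_inner a u (Hs_of x))"
  proof (intro conjI ballI)
    fix u :: "'d multi_index \<Rightarrow> 'e" assume "u \<in> Hs a E"
    then obtain y where "u = Hs_of y" "\<And>\<alpha>. ell2_nth y \<alpha> \<in> E" using Hs_of_surj[OF E(1)] by blast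
    then show "ip (S u) f = Hs_inner a u (Hs_of x)" using adj by (simp add: Hs_inner_Hs_of)
  qed (rule Hs_of_in_Hs[OF E])
  fix g :: "'d multi_index \<Rightarrow> 'e" assume g: "g \<in> Hs a E \<and> (\<forall>u\<in>Hs a E. ip (S u) f = Hs_inner a u g)"
  then obtain x' where x': "g = Hs_of x'" "\<And>\<alpha>. ell2_nth x' \<alpha> \<in> E" using Hs_of_surj[OF E(1)] by blast
  have same: "cinner y x' = cinner y x" if y: "\<And>\<alpha>. ell2_nth y \<alpha> \<in> E" for y
  proof -
    have "ip (S (Hs_of y)) f = Hs_inner a (Hs_of y) (Hs_of x')" using g Hs_of_in_Hs[OF E(1) y] x'(1) by blast
    then show ?thesis using adj[OF y] by (simp add: Hs_inner_Hs_of)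
  qed
  have mem: "ell2_nth (x' - x) \<alpha> \<in> E" for \<alpha>
  proof -
    have "ell2_nth x' \<alpha> + (-1) *\<^sub>C ell2_nth x \<alpha> \<in> E" using E x'(2) by (simp add: closed_csubspace_def)
    moreover have "(-1) *\<^sub>C ell2_nth x \<alpha> = - ell2_nth x \<alpha>" using scaleR_scaleC[of "-1" "ell2_nth x \<alpha>"] by simp
    ultimately show ?thesis by (simp add: minus_ell2.rep_eq)
  qed
  have "cinner (x' - x) (x' - x) = 0" using same[OF mem] by (simp add: cinner.diff_right)
  then show "g = Hs_of x" by (simp add: x'(1) cinner_self)
qed

end

context pure_contraction
begin

lemma closed_csubspace_defect_space: "closed_csubspace (defect_space a T)"
  unfolding defect_space_def by (rule closed_csubspace_closure_range[OF bounded_clinear_Delta])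

lemma ell2_nth_V_in_defect_space: "ell2_nth (V h) \<alpha> \<in> defect_space a T"
proof -
  have "\<Delta> (T_adj \<alpha> h) \<in> defect_space a T"
    unfolding defect_space_def by (rule subsetD[OF closure_subset]) simp
  then show ?thesis
    unfolding ell2_nth_V by (rule closed_csubspace_scaleR[OF closed_csubspace_defect_space])
qed

text \<open>
  The coefficient space is all of \<open>ell2\<close> and \<open>\<theta>(z) e = Q ((\<Gamma> e)(z))\<close>, where \<open>Q\<close> projects to the defect
  space. The construction of \<open>\<Gamma>\<close> takes place in the space of functions with values in \<open>H\<close>; \<open>Q\<close>
  turns \<open>M\<^sub>\<theta> M\<^sub>\<theta>\<^sup>*\<close> into the compression of \<open>P\<close> to functions with values in the defect space, on which \<open>P\<close>
  already acts because \<open>V\<close> takes values there.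
\<close>

lemma characteristic_function_exists:
  "\<exists>\<theta> :: complex ^ 'd \<Rightarrow> ('d multi_index, 'h) ell2 \<Rightarrow>\<^sub>L 'h. characteristic_function a T UNIV \<theta>"
proof -
  let ?D = "defect_space a T"
  note D = closed_csubspace_defect_space
  obtain Q where Q: "bounded_clinear Q" "\<And>x. Q x \<in> ?D" "\<And>x. x \<in> ?D \<Longrightarrow> Q x = x"
    "\<And>x y. cinner (Q x) y = cinner x (Q y)"
    using orthogonal_projection[OF D] by metis
  have nQ: "norm (Q x) \<le> norm x" for x
    by (rule norm_le_if_cinner_self) (simp add: Q)
  define QX :: "('d multi_index, 'h) ell2 \<Rightarrow> ('d multi_index, 'h) ell2"
    where "QX = column_op (\<lambda>\<alpha> x. Q (ell2_nth x \<alpha>))"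
  have "(\<Sum>\<alpha>\<in>F. (norm (Q (ell2_nth x \<alpha>)))\<^sup>2) \<le> (1 * norm x)\<^sup>2"
    if "finite F" for F and x :: "('d multi_index, 'h) ell2"
    using order_trans[OF sum_mono[of F "\<lambda>\<alpha>. (norm (Q (ell2_nth x \<alpha>)))\<^sup>2" "\<lambda>\<alpha>. (norm (ell2_nth x \<alpha>))\<^sup>2"]
        ell2_sum_le[OF that]] by (simp add: power_mono nQ)
  note col = column_op[of "\<lambda>\<alpha> x. Q (ell2_nth x \<alpha>)",
      OF bounded_clinear_compose[OF Q(1) bounded_clinear_ell2_nth] _ this]
  have Qx: "ell2_nth (QX x) \<alpha> = Q (ell2_nth x \<alpha>)" and nQX: "norm (QX x) \<le> norm x" for x \<alpha>
    using col(1,2)[of x] by (simp_all add: QX_def)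
  have QX_herm: "cinner (QX x) y = cinner x (QX y)" for x y
    unfolding cinner_ell2.rep_eq by (simp add: Qx Q(4))
  have QX_fix: "QX x = x" if "\<And>\<alpha>. ell2_nth x \<alpha> \<in> ?D" for x
    by (rule ell2_eqI) (simp add: Qx Q(3) that)
  have QX_val: "Hs_value (Hs_of (QX x)) z = Q (Hs_value (Hs_of x) z)" if "norm z < 1" for x z
  proof -
    have "Hs_of (QX x) = (\<lambda>\<alpha>. Q (Hs_of x \<alpha>))"
      by (simp add: fun_eq_iff Hs_of_def Qx bounded_clinearD[OF Q(1)])
    then show ?thesis using Hs_value_map[OF Q(1) Hs_value_summable[OF that]] by simp
  qed
  define BQ where "BQ = Blinfun Q"
  define BG where "BG = Blinfun \<Gamma>"
  have BQ: "blinfun_apply BQ x = Q x" and BG: "blinfun_apply BG y = \<Gamma> y" for x y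
    unfolding BQ_def BG_def
    using bounded_clinearD(1)[OF Q(1)] bounded_clinearD(1)[OF bounded_clinear_Gamma]
    by (simp_all add: bounded_linear_Blinfun_apply)
  define \<theta> :: "complex ^ 'd \<Rightarrow> ('d multi_index, 'h) ell2 \<Rightarrow>\<^sub>L 'h"
    where "\<theta> z = BQ o\<^sub>L (eval_op z o\<^sub>L BG)" for z
  have \<theta>: "blinfun_apply (\<theta> z) x = Q (Hs_value (Hs_of (\<Gamma> x)) z)" if "norm z < 1" for z x
    by (simp add: \<theta>_def BQ BG eval_op_apply that)
  have mult: "mult_op a ?D \<theta> (Hs_of f) = Hs_of (QX (cadjoint U f))" for f
    by (rule mult_op_eqI[OF D]) (simp_all add: Qx Q QX_val Hs_value_adj_U \<theta>)
  have "characteristic_function a T UNIV \<theta>"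
    unfolding characteristic_function_def
  proof (intro conjI ballI)
    show "closed_csubspace (UNIV :: ('d multi_index, 'h) ell2 set)" by (rule closed_csubspace_UNIV)
  next
    fix z :: "complex ^ 'd" assume "z \<in> ball 0 1"
    then have z: "norm z < 1" by simp
    have "bounded_clinear (\<lambda>x. Q (Hs_value (Hs_of (\<Gamma> x)) z))"
      by (intro bounded_clinear_compose[OF Q(1)] bounded_clinear_compose[OF bounded_clinear_Hs_value[OF z]] bounded_clinear_Gamma)
    moreover have "blinfun_apply (\<theta> z) = (\<lambda>x. Q (Hs_value (Hs_of (\<Gamma> x)) z))"
      using \<theta>[OF z] by (rule ext)
    ultimately have "bounded_clinear (blinfun_apply (\<theta> z))" by simp
    moreover have "blinfun_apply (\<theta> z) x = 0" if "x \<in> orthogonal_compl UNIV" for x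
    proof -
      have "x = 0" using that by (auto simp: orthogonal_compl_def dest: spec[of _ x] simp: cinner_self)
      then show ?thesis by (simp add: blinfun.zero_right)
    qed
    moreover have "blinfun_apply (\<theta> z) x \<in> ?D" for x by (simp add: \<theta>[OF z] Q(2))
    ultimately show "\<theta> z \<in> bounded_ops UNIV ?D"
      by (auto simp: bounded_ops_def)
  next
    show "analytic_on_ball \<theta>"
      unfolding analytic_on_ball_def
    proof
      fix z :: "complex ^ 'd" assume "z \<in> ball 0 1"
      then have z: "norm z < 1" by simp
      obtain L :: "complex ^ 'd \<Rightarrow> ('d multi_index, 'h) ell2 \<Rightarrow>\<^sub>L 'h"
        where L: "(eval_op has_derivative L) (at z)" "\<And>c h x. blinfun_apply (L (c *s h)) x = c *\<^sub>C blinfun_apply (L h) x"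
        using eval_op_has_derivative[OF z] by blast
      have "bounded_linear (\<lambda>A. BQ o\<^sub>L (A o\<^sub>L BG))"
        by (intro bounded_linear_compose[OF bounded_bilinear.bounded_linear_right[OF bounded_bilinear_blinfun_compose]]
            bounded_bilinear.bounded_linear_left[OF bounded_bilinear_blinfun_compose])
      from bounded_linear.has_derivative[OF this L(1)]
      have "(\<theta> has_derivative (\<lambda>h. BQ o\<^sub>L (L h o\<^sub>L BG))) (at z)" by (simp add: \<theta>_def[abs_def])
      moreover have "blinfun_apply (BQ o\<^sub>L (L (c *s h) o\<^sub>L BG)) x = c *\<^sub>C blinfun_apply (BQ o\<^sub>L (L h o\<^sub>L BG)) x" for c h x
        by (simp add: BQ L(2) bounded_clinearD(5)[OF Q(1)])
      ultimately show "\<exists>D. (\<theta> has_derivative D) (at z) \<and> (\<forall>c x e. blinfun_apply (D (c *s x)) e = c *\<^sub>C blinfun_apply (D x) e)"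
        by blast
    qed
  next
    show "bounded_multiplier a UNIV ?D \<theta>"
      unfolding bounded_multiplier_def
    proof
      show "\<forall>f\<in>Hs a UNIV. \<exists>g\<in>Hs a ?D. \<forall>z\<in>ball 0 1. Hs_value g z = blinfun_apply (\<theta> z) (Hs_value f z)"
      proof
        fix f :: "'d multi_index \<Rightarrow> ('d multi_index, 'h) ell2" assume "f \<in> Hs a UNIV"
        then obtain y where y: "f = Hs_of y" using Hs_of_surj[OF closed_csubspace_UNIV] by blast
        show "\<exists>g\<in>Hs a ?D. \<forall>z\<in>ball 0 1. Hs_value g z = blinfun_apply (\<theta> z) (Hs_value f z)"
          by (rule bexI[of _ "Hs_of (QX (cadjoint U y))"])
            (simp_all add: y Hs_of_in_Hs[OF D] Qx Q QX_val Hs_value_adj_U \<theta>)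
      qed
      obtain K where K: "\<And>f. norm (cadjoint U f) \<le> K * norm f"
        using bounded_clinear_pos_bound[OF bounded_clinear_cadjoint[OF bounded_clinear_U]] by blast
      show "\<exists>C. \<forall>f\<in>Hs a UNIV. Hs_norm a (mult_op a ?D \<theta> f) \<le> C * Hs_norm a f"
      proof (intro exI ballI)
        fix f :: "'d multi_index \<Rightarrow> ('d multi_index, 'h) ell2" assume "f \<in> Hs a UNIV"
        then obtain y where y: "f = Hs_of y" using Hs_of_surj[OF closed_csubspace_UNIV] by blast
        show "Hs_norm a (mult_op a ?D \<theta> f) \<le> K * Hs_norm a f"
          using order_trans[OF nQX K] by (simp add: y mult Hs_norm_Hs_of)
      qed
    qed
  next
    fix f :: "'d multi_index \<Rightarrow> 'h" assume "f \<in> Hs a ?D"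
    then obtain x where x: "f = Hs_of x" "\<And>\<alpha>. ell2_nth x \<alpha> \<in> ?D" using Hs_of_surj[OF D] by blast
    have 1: "adjoint_on UNIV cinner (Hs_inner a) (V_op a T) f = cadjoint V x"
    proof -
      have ip: "Hs_inner a (V_op a T u) f = cinner u (cadjoint V x)" for u
        by (simp add: x(1) V_op_eq Hs_inner_Hs_of cinner_cadjoint[OF bounded_clinear_V])
      show ?thesis unfolding adjoint_on_def ip by (rule the_equality) (auto intro: cinner_ext[symmetric])
    qed
    have 2: "adjoint_on (Hs a UNIV) (Hs_inner a) (Hs_inner a) (mult_op a ?D \<theta>) f = Hs_of (U x)"
    proof (rule adjoint_on_Hs_eqI[OF closed_csubspace_UNIV])
      fix y
      have "Hs_inner a (mult_op a ?D \<theta> (Hs_of y)) f = cinner (cadjoint U y) (QX x)"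
        by (simp add: mult x(1) Hs_inner_Hs_of QX_herm)
      also have "\<dots> = cinner y (U x)"
        by (simp add: QX_fix[OF x(2)] cinner_cadjoint_left[OF bounded_clinear_U])
      finally show "Hs_inner a (mult_op a ?D \<theta> (Hs_of y)) f = cinner y (U x)" .
    qed simp
    have "ell2_nth (P x) \<alpha> \<in> ?D" for \<alpha>
    proof -
      have "ell2_nth x \<alpha> + (-1) *\<^sub>C ell2_nth (V (cadjoint V x)) \<alpha> \<in> ?D"
        using D x(2) ell2_nth_V_in_defect_space by (simp add: closed_csubspace_def)
      moreover have "(-1) *\<^sub>C u = - u" for u :: 'h using scaleR_scaleC[of "-1" u] by simp
      ultimately show ?thesis by (simp add: P_def minus_ell2.rep_eq)
    qed
    then have "QX (P x) = P x" by (rule QX_fix)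
    then show "(\<lambda>\<alpha>. f \<alpha> - V_op a T (adjoint_on UNIV cinner (Hs_inner a) (V_op a T) f) \<alpha>) =
      mult_op a ?D \<theta> (adjoint_on (Hs a UNIV) (Hs_inner a) (Hs_inner a) (mult_op a ?D \<theta>) f)"
      unfolding 1 2 mult adj_U_U
      by (simp add: fun_eq_iff x(1) V_op_eq Hs_of_def P_def minus_ell2.rep_eq scaleR_diff_right)
  qed
  then show ?thesis by blast
qed

end

theorem theorem3p2:
  fixes s :: "complex ^ 'd::finite \<Rightarrow> complex ^ 'd \<Rightarrow> complex"
    and a :: "nat \<Rightarrow> real"
    and T :: "'d \<Rightarrow> 'h::chilbert_space \<Rightarrow> 'h"
  assumes "unitarily_invariant_CNP_kernel s a"
    and "pure_inv_s_contraction a T"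
  shows "\<exists>(E :: ('d multi_index, 'h) ell2 set)
      (\<theta> :: complex ^ 'd \<Rightarrow> ('d multi_index, 'h) ell2 \<Rightarrow>\<^sub>L 'h).
    characteristic_function a T E \<theta>"
proof -
  interpret pure_contraction a T
    using unitarily_invariant_CNP_kernel_weights[OF assms(1)] assms(2)
    by (intro pure_contraction.intro nonneg_reciprocal.intro nonneg_reciprocal_axioms.intro
        pure_contraction_axioms.intro)
  show ?thesis using characteristic_function_exists by blast
qed

end
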